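(* Let $X$ be a reflexive Banach space such that $X$ and $X^*$ are strictly convex, let $A$ generate a $C_0$-semigroup $\{T(t)\}_{t\ge0}$ on $X$, let $Y$ be a separable Hilbert space (identified with its dual), let $B:Y\to X$ be bounded and linear, and let $x_0,x_b\in X$, $\lambda>0$. Suppose $u\in L^2([a,b],Y)$ is the optimal control for the problem of minimizing $$\|q(b)-x_b\|_X^2+\lambda\int_a^b\|u(t)\|_Y^2\,dt$$ over all $u\in L^2([a,b],Y)$, where $q$ is the unique mild solution, corresponding to $u$, of ${}^{H}D^{\alpha,\beta;\psi}_{a+}q(t)=Aq(t)+Bu(t)$, $t\in[a,b]$, $(I^{1-\gamma;\psi}_{a+}q)(a)=x_0$. Then $$u(t)=\psi'(t)(\Psi(b,t))^{\alpha-1}B^*P_\alpha^*(\Psi(b,t))\,J\big((\lambda I+R(b)J)^{-1}[x_b-S_{\alpha,\beta}(\Psi(b,a))x_0]\big),\qquad t\in[a,b],$$ (equality in $L^2([a,b],Y)$), where $J:X\to X^*$ is the duality mapping and $R(b):X^*\to X$ is $$R(b)=\int_a^b\left\{\psi'(s)(\Psi(b,s))^{\alpha-1}\right\}^2P_\alpha(\Psi(b,s))BB^*P_\alpha^*(\Psi(b,s))\,ds.$$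
   Context: Setting: $-\infty<a<b<\infty$, $\frac12<\alpha\le 1$, $0\le\beta\le 1$, $\gamma=\alpha+\beta(1-\alpha)$; $\psi\in C^1([a,b],\mathbb{R})$ is increasing with $\psi'(t)\ne 0$ for all $t$; $\Psi(t,s)=\psi(t)-\psi(s)$. All vector integrals are Bochner integrals (the integral defining $R(b)$ is in the strong sense). Fractional integral: $I^{\delta;\psi}_{a+}f(t)=\frac{1}{\Gamma(\delta)}\int_a^t\psi'(s)(\Psi(t,s))^{\delta-1}f(s)\,ds$ for $\delta>0$, and $I^{0;\psi}_{a+}f=f$. The $\psi$-Hilfer derivative is ${}^{H}D^{\alpha,\beta;\psi}_{a+}f=I^{\beta(1-\alpha);\psi}_{a+}\left(\frac{1}{\psi'(t)}\frac{d}{dt}\right)I^{(1-\beta)(1-\alpha);\psi}_{a+}f$ (the control system is understood only through the mild solutions below). Operators: for $t>0$, $P_\alpha(t)=\int_0^\infty\alpha\theta M_\alpha(\theta)T(t^\alpha\theta)\,d\theta$, where $M_\alpha(\theta)=\sum_{n=1}^\infty\frac{(-\theta)^{n-1}}{(n-1)!\,\Gamma(1-\alpha n)}$ is the Wright (Mainardi) function for $0<\alpha<1$, and $P_1(t)=T(t)$ when $\alpha=1$; $P_\alpha^*(t)$ is the adjoint of $P_\alpha(t)$; $K_\alpha(t)=t^{\alpha-1}P_\alpha(t)$; $S_{\alpha,\beta}(t)=\frac{1}{\Gamma(\gamma-\alpha)}\int_0^t(t-s)^{\gamma-\alpha-1}K_\alpha(s)\,ds$ (strong integral) if $\gamma>\alpha$,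 and $S_{\alpha,\beta}(t)=K_\alpha(t)$ if $\gamma=\alpha$. Mild solution: for $u\in L^2([a,b],Y)$, the unique mild solution of the linear control system is $q(t)=S_{\alpha,\beta}(\Psi(t,a))x_0+\int_a^t\psi'(s)(\Psi(t,s))^{\alpha-1}P_\alpha(\Psi(t,s))Bu(s)\,ds$, $t\in(a,b]$. Duality mapping: $J(x)=\{x^*\in X^*:\langle x,x^*\rangle=\|x\|_X^2=\|x^*\|_{X^*}^2\}$; it is single-valued since $X^*$ is strictly convex. $R(b)J$ denotes the composition, and $(\lambda I+R(b)J)^{-1}$ the inverse of the (nonlinear) map $\lambda I+R(b)J:X\to X$. *)

theory Defs
  imports "HOL-Analysis.Analysis"
begin

section \<open>Geometry of Banach spaces\<close>

text \<open>
  The dual of a real Banach space \<open>'x\<close> is \<open>'x \<Rightarrow>\<^sub>L real\<close>.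
\<close>

definition reflexive_space :: "'x::real_normed_vector itself \<Rightarrow> bool" where
  "reflexive_space _ \<longleftrightarrow>
     (\<forall>\<phi> :: ('x \<Rightarrow>\<^sub>L real) \<Rightarrow>\<^sub>L real. \<exists>x::'x. \<forall>f. blinfun_apply \<phi> f = blinfun_apply f x)"

definition strictly_convex_space :: "'x::real_normed_vector itself \<Rightarrow> bool" where
  "strictly_convex_space _ \<longleftrightarrow>
     (\<forall>x y :: 'x. norm x = 1 \<and> norm y = 1 \<and> x \<noteq> y \<longrightarrow> norm ((1/2) *\<^sub>R (x + y)) < 1)"

definition duality_set :: "'x::real_normed_vector \<Rightarrow> ('x \<Rightarrow>\<^sub>L real) set" where
  "duality_set x = {f. blinfun_apply f x = (norm x)\<^sup>2 \<and> (norm x)\<^sup>2 = (norm f)\<^sup>2}"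

text \<open>The duality set is a singleton when the dual is strictly convex.\<close>

definition duality_map :: "'x::real_normed_vector \<Rightarrow> ('x \<Rightarrow>\<^sub>L real)" where
  "duality_map x = (THE f. f \<in> duality_set x)"

lift_definition banach_adjoint ::
  "('x::real_normed_vector \<Rightarrow>\<^sub>L 'z::real_normed_vector) \<Rightarrow> ('z \<Rightarrow>\<^sub>L real) \<Rightarrow>\<^sub>L ('x \<Rightarrow>\<^sub>L real)"
  is "\<lambda>L f. f o\<^sub>L L"
  by (rule bounded_bilinear.bounded_linear_left[OF bounded_bilinear_blinfun_compose])

text \<open>
  Adjoint of an operator defined on a Hilbert space that is identified with its dual:
  the functional \<open>f \<circ> B\<close> is replaced by its Riesz representative.
\<close>

definition hilbert_adjoint ::
  "('y::real_inner \<Rightarrow>\<^sub>L 'x::real_normed_vector) \<Rightarrow> ('x \<Rightarrow>\<^sub>L real) \<Rightarrow>\<^sub>L 'y" where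
  "hilbert_adjoint B =
     Blinfun (\<lambda>f. THE y. \<forall>v. inner y v = blinfun_apply f (blinfun_apply B v))"


section \<open>Bochner and strong operator integrals\<close>

text \<open>
  The integral of \<^theory>\<open>HOL-Analysis.Bochner_Integration\<close> is restricted to second countable
  (that is, separable) range spaces.  Below, the range is an arbitrary Banach space; Borel
  measurability is therefore replaced by strong measurability (a.e. limit of simple functions).
  Only complete measures are used, so that \<open>\<lambda>x. norm (f x - s n x)\<close> is measurable.
\<close>

definition has_bochner_int ::
  "'a measure \<Rightarrow> ('a \<Rightarrow> 'x::real_normed_vector) \<Rightarrow> 'x \<Rightarrow> bool" where
  "has_bochner_int M f I \<longleftrightarrow>
     (\<exists>s. (\<forall>n. Bochner_Integration.simple_bochner_integrable M (s n)) \<and>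
          (AE x in M. (\<lambda>n. s n x) \<longlonglongrightarrow> f x) \<and>
          (\<lambda>n. \<integral>\<^sup>+x. norm (f x - s n x) \<partial>M) \<longlonglongrightarrow> 0 \<and>
          (\<lambda>n. Bochner_Integration.simple_bochner_integral M (s n)) \<longlonglongrightarrow> I)"

definition bochner_int :: "'a measure \<Rightarrow> ('a \<Rightarrow> 'x::real_normed_vector) \<Rightarrow> 'x" where
  "bochner_int M f =
     (if \<exists>I. has_bochner_int M f I then THE I. has_bochner_int M f I else 0)"

text \<open>The operator \<open>x \<mapsto> \<integral> F(s) x ds\<close>.\<close>

definition strong_int ::
  "'a measure \<Rightarrow> ('a \<Rightarrow> 'x::real_normed_vector \<Rightarrow>\<^sub>L 'z::real_normed_vector) \<Rightarrow> 'x \<Rightarrow>\<^sub>L 'z" where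
  "strong_int M F = Blinfun (\<lambda>x. bochner_int M (\<lambda>s. blinfun_apply (F s) x))"


section \<open>Semigroups and solution operators\<close>

text \<open>Semigroups are indexed by \<open>real\<close>; only the values at \<open>t \<ge> 0\<close> matter.\<close>

definition C0_semigroup :: "(real \<Rightarrow> 'x::real_normed_vector \<Rightarrow>\<^sub>L 'x) \<Rightarrow> bool" where
  "C0_semigroup T \<longleftrightarrow>
     T 0 = id_blinfun \<and>
     (\<forall>s\<ge>0. \<forall>t\<ge>0. T (s + t) = T s o\<^sub>L T t) \<and>
     (\<forall>x. ((\<lambda>t. blinfun_apply (T t) x) \<longlongrightarrow> x) (at_right 0))"

text \<open>The linear operator \<open>A\<close> with domain \<open>D\<close>; values of \<open>A\<close> outside \<open>D\<close> are irrelevant.\<close>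

definition generates_C0_semigroup ::
  "'x::real_normed_vector set \<Rightarrow> ('x \<Rightarrow> 'x) \<Rightarrow> (real \<Rightarrow> 'x \<Rightarrow>\<^sub>L 'x) \<Rightarrow> bool" where
  "generates_C0_semigroup D A T \<longleftrightarrow>
     C0_semigroup T \<and>
     D = {x. \<exists>y. ((\<lambda>h. (1/h) *\<^sub>R (blinfun_apply (T h) x - x)) \<longlongrightarrow> y) (at_right 0)} \<and>
     (\<forall>x\<in>D. ((\<lambda>h. (1/h) *\<^sub>R (blinfun_apply (T h) x - x)) \<longlongrightarrow> A x) (at_right 0))"

text \<open>
  The Wright function \<open>M\<^sub>\<alpha>\<close>, with summation index shifted to start at \<open>0\<close>; \<^const>\<open>rGamma\<close> is
  \<open>1/\<Gamma>\<close>, extended by \<open>0\<close> to the poles of \<open>\<Gamma>\<close>.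
\<close>

definition wright_M :: "real \<Rightarrow> real \<Rightarrow> real" where
  "wright_M \<alpha> \<theta> = (\<Sum>n. (- \<theta>) ^ n / fact n * rGamma (1 - \<alpha> * real (n + 1)))"

definition P_op ::
  "real \<Rightarrow> (real \<Rightarrow> 'x::real_normed_vector \<Rightarrow>\<^sub>L 'x) \<Rightarrow> real \<Rightarrow> 'x \<Rightarrow>\<^sub>L 'x" where
  "P_op \<alpha> T t =
     (if \<alpha> = 1 then T t
      else strong_int (lebesgue_on {0..})
             (\<lambda>\<theta>. (\<alpha> * \<theta> * wright_M \<alpha> \<theta>) *\<^sub>R T (t powr \<alpha> * \<theta>)))"

definition K_op ::
  "real \<Rightarrow> (real \<Rightarrow> 'x::real_normed_vector \<Rightarrow>\<^sub>L 'x) \<Rightarrow> real \<Rightarrow> 'x \<Rightarrow>\<^sub>L 'x" where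
  "K_op \<alpha> T t = (t powr (\<alpha> - 1)) *\<^sub>R P_op \<alpha> T t"

definition S_op ::
  "real \<Rightarrow> real \<Rightarrow> (real \<Rightarrow> 'x::real_normed_vector \<Rightarrow>\<^sub>L 'x) \<Rightarrow> real \<Rightarrow> 'x \<Rightarrow>\<^sub>L 'x" where
  "S_op \<alpha> \<beta> T t =
     (let \<gamma> = \<alpha> + \<beta> * (1 - \<alpha>) in
      if \<gamma> > \<alpha>
      then (1 / Gamma (\<gamma> - \<alpha>)) *\<^sub>R
             strong_int (lebesgue_on {0..t}) (\<lambda>s. ((t - s) powr (\<gamma> - \<alpha> - 1)) *\<^sub>R K_op \<alpha> T s)
      else K_op \<alpha> T t)"


section \<open>The control problem\<close>

text \<open>In what follows \<open>\<psi>'\<close> is the derivative of \<open>\<psi>\<close>.\<close>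

definition L2_control :: "real \<Rightarrow> real \<Rightarrow> (real \<Rightarrow> 'y::real_normed_vector) \<Rightarrow> bool" where
  "L2_control a b u \<longleftrightarrow>
     u \<in> borel_measurable (lebesgue_on {a..b}) \<and>
     integrable (lebesgue_on {a..b}) (\<lambda>t. (norm (u t))\<^sup>2)"

definition mild_solution ::
  "real \<Rightarrow> real \<Rightarrow> (real \<Rightarrow> real) \<Rightarrow> (real \<Rightarrow> real) \<Rightarrow> (real \<Rightarrow> 'x::real_normed_vector \<Rightarrow>\<^sub>L 'x) \<Rightarrow>
   ('y::real_normed_vector \<Rightarrow>\<^sub>L 'x) \<Rightarrow> real \<Rightarrow> 'x \<Rightarrow> (real \<Rightarrow> 'y) \<Rightarrow> real \<Rightarrow> 'x" where
  "mild_solution \<alpha> \<beta> \<psi> \<psi>' T B a x0 u t =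
     blinfun_apply (S_op \<alpha> \<beta> T (\<psi> t - \<psi> a)) x0 +
     bochner_int (lebesgue_on {a..t})
       (\<lambda>s. (\<psi>' s * (\<psi> t - \<psi> s) powr (\<alpha> - 1)) *\<^sub>R
              blinfun_apply (P_op \<alpha> T (\<psi> t - \<psi> s)) (blinfun_apply B (u s)))"

definition cost ::
  "real \<Rightarrow> real \<Rightarrow> 'x \<Rightarrow> real \<Rightarrow> (real \<Rightarrow> 'x::real_normed_vector) \<Rightarrow>
   (real \<Rightarrow> 'y::real_normed_vector) \<Rightarrow> real" where
  "cost a b xb lam q u =
     (norm (q b - xb))\<^sup>2 + lam * (\<integral>t. (norm (u t))\<^sup>2 \<partial>(lebesgue_on {a..b}))"

definition optimal_control ::
  "real \<Rightarrow> real \<Rightarrow> (real \<Rightarrow> real) \<Rightarrow> (real \<Rightarrow> real) \<Rightarrow> (real \<Rightarrow> 'x::real_normed_vector \<Rightarrow>\<^sub>L 'x) \<Rightarrow>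
   ('y::real_normed_vector \<Rightarrow>\<^sub>L 'x) \<Rightarrow> real \<Rightarrow> real \<Rightarrow> 'x \<Rightarrow> 'x \<Rightarrow> real \<Rightarrow> (real \<Rightarrow> 'y) \<Rightarrow> bool" where
  "optimal_control \<alpha> \<beta> \<psi> \<psi>' T B a b x0 xb lam u \<longleftrightarrow>
     L2_control a b u \<and>
     (\<forall>v. L2_control a b v \<longrightarrow>
        cost a b xb lam (mild_solution \<alpha> \<beta> \<psi> \<psi>' T B a x0 u) u
        \<le> cost a b xb lam (mild_solution \<alpha> \<beta> \<psi> \<psi>' T B a x0 v) v)"

definition R_op ::
  "real \<Rightarrow> (real \<Rightarrow> real) \<Rightarrow> (real \<Rightarrow> real) \<Rightarrow> (real \<Rightarrow> 'x::real_normed_vector \<Rightarrow>\<^sub>L 'x) \<Rightarrow>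
   ('y::real_inner \<Rightarrow>\<^sub>L 'x) \<Rightarrow> real \<Rightarrow> real \<Rightarrow> ('x \<Rightarrow>\<^sub>L real) \<Rightarrow>\<^sub>L 'x" where
  "R_op \<alpha> \<psi> \<psi>' T B a b =
     strong_int (lebesgue_on {a..b})
       (\<lambda>s. ((\<psi>' s * (\<psi> b - \<psi> s) powr (\<alpha> - 1))\<^sup>2) *\<^sub>R
              (P_op \<alpha> T (\<psi> b - \<psi> s) o\<^sub>L B o\<^sub>L hilbert_adjoint B o\<^sub>L
               banach_adjoint (P_op \<alpha> T (\<psi> b - \<psi> s))))"

end

theory Submission
  imports Defs "HOL-Complex_Analysis.Complex_Analysis" "HOL-Real_Asymp.Real_Asymp"
begin

text \<open>
  At the final time the state is \<open>q(b) = S x\<^sub>0 + L u\<close>, where \<open>S\<close> stands for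
  \<open>S\<^sub>\<alpha>\<^sub>,\<^sub>\<beta>(\<psi> b - \<psi> a)\<close> and \<open>L\<close> is linear from \<open>L\<^sup>2\<close> to the state space.  With
  \<open>z = x\<^sub>b - S x\<^sub>0\<close> and \<open>y = z - L u\<close> the cost is \<open>\<parallel>y\<parallel>\<^sup>2 + \<lambda> \<parallel>u\<parallel>\<^sup>2\<close>.  Because the dual is
  strictly convex, half the squared norm has the duality mapping \<open>J\<close> as Gateaux derivative
  (\<open>duality_map_Gateaux\<close>), so an optimal \<open>u\<close> satisfies \<open>\<lambda> u = L\<^sup>* J y\<close>.  Since \<open>R(b) = L L\<^sup>*\<close>, this
  gives \<open>\<lambda> L u = R(b) J y\<close>; as \<open>J\<close> is homogeneous, \<open>x = y / \<lambda>\<close> solves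
  \<open>\<lambda> x + R(b) J x = z\<close>, and \<open>u = L\<^sup>* J x\<close>.  The map \<open>\<lambda> I + R(b) J\<close> is injective because
  \<open>R(b)\<close> is nonnegative and \<open>J\<close> is strictly monotone (\<open>duality_map_strictly_monotone\<close>), so \<open>x\<close> is the
  value of its inverse at \<open>z\<close>.  This argument is \<open>optimal_control_feedback\<close>.

  For it to apply, the operators must be given by genuine integrals and \<open>t \<mapsto> P\<^sub>\<alpha>(t)\<close> must be strongly
  continuous and bounded (\<open>P_op_strongly_continuous\<close>).  A semigroup may grow exponentially, so
  the Wright function has to decay faster than every exponential.  Its power series does not show this.
  Written as the imaginary part of an integral of \<open>exp (\<sigma> - \<theta> \<sigma>\<^sup>\<alpha>) \<sigma>\<^sup>\<alpha>\<^sup>-\<^sup>1\<close> along a ray, it can be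
  estimated after the ray has been shifted to the right, and the size of the shift determines the rate of
  decay (\<open>wright_M_exponential_decay\<close>).

  The functional-analytic basis is the Hahn-Banach theorem, proved through minimal sublinear
  functionals: it provides the duality mapping and its differentiability, and it reduces statements
  about Bochner integrals to real integrals (\<open>bochner_int_functional\<close>).
\<close>

section \<open>The Hahn-Banach theorem\<close>

definition sublinear :: "('x::real_vector \<Rightarrow> real) \<Rightarrow> bool" where
  "sublinear p \<longleftrightarrow> (\<forall>x y. p (x + y) \<le> p x + p y) \<and> (\<forall>c>0. \<forall>x. p (c *\<^sub>R x) = c * p x)"

lemma sublinearI:
  assumes "\<And>x y. p (x + y) \<le> p x + p y" and "\<And>c x. c > 0 \<Longrightarrow> c * p x \<le> p (c *\<^sub>R x)"
  shows "sublinear p"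
proof -
  have "p (c *\<^sub>R x) = c * p x" if c: "c > 0" for c x
  proof -
    have "inverse c * p (c *\<^sub>R x) \<le> p (inverse c *\<^sub>R (c *\<^sub>R x))"
      using assms(2)[of "inverse c" "c *\<^sub>R x"] c by simp
    then have "inverse c * p (c *\<^sub>R x) \<le> p x" using c by simp
    then have "p (c *\<^sub>R x) \<le> c * p x" using c by (simp add: field_simps)
    with assms(2)[OF c, of x] show ?thesis by simp
  qed
  with assms(1) show ?thesis by (simp add: sublinear_def)
qed

lemma sublinear_add: "sublinear p \<Longrightarrow> p (x + y) \<le> p x + p y"
  and sublinear_scale: "sublinear p \<Longrightarrow> c > 0 \<Longrightarrow> p (c *\<^sub>R x) = c * p x"
  by (simp_all add: sublinear_def)

lemma sublinear_zero: "sublinear p \<Longrightarrow> p 0 = 0"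
  using sublinear_scale[of p 2 0] by simp

lemma sublinear_minus: "sublinear p \<Longrightarrow> - p (- x) \<le> p x"
  using sublinear_add[of p x "- x"] sublinear_zero[of p] by simp

text \<open>
  A sublinear minorant of \<open>p\<close> whose value at \<open>- h\<close> is at most \<open>- p h\<close> (take \<open>t = 1\<close>).  A linear
  functional below \<open>tilt p h\<close> therefore has to touch \<open>p\<close> at \<open>h\<close>.
\<close>

definition tilt :: "('x::real_vector \<Rightarrow> real) \<Rightarrow> 'x \<Rightarrow> 'x \<Rightarrow> real" where
  "tilt p h x = (INF t\<in>{0..}. p (x + t *\<^sub>R h) - t * p h)"

lemma tilt_bdd:
  assumes p: "sublinear p"
  shows "bdd_below ((\<lambda>t. p (x + t *\<^sub>R h) - t * p h) ` {0..})"
proof (rule bdd_belowI2)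
  fix t :: real assume "t \<in> {0..}"
  then have "t * p h = p (t *\<^sub>R h)"
    using sublinear_scale[OF p, of t h] sublinear_zero[OF p] by (cases "t = 0") auto
  also have "\<dots> \<le> p (x + t *\<^sub>R h) + p (- x)"
    using sublinear_add[OF p, of "x + t *\<^sub>R h" "- x"] by simp
  finally show "- p (- x) \<le> p (x + t *\<^sub>R h) - t * p h" by simp
qed

lemma tilt_le:
  assumes "sublinear p" "t \<ge> 0"
  shows "tilt p h x \<le> p (x + t *\<^sub>R h) - t * p h"
  unfolding tilt_def by (rule cINF_lower[OF tilt_bdd]) (use assms in auto)

lemma sublinear_tilt:
  assumes p: "sublinear p"
  shows "sublinear (tilt p h)"
proof (rule sublinearI)
  fix x y
  have "tilt p h (x + y) - (p (y + s *\<^sub>R h) - s * p h) \<le> tilt p h x" if s: "s \<ge> 0" for s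
    unfolding tilt_def[of p h x]
  proof (rule cINF_greatest)
    fix t :: real assume t: "t \<in> {0..}"
    have "tilt p h (x + y) \<le> p ((x + y) + (t + s) *\<^sub>R h) - (t + s) * p h"
      using tilt_le[OF p] t s by simp
    also have "p ((x + y) + (t + s) *\<^sub>R h) \<le> p (x + t *\<^sub>R h) + p (y + s *\<^sub>R h)"
      using sublinear_add[OF p, of "x + t *\<^sub>R h" "y + s *\<^sub>R h"] by (simp add: algebra_simps)
    finally show "tilt p h (x + y) - (p (y + s *\<^sub>R h) - s * p h) \<le> p (x + t *\<^sub>R h) - t * p h"
      by (simp add: algebra_simps)
  qed simp
  then have "tilt p h (x + y) - tilt p h x \<le> p (y + s *\<^sub>R h) - s * p h" if "s \<ge> 0" for s
    using that by (simp add: algebra_simps)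
  then have "tilt p h (x + y) - tilt p h x \<le> tilt p h y"
    unfolding tilt_def[of p h y] by (intro cINF_greatest) auto
  then show "tilt p h (x + y) \<le> tilt p h x + tilt p h y" by simp
next
  fix c :: real and x assume c: "c > 0"
  show "c * tilt p h x \<le> tilt p h (c *\<^sub>R x)"
    unfolding tilt_def[of p h "c *\<^sub>R x"]
  proof (rule cINF_greatest)
    fix t :: real assume t: "t \<in> {0..}"
    have "c * tilt p h x \<le> c * (p (x + (t / c) *\<^sub>R h) - t / c * p h)"
      using tilt_le[OF p, of "t / c" h x] t c by simp
    also have "\<dots> = p (c *\<^sub>R x + t *\<^sub>R h) - t * p h"
      using sublinear_scale[OF p c, of "x + (t / c) *\<^sub>R h"] c by (simp add: algebra_simps)
    finally show "c * tilt p h x \<le> p (c *\<^sub>R x + t *\<^sub>R h) - t * p h" .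
  qed simp
qed

text \<open>
  A minimal sublinear functional coincides with all of its tilts, and for \<open>t = 1\<close> the bound on the
  tilt becomes superadditivity.
\<close>

lemma minimal_sublinear_linear:
  assumes q: "sublinear q"
    and min: "\<And>r. sublinear r \<Longrightarrow> (\<And>x. r x \<le> q x) \<Longrightarrow> r = q"
  shows "linear q"
proof -
  have tq: "tilt q y = q" for y
    using tilt_le[OF q, of 0 y] by (intro min sublinear_tilt[OF q]) auto
  have super: "q x + q y \<le> q (x + y)" for x y
    using tilt_le[OF q, of 1 y x] tq[of y] by simp
  have add: "q (x + y) = q x + q y" for x y
    using super sublinear_add[OF q] by (intro antisym) auto
  have neg: "q (- x) = - q x" for x
    using add[of x "- x"] sublinear_zero[OF q] by simp
  have "q (c *\<^sub>R x) = c * q x" for c x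
  proof -
    consider "c > 0" | "c = 0" | "- c > 0" by linarith
    then show ?thesis
    proof cases
      case 3
      then have "q ((- c) *\<^sub>R x) = (- c) * q x" by (rule sublinear_scale[OF q])
      with neg[of "c *\<^sub>R x"] show ?thesis by simp
    qed (use sublinear_scale[OF q] sublinear_zero[OF q] in auto)
  qed
  with add show ?thesis by (intro linearI) auto
qed

text \<open>
  Zorn's lemma for the reversed pointwise order.  The pointwise infimum of a chain is finite because
  every sublinear \<open>q\<close> below \<open>p\<close> satisfies \<open>- p (- x) \<le> q x\<close>; it is subadditive because two members
  of a chain have a common lower bound in the chain.
\<close>

lemma exists_minimal_sublinear:
  assumes p: "sublinear p"
  shows "\<exists>q. sublinear q \<and> (\<forall>x. q x \<le> p x) \<and>
             (\<forall>r. sublinear r \<longrightarrow> (\<forall>x. r x \<le> q x) \<longrightarrow> r = q)"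
proof -
  define A where "A = {q. sublinear q \<and> (\<forall>x. q x \<le> p x)}"
  let ?R = "\<lambda>q r. \<forall>x. r x \<le> q x"
  have po: "partial_order_on A (relation_of ?R A)"
    by (rule partial_order_on_relation_ofI) (auto intro: order_trans intro!: ext antisym)
  have "\<exists>m\<in>A. \<forall>r\<in>A. ?R m r \<longrightarrow> r = m"
  proof (rule predicate_Zorn[OF po])
    fix C assume "C \<in> Chains (relation_of ?R A)"
    then have CA: "C \<subseteq> A" and total: "\<And>q r. q \<in> C \<Longrightarrow> r \<in> C \<Longrightarrow> ?R q r \<or> ?R r q"
      by (auto simp: Chains_def relation_of_def)
    show "\<exists>u\<in>A. \<forall>q\<in>C. ?R q u"
    proof (cases "C = {}")
      case True
      with p show ?thesis by (auto simp: A_def)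
    next
      case False
      define u where "u x = (INF q\<in>C. q x)" for x
      have bdd: "bdd_below ((\<lambda>q. q x) ` C)" for x
      proof (rule bdd_belowI2)
        fix q assume "q \<in> C"
        with CA have "sublinear q" "q (- x) \<le> p (- x)" by (auto simp: A_def)
        with sublinear_minus[of q x] show "- p (- x) \<le> q x" by linarith
      qed
      have lower: "u x \<le> q x" if "q \<in> C" for q x
        unfolding u_def using bdd that by (rule cINF_lower)
      have greatest: "m \<le> u x" if "\<And>q. q \<in> C \<Longrightarrow> m \<le> q x" for m x
        unfolding u_def using False that by (rule cINF_greatest)
      have "sublinear u"
      proof (rule sublinearI)
        fix x y
        have le: "u (x + y) \<le> q x + r y" if qr: "q \<in> C" "r \<in> C" for q r
        proof -
          from total[OF qr] obtain s where s: "s \<in> C" "\<And>x. s x \<le> q x" "\<And>x. s x \<le> r x"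
            using qr by blast
          have "u (x + y) \<le> s (x + y)" using s(1) by (rule lower)
          also have "\<dots> \<le> s x + s y" using s(1) CA by (auto simp: A_def intro: sublinear_add)
          also have "\<dots> \<le> q x + r y" using s(2,3) by (intro add_mono)
          finally show ?thesis .
        qed
        have "u (x + y) - r y \<le> u x" if "r \<in> C" for r
          using le[OF _ that] by (intro greatest) (simp add: algebra_simps)
        then have "u (x + y) - u x \<le> u y"
          by (intro greatest) (simp add: algebra_simps)
        then show "u (x + y) \<le> u x + u y" by simp
      next
        fix c :: real and x assume c: "c > 0"
        show "c * u x \<le> u (c *\<^sub>R x)"
        proof (rule greatest)
          fix q assume "q \<in> C"
          with CA c lower[OF this, of x] show "c * u x \<le> q (c *\<^sub>R x)"
            by (auto simp: A_def sublinear_scale)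
        qed
      qed
      moreover have "u x \<le> p x" for x
      proof -
        obtain q where "q \<in> C" using False by blast
        with lower[OF this, of x] CA show ?thesis by (auto simp: A_def intro: order_trans)
      qed
      ultimately show ?thesis using lower by (auto simp: A_def)
    qed
  qed
  then obtain m where "m \<in> A" and *: "\<And>r. r \<in> A \<Longrightarrow> ?R m r \<Longrightarrow> r = m" by blast
  then show ?thesis
    by (intro exI[of _ m]) (auto simp: A_def intro: order_trans)
qed

text \<open>
  Any minimal sublinear functional below \<open>tilt p h\<close> will do: it is linear, and the tilt forces its
  value at \<open>h\<close>.
\<close>

theorem Hahn_Banach_touching:
  assumes p: "sublinear p"
  shows "\<exists>f. linear f \<and> (\<forall>x. f x \<le> p x) \<and> f h = p h"
proof -
  obtain f where f: "sublinear f" "\<And>x. f x \<le> tilt p h x"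
      "\<And>r. sublinear r \<Longrightarrow> (\<And>x. r x \<le> f x) \<Longrightarrow> r = f"
    using exists_minimal_sublinear[OF sublinear_tilt[OF p, of h]] by blast
  have lin: "linear f" using f(1,3) by (rule minimal_sublinear_linear)
  have le: "f x \<le> p x" for x
    using f(2)[of x] tilt_le[OF p, of 0 h x] by simp
  have "- f h \<le> - p h"
    using f(2)[of "- h"] tilt_le[OF p, of 1 h "- h"] sublinear_zero[OF p] linear_neg[OF lin, of h]
    by simp
  with le[of h] have "f h = p h" by simp
  with lin le show ?thesis by blast
qed

corollary Hahn_Banach_blinfun:
  fixes p :: "'x::real_normed_vector \<Rightarrow> real"
  assumes p: "sublinear p" and bound: "\<And>x. p x \<le> C * norm x" and C: "C \<ge> 0"
  obtains f :: "'x \<Rightarrow>\<^sub>L real"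
  where "\<And>x. f x \<le> p x" "f h = p h" "norm f \<le> C"
proof -
  obtain f where f: "linear f" "\<And>x. f x \<le> p x" "f h = p h"
    using Hahn_Banach_touching[OF p, of h] by blast
  have abs: "norm (f x) \<le> C * norm x" for x
    using f(2)[of x] f(2)[of "- x"] bound[of x] bound[of "- x"] linear_neg[OF f(1), of x]
    by (simp add: abs_le_iff)
  have bl: "bounded_linear f"
    using f(1) abs by (auto intro!: bounded_linear_intro[where K = C] simp: linear_add linear_scale mult.commute)
  have eq: "blinfun_apply (Blinfun f) = f" by (rule bounded_linear_Blinfun_apply[OF bl])
  show ?thesis
  proof (rule that[of "Blinfun f"])
    show "norm (Blinfun f) \<le> C" using abs C by (intro norm_blinfun_bound) (auto simp: eq)
  qed (use f in \<open>auto simp: eq\<close>)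
qed

lemma exists_norming_functional:
  fixes x :: "'x::real_normed_vector"
  obtains f :: "'x \<Rightarrow>\<^sub>L real" where "f x = norm x" "norm f \<le> 1"
proof -
  have "sublinear (norm :: 'x \<Rightarrow> real)" by (rule sublinearI) (auto simp: norm_triangle_ineq)
  from Hahn_Banach_blinfun[OF this, of 1 x] that show ?thesis by auto
qed

text \<open>
  The continuous functionals separate points.  Identities between vector-valued integrals are
  obtained below by applying functionals, which turns them into identities between real integrals.
\<close>

lemma eq_if_functionals_eq:
  fixes x y :: "'x::real_normed_vector"
  assumes "\<And>f :: 'x \<Rightarrow>\<^sub>L real. f x = f y"
  shows "x = y"
proof -
  obtain f :: "'x \<Rightarrow>\<^sub>L real" where "f (x - y) = norm (x - y)" by (rule exists_norming_functional)
  with assms[of f] show ?thesis by (simp add: blinfun.diff_right)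
qed

section \<open>The duality mapping\<close>

lemma duality_set_nonempty:
  fixes x :: "'x::real_normed_vector"
  shows "\<exists>f. f \<in> duality_set x"
proof -
  obtain f :: "'x \<Rightarrow>\<^sub>L real" where f: "f x = norm x" "norm f \<le> 1" by (rule exists_norming_functional)
  have *: "norm x * norm f = norm x"
  proof -
    have "norm x \<le> norm f * norm x" using norm_blinfun[of f x] f(1) by simp
    moreover have "norm f * norm x \<le> 1 * norm x" by (rule mult_right_mono) (use f in auto)
    ultimately show ?thesis by (simp add: mult.commute)
  qed
  have "(norm x)\<^sup>2 = (norm (norm x *\<^sub>R f))\<^sup>2"
    unfolding norm_scaleR using * by simp
  with f(1) have "norm x *\<^sub>R f \<in> duality_set x"
    by (simp add: duality_set_def blinfun.scaleR_left power2_eq_square)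
  then show ?thesis ..
qed

lemma duality_set_iff:
  "f \<in> duality_set x \<longleftrightarrow> blinfun_apply f x = (norm x)\<^sup>2 \<and> norm f = norm x"
  by (auto simp: duality_set_def)

text \<open>Strict convexity, rescaled from the unit sphere to a sphere of arbitrary radius.\<close>

lemma strictly_convex_eq:
  fixes x y :: "'x::real_normed_vector"
  assumes "strictly_convex_space TYPE('x)"
    and "norm x = r" "norm y = r" "norm (x + y) \<ge> 2 * r"
  shows "x = y"
proof (cases "r = 0")
  case False
  with assms(2) have r: "r > 0" using norm_ge_zero[of x] by linarith
  have "\<not> norm ((1/2) *\<^sub>R ((1/r) *\<^sub>R x + (1/r) *\<^sub>R y)) < 1"
  proof -
    have "(1/2) *\<^sub>R ((1/r) *\<^sub>R x + (1/r) *\<^sub>R y) = (1 / (2 * r)) *\<^sub>R (x + y)"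
      by (simp add: scaleR_add_right)
    then have "norm ((1/2) *\<^sub>R ((1/r) *\<^sub>R x + (1/r) *\<^sub>R y)) = norm (x + y) / (2 * r)"
      using r by simp
    with assms(4) r show ?thesis by simp
  qed
  with assms(1-3) r have "(1/r) *\<^sub>R x = (1/r) *\<^sub>R y"
    unfolding strictly_convex_space_def by (metis divide_self_if less_irrefl mult.commute
      norm_scaleR abs_of_pos zero_less_divide_1_iff times_divide_eq_right mult.right_neutral)
  with r show ?thesis by simp
qed (use assms in auto)

text \<open>
  Two elements of the duality set have norm \<open>norm x\<close>, and their sum takes the largest possible value
  at \<open>x\<close>; so it has norm \<open>2 * norm x\<close>, which strict convexity of the dual allows only if they are equal.
\<close>

lemma duality_set_unique:
  fixes x :: "'x::real_normed_vector"
  assumes sc: "strictly_convex_space TYPE('x \<Rightarrow>\<^sub>L real)"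
    and "f \<in> duality_set x" "g \<in> duality_set x"
  shows "f = g"
proof (rule strictly_convex_eq[OF sc])
  show "norm f = norm x" "norm g = norm x" using assms by (auto simp: duality_set_iff)
  have "2 * norm x * norm x = (f + g) x"
    using assms(2,3) by (simp add: duality_set_iff blinfun.add_left power2_eq_square)
  also have "\<dots> \<le> norm (f + g) * norm x" using norm_blinfun[of "f + g" x] by simp
  finally show "2 * norm x \<le> norm (f + g)"
    by (cases "x = 0") auto
qed

lemma duality_map_mem:
  fixes x :: "'x::real_normed_vector"
  assumes "strictly_convex_space TYPE('x \<Rightarrow>\<^sub>L real)"
  shows "duality_map x \<in> duality_set x"
  unfolding duality_map_def
  by (rule theI') (use duality_set_nonempty[of x] duality_set_unique[OF assms] in blast)

lemma duality_map_eqI: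
  fixes x :: "'x::real_normed_vector"
  assumes "strictly_convex_space TYPE('x \<Rightarrow>\<^sub>L real)" "f \<in> duality_set x"
  shows "duality_map x = f"
  using duality_map_mem duality_set_unique assms by blast

lemma duality_map_scaleR:
  fixes x :: "'x::real_normed_vector"
  assumes sc: "strictly_convex_space TYPE('x \<Rightarrow>\<^sub>L real)"
  shows "duality_map (c *\<^sub>R x) = c *\<^sub>R duality_map x"
  using duality_map_mem[OF sc, of x]
  by (intro duality_map_eqI[OF sc])
     (auto simp: duality_set_iff blinfun.scaleR_left blinfun.scaleR_right power2_eq_square)

text \<open>
  With \<open>f\<close> and \<open>g\<close> the duality functionals of \<open>x\<close> and \<open>y\<close>, the pairing \<open>(f - g) (x - y)\<close> is at
  least \<open>(norm x - norm y)\<^sup>2\<close>.  If it is not positive, then \<open>x\<close> and \<open>y\<close> have the same norm and \<open>f\<close>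
  attains its norm at both, hence at their midpoint; strict convexity of the space identifies them.
\<close>

lemma duality_map_strictly_monotone:
  fixes x y :: "'x::real_normed_vector"
  assumes sc: "strictly_convex_space TYPE('x)" and sc': "strictly_convex_space TYPE('x \<Rightarrow>\<^sub>L real)"
    and le: "(duality_map x - duality_map y) (x - y) \<le> 0"
  shows "x = y"
proof -
  let ?f = "duality_map x" and ?g = "duality_map y"
  have f: "?f x = (norm x)\<^sup>2" "norm ?f = norm x" and g: "?g y = (norm y)\<^sup>2" "norm ?g = norm y"
    using duality_map_mem[OF sc'] by (auto simp: duality_set_iff)
  have fy: "?f y \<le> norm x * norm y" and gx: "?g x \<le> norm x * norm y"
    using norm_blinfun[of ?f y] norm_blinfun[of ?g x] f g by (auto simp: mult.commute)
  have le': "(norm x)\<^sup>2 + (norm y)\<^sup>2 \<le> ?f y + ?g x"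
    using le f g by (simp add: blinfun.diff_left blinfun.diff_right)
  with fy gx have "(norm x - norm y)\<^sup>2 \<le> 0" by (simp add: power2_diff)
  then have eq: "norm x = norm y" by simp
  with le' fy gx have "?f y = norm x * norm x" by (simp add: power2_eq_square)
  with f have "2 * norm x * norm x = ?f (x + y)" by (simp add: blinfun.add_right power2_eq_square)
  also have "\<dots> \<le> norm x * norm (x + y)" using norm_blinfun[of ?f "x + y"] f by simp
  finally have "norm x * (2 * norm x) \<le> norm x * norm (x + y)" by (simp add: mult_ac)
  then have "2 * norm x \<le> norm (x + y)" by (cases "x = 0") auto
  then show ?thesis using eq by (intro strictly_convex_eq[OF sc, of x "norm x"]) auto
qed

lemma quotient_step_le:
  fixes v :: "'x::real_normed_vector"
  assumes "e > 0"
  shows "e / ((norm v)\<^sup>2 + 1) * (norm v)\<^sup>2 \<le> e"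
proof -
  have "0 < (norm v)\<^sup>2 + 1" by (simp add: add_nonneg_pos)
  then have "e / ((norm v)\<^sup>2 + 1) * ((norm v)\<^sup>2 + 1) = e" by simp
  moreover have "e / ((norm v)\<^sup>2 + 1) * (norm v)\<^sup>2 \<le> e / ((norm v)\<^sup>2 + 1) * ((norm v)\<^sup>2 + 1)"
    using assms by (intro mult_left_mono) auto
  ultimately show ?thesis by simp
qed

lemma norm_convex_comb_power2:
  fixes x y :: "'x::real_normed_vector"
  assumes "l \<ge> 0" "m \<ge> 0" "l + m = 1"
  shows "(norm (l *\<^sub>R x + m *\<^sub>R y))\<^sup>2 \<le> l * (norm x)\<^sup>2 + m * (norm y)\<^sup>2"
proof -
  have "norm (l *\<^sub>R x + m *\<^sub>R y) \<le> l * norm x + m * norm y"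
    using norm_triangle_ineq[of "l *\<^sub>R x" "m *\<^sub>R y"] assms by simp
  then have "(norm (l *\<^sub>R x + m *\<^sub>R y))\<^sup>2 \<le> (l * norm x + m * norm y)\<^sup>2"
    by (rule power_mono) simp
  also have "\<dots> = l * (norm x)\<^sup>2 + m * (norm y)\<^sup>2 - l * m * (norm x - norm y)\<^sup>2"
  proof -
    have m: "m = 1 - l" using assms by simp
    show ?thesis unfolding m by (simp add: power2_eq_square algebra_simps)
  qed
  also have "\<dots> \<le> l * (norm x)\<^sup>2 + m * (norm y)\<^sup>2" using assms by simp
  finally show ?thesis .
qed

definition half_sq_quot :: "'x::real_normed_vector \<Rightarrow> 'x \<Rightarrow> real \<Rightarrow> real" where
  "half_sq_quot y h t = ((norm (y + t *\<^sub>R h))\<^sup>2 - (norm y)\<^sup>2) / (2 * t)"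

text \<open>The difference quotients of a convex function increase with the step.\<close>

lemma half_sq_quot_mono:
  assumes "0 < s" "s \<le> t"
  shows "half_sq_quot y h s \<le> half_sq_quot y h t"
proof -
  have eq: "y + s *\<^sub>R h = (1 - s / t) *\<^sub>R y + (s / t) *\<^sub>R (y + t *\<^sub>R h)"
    using assms by (simp add: algebra_simps)
  have "(norm (y + s *\<^sub>R h))\<^sup>2 \<le> (1 - s / t) * (norm y)\<^sup>2 + (s / t) * (norm (y + t *\<^sub>R h))\<^sup>2"
    unfolding eq by (rule norm_convex_comb_power2) (use assms in auto)
  then have "(norm (y + s *\<^sub>R h))\<^sup>2 - (norm y)\<^sup>2 \<le> s / t * ((norm (y + t *\<^sub>R h))\<^sup>2 - (norm y)\<^sup>2)"
    by (simp add: algebra_simps)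
  with assms show ?thesis by (simp add: half_sq_quot_def field_simps)
qed

lemma half_sq_quot_lower:
  fixes y :: "'x::real_normed_vector"
  assumes "f \<in> duality_set y" "t > 0"
  shows "blinfun_apply f h \<le> half_sq_quot y h t"
proof -
  have "(norm y)\<^sup>2 + t * f h = f (y + t *\<^sub>R h)"
    using assms by (simp add: duality_set_iff blinfun.add_right blinfun.scaleR_right)
  also have "\<dots> \<le> norm y * norm (y + t *\<^sub>R h)"
    using norm_blinfun[of f "y + t *\<^sub>R h"] assms by (simp add: duality_set_iff)
  also have "\<dots> \<le> ((norm y)\<^sup>2 + (norm (y + t *\<^sub>R h))\<^sup>2) / 2"
    using sum_squares_bound[of "norm y" "norm (y + t *\<^sub>R h)"] by simp
  finally show ?thesis using assms by (simp add: half_sq_quot_def field_simps)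
qed

text \<open>
  The right-hand side is the one-sided directional derivative of \<open>\<lambda>x. (norm x)\<^sup>2 / 2\<close> at \<open>y\<close>, a
  sublinear function of the direction.  Every linear functional below it belongs to the duality set
  of \<open>y\<close>, and Hahn-Banach supplies one that touches it in the direction \<open>h\<close>.  The duality set being a
  singleton, it is the same functional for all \<open>h\<close>.
\<close>

lemma duality_map_Gateaux:
  fixes y h :: "'x::real_normed_vector"
  assumes sc: "strictly_convex_space TYPE('x \<Rightarrow>\<^sub>L real)"
  shows "duality_map y h = (INF t\<in>{0<..}. half_sq_quot y h t)"
proof -
  define p where "p k = (INF t\<in>{0<..}. half_sq_quot y k t)" for k
  note J = half_sq_quot_lower[OF duality_map_mem[OF sc, of y]]
  have bdd: "bdd_below (half_sq_quot y k ` {0<..})" for k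
    by (rule bdd_belowI2[of _ "duality_map y k"]) (use J in auto)
  have lower: "p k \<le> half_sq_quot y k t" if "t > 0" for k t
    unfolding p_def using that by (intro cINF_lower[OF bdd]) auto
  have greatest: "m \<le> p k" if "\<And>t. t > 0 \<Longrightarrow> m \<le> half_sq_quot y k t" for m k
    unfolding p_def using that by (intro cINF_greatest) auto
  have scaled: "2 * t * half_sq_quot y k t = (norm (y + t *\<^sub>R k))\<^sup>2 - (norm y)\<^sup>2" if "t > 0" for t k
    using that by (simp add: half_sq_quot_def)
  have sub: "sublinear p"
  proof (rule sublinearI)
    fix k l
    \<comment> \<open>A step of length \<open>r\<close> along \<open>k + l\<close> ends at a convex combination of the end points of a step \<open>s\<close>
        along \<open>k\<close> and a step \<open>t\<close> along \<open>l\<close>.\<close>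
    have le: "p (k + l) \<le> half_sq_quot y k s + half_sq_quot y l t" if st: "s > 0" "t > 0" for s t
    proof -
      define r where "r = s * t / (s + t)"
      have r: "r > 0" using st by (simp add: r_def)
      have eq: "y + r *\<^sub>R (k + l) = (t / (s + t)) *\<^sub>R (y + s *\<^sub>R k) + (s / (s + t)) *\<^sub>R (y + t *\<^sub>R l)"
      proof -
        have "(t / (s + t)) *\<^sub>R y + (s / (s + t)) *\<^sub>R y = y"
          using st by (simp flip: scaleR_add_left add_divide_distrib add: add.commute)
        then show ?thesis by (simp add: r_def scaleR_add_right mult.commute)
      qed
      have "(norm (y + r *\<^sub>R (k + l)))\<^sup>2
          \<le> t / (s + t) * (norm (y + s *\<^sub>R k))\<^sup>2 + s / (s + t) * (norm (y + t *\<^sub>R l))\<^sup>2"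
        unfolding eq by (rule norm_convex_comb_power2) (use st in \<open>auto simp flip: add_divide_distrib\<close>)
      moreover have "t / (s + t) * (norm y)\<^sup>2 + s / (s + t) * (norm y)\<^sup>2 = (norm y)\<^sup>2"
        using st by (simp flip: distrib_right add_divide_distrib add: add.commute)
      ultimately have "(norm (y + r *\<^sub>R (k + l)))\<^sup>2 - (norm y)\<^sup>2
          \<le> t / (s + t) * (2 * s * half_sq_quot y k s) + s / (s + t) * (2 * t * half_sq_quot y l t)"
        using scaled[OF st(1), of k] scaled[OF st(2), of l] by (simp add: right_diff_distrib)
      also have "\<dots> = 2 * r * (half_sq_quot y k s + half_sq_quot y l t)"
        by (simp add: r_def algebra_simps add_divide_distrib)
      finally have "half_sq_quot y (k + l) r \<le> half_sq_quot y k s + half_sq_quot y l t"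
        using r unfolding half_sq_quot_def[of y "k + l" r] by (simp add: pos_divide_le_eq mult_ac)
      with lower[OF r, of "k + l"] show ?thesis by linarith
    qed
    have "p (k + l) - half_sq_quot y l t \<le> p k" if "t > 0" for t
      using le[OF _ that] by (intro greatest) (simp add: algebra_simps)
    then have "p (k + l) - p k \<le> p l"
      by (intro greatest) (simp add: algebra_simps)
    then show "p (k + l) \<le> p k + p l" by simp
  next
    fix c :: real and k assume c: "c > 0"
    show "c * p k \<le> p (c *\<^sub>R k)"
    proof (rule greatest)
      fix t :: real assume t: "t > 0"
      have "c * p k \<le> c * half_sq_quot y k (c * t)" using lower[of "c * t" k] c t by simp
      also have "\<dots> = half_sq_quot y (c *\<^sub>R k) t"
        using c t by (simp add: half_sq_quot_def mult.commute)
      finally show "c * p k \<le> half_sq_quot y (c *\<^sub>R k) t" .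
    qed
  qed
  have bound: "p k \<le> norm y * norm k" for k
  proof (rule field_le_epsilon)
    fix e :: real assume e: "e > 0"
    define t where "t = e / ((norm k)\<^sup>2 + 1)"
    have t: "t > 0" using e by (simp add: t_def add_nonneg_pos)
    have "(norm (y + t *\<^sub>R k))\<^sup>2 \<le> (norm y + t * norm k)\<^sup>2"
      using norm_triangle_ineq[of y "t *\<^sub>R k"] t by (intro power_mono) auto
    then have "half_sq_quot y k t \<le> ((norm y + t * norm k)\<^sup>2 - (norm y)\<^sup>2) / (2 * t)"
      using t unfolding half_sq_quot_def by (intro divide_right_mono) auto
    also have "\<dots> = norm y * norm k + t * (norm k)\<^sup>2 / 2"
      using t by (simp add: field_simps power2_eq_square)
    also have "t * (norm k)\<^sup>2 \<le> e"
      unfolding t_def using e by (rule quotient_step_le)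
    finally show "p k \<le> norm y * norm k + e" using lower[OF t, of k] e by linarith
  qed
  have at_y: "p (- y) \<le> - (norm y)\<^sup>2"
  proof (rule field_le_epsilon)
    fix e :: real assume e: "e > 0"
    define t where "t = e / ((norm y)\<^sup>2 + 1)"
    have t: "t > 0" using e by (simp add: t_def add_nonneg_pos)
    have "y + t *\<^sub>R (- y) = (1 - t) *\<^sub>R y" by (simp add: algebra_simps)
    then have "half_sq_quot y (- y) t = ((1 - t)\<^sup>2 - 1) * (norm y)\<^sup>2 / (2 * t)"
      by (simp add: half_sq_quot_def power_mult_distrib left_diff_distrib)
    also have "\<dots> = - (norm y)\<^sup>2 + t * (norm y)\<^sup>2 / 2"
      using t by (simp add: field_simps power2_eq_square)
    also have "t * (norm y)\<^sup>2 \<le> e"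
      unfolding t_def using e by (rule quotient_step_le)
    finally show "p (- y) \<le> - (norm y)\<^sup>2 + e" using lower[OF t, of "- y"] e by linarith
  qed
  obtain f :: "'x \<Rightarrow>\<^sub>L real" where f: "\<And>k. f k \<le> p k" "f h = p h" "norm f \<le> norm y"
    using Hahn_Banach_blinfun[OF sub bound] by (metis norm_ge_zero)
  have "f \<in> duality_set y"
  proof -
    have ge: "(norm y)\<^sup>2 \<le> f y" using f(1)[of "- y"] at_y by (simp add: blinfun.minus_right)
    have le: "f y \<le> norm f * norm y" using norm_blinfun[of f y] by simp
    have le2: "norm f * norm y \<le> norm y * norm y" using f(3) by (rule mult_right_mono) simp
    from ge le le2 have "norm f * norm y = norm y * norm y"
      by (intro antisym) (auto simp: power2_eq_square)
    with f(3) have "norm f = norm y" by (cases "y = 0") auto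
    with ge le show ?thesis by (simp add: duality_set_iff power2_eq_square)
  qed
  then have "duality_map y = f" by (rule duality_map_eqI[OF sc])
  with f(2) show ?thesis by (simp add: p_def)
qed

text \<open>
  The necessary condition for a minimum in the form in which it is used: the perturbation by \<open>t h\<close>
  changes the rest of the cost by the quadratic polynomial \<open>2 t a + t\<^sup>2 c\<close>.
\<close>

lemma duality_map_first_order:
  fixes y h :: "'x::real_normed_vector"
  assumes sc: "strictly_convex_space TYPE('x \<Rightarrow>\<^sub>L real)"
    and min: "\<And>t. t > 0 \<Longrightarrow> (norm y)\<^sup>2 \<le> (norm (y + t *\<^sub>R h))\<^sup>2 + 2 * t * a + t\<^sup>2 * c"
  shows "0 \<le> duality_map y h + a"
proof -
  have "- a \<le> half_sq_quot y h t" if t: "t > 0" for t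
  proof (rule field_le_epsilon)
    fix e :: real assume e: "e > 0"
    define s where "s = min t (e / (\<bar>c\<bar> + 1))"
    have s: "s > 0" "s \<le> t" "s \<le> e / (\<bar>c\<bar> + 1)" using t e by (auto simp: s_def)
    have "s * c \<le> s * (\<bar>c\<bar> + 1)" using s(1) by (intro mult_left_mono) auto
    also have "\<dots> \<le> e" using s(3) by (simp add: pos_le_divide_eq)
    finally have "s * c \<le> e" .
    moreover have "- a \<le> half_sq_quot y h s + s * c / 2"
      using min[OF s(1)] s(1) by (simp add: half_sq_quot_def field_simps power2_eq_square)
    ultimately show "- a \<le> half_sq_quot y h t + e"
      using half_sq_quot_mono[OF s(1,2), of y h] e by linarith
  qed
  then have "- a \<le> duality_map y h"
    unfolding duality_map_Gateaux[OF sc] by (intro cINF_greatest) auto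
  then show ?thesis by simp
qed

section \<open>Uniform boundedness and the adjoint of an operator on a Hilbert space\<close>

text \<open>
  By Baire's theorem one of the closed sets on which all operators are bounded by \<open>n\<close> contains a
  ball; differences of its points give a bound on a ball around the origin.
\<close>

lemma uniform_boundedness:
  fixes S :: "('x::banach \<Rightarrow>\<^sub>L 'z::real_normed_vector) set"
  assumes ptw: "\<And>x. bounded ((\<lambda>L. blinfun_apply L x) ` S)"
  shows "bounded S"
proof -
  define E where "E n = {x. \<forall>L\<in>S. norm (blinfun_apply L x) \<le> real n}" for n
  have closed: "closed (E n)" for n
  proof -
    have "E n = (\<Inter>L\<in>S. {x. norm (blinfun_apply L x) \<le> real n})" by (auto simp: E_def)
    also have "closed \<dots>" by (intro closed_INT ballI closed_Collect_le continuous_intros)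
    finally show ?thesis .
  qed
  have cover: "\<exists>n. x \<in> E n" for x
  proof -
    obtain K where "\<And>L. L \<in> S \<Longrightarrow> norm (blinfun_apply L x) \<le> K"
      using ptw[of x] by (auto simp: bounded_iff)
    moreover obtain n where "K \<le> real n" using real_arch_simple by blast
    ultimately have "x \<in> E n" unfolding E_def by (blast intro: order_trans)
    then show ?thesis ..
  qed
  have "\<exists>n. interior (E n) \<noteq> {}"
  proof (rule ccontr)
    assume "\<not> ?thesis"
    then have "euclidean interior_of \<Union>(range E) = {}"
      using closed
      by (intro Baire_category_alt) (auto simp: completely_metrizable_space_euclidean)
    moreover have "\<Union>(range E) = UNIV" using cover by auto
    ultimately show False by simp
  qed
  then obtain n x where "x \<in> interior (E n)" by blast
  then obtain r where r: "r > 0" "cball x r \<subseteq> E n" by (meson mem_interior_cball)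
  have "norm L \<le> 2 * real n / r" if L: "L \<in> S" for L
  proof (rule norm_blinfun_bound)
    fix z
    show "norm (blinfun_apply L z) \<le> 2 * real n / r * norm z"
    proof (cases "z = 0")
      case False
      define w where "w = (r / norm z) *\<^sub>R z"
      have "norm w = r" using r False by (simp add: w_def)
      then have "x + w \<in> cball x r" "x \<in> cball x r" using r by (auto simp: dist_norm)
      with r have "x + w \<in> E n" "x \<in> E n" by blast+
      with L have "norm (blinfun_apply L (x + w)) \<le> n" "norm (blinfun_apply L x) \<le> n"
        by (auto simp: E_def)
      then have "norm (blinfun_apply L w) \<le> 2 * n"
        using norm_triangle_ineq4[of "blinfun_apply L (x + w)" "blinfun_apply L x"]
        by (simp add: blinfun.add_right)
      moreover have "norm (blinfun_apply L w) = r / norm z * norm (blinfun_apply L z)"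
        using r by (simp add: w_def blinfun.scaleR_right)
      ultimately show ?thesis using r False by (simp add: field_simps)
    qed simp
  qed (use r in auto)
  then show ?thesis by (auto simp: bounded_iff)
qed

text \<open>
  The representing vector minimises \<open>F y = (norm y)\<^sup>2 / 2 - g y\<close>.  By the parallelogram law a
  minimising sequence is Cauchy, and the first-order condition at the limit is the representation.
\<close>

lemma Riesz_representation:
  fixes g :: "'y::{real_inner, complete_space} \<Rightarrow>\<^sub>L real"
  shows "\<exists>!y. \<forall>v. inner y v = blinfun_apply g v"
proof -
  define F where "F y = (norm y)\<^sup>2 / 2 - g y" for y
  define m where "m = (INF y. F y)"
  have lowF: "- (norm g)\<^sup>2 / 2 \<le> F y" for y
  proof -
    have "g y \<le> norm g * norm y" using norm_blinfun[of g y] by simp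
    also have "\<dots> \<le> ((norm g)\<^sup>2 + (norm y)\<^sup>2) / 2"
      using sum_squares_bound[of "norm g" "norm y"] by simp
    finally show ?thesis by (simp add: F_def field_simps)
  qed
  have bdd: "bdd_below (range F)" by (rule bdd_belowI2) (rule lowF)
  have mle: "m \<le> F y" for y unfolding m_def by (rule cINF_lower[OF bdd]) simp
  have "\<exists>y. F y < m + 1 / Suc n" for n
  proof -
    have "m < m + 1 / Suc n" by simp
    then show ?thesis unfolding m_def by (subst (asm) cINF_less_iff) (use bdd in auto)
  qed
  then obtain Y where Y: "\<And>n. F (Y n) < m + 1 / Suc n" by metis
  have par: "(norm (y - z))\<^sup>2 \<le> 4 * (F y - m) + 4 * (F z - m)" for y z
  proof -
    have "F y + F z - 2 * F ((1/2) *\<^sub>R (y + z)) = (norm (y - z))\<^sup>2 / 4"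
      by (simp add: F_def power2_norm_eq_inner blinfun.scaleR_right blinfun.add_right
        inner_diff inner_add inner_commute field_simps)
    moreover have "2 * m \<le> 2 * F ((1/2) *\<^sub>R (y + z))" using mle by simp
    ultimately have "(norm (y - z))\<^sup>2 / 4 \<le> F y + F z - 2 * m" by linarith
    then show ?thesis by (simp add: field_simps)
  qed
  have "Cauchy Y"
  proof (rule metric_CauchyI)
    fix e :: real assume e: "e > 0"
    obtain N where N: "8 / e\<^sup>2 < real N" using reals_Archimedean2 by blast
    have "dist (Y i) (Y j) < e" if ij: "i \<ge> N" "j \<ge> N" for i j
    proof -
      have "1 / Suc k < e\<^sup>2 / 8" if "k \<ge> N" for k
      proof -
        have "8 / e\<^sup>2 < Suc k" using N that by linarith
        with e show ?thesis by (simp add: field_simps)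
      qed
      then have "F (Y k) < m + e\<^sup>2 / 8" if "k \<ge> N" for k
        using Y[of k] that by (meson add_strict_left_mono order.strict_trans)
      from add_strict_mono[OF this[OF ij(1)] this[OF ij(2)]]
      have "4 * (F (Y i) - m) + 4 * (F (Y j) - m) < e\<^sup>2" by (simp add: field_simps)
      with par[of "Y i" "Y j"] have "(norm (Y i - Y j))\<^sup>2 < e\<^sup>2" by (rule le_less_trans)
      with e show ?thesis by (simp add: dist_norm power2_less_imp_less)
    qed
    then show "\<exists>M. \<forall>i\<ge>M. \<forall>j\<ge>M. dist (Y i) (Y j) < e" by blast
  qed
  then obtain y where y: "Y \<longlonglongrightarrow> y" by (auto simp: Cauchy_convergent_iff convergent_def)
  have "(\<lambda>n. F (Y n)) \<longlonglongrightarrow> F y" unfolding F_def by (intro tendsto_intros y) simp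
  moreover have "(\<lambda>n. m + 1 / Suc n) \<longlonglongrightarrow> m + 0"
    by (intro tendsto_intros LIMSEQ_inverse_real_of_nat[unfolded inverse_eq_divide])
  ultimately have "F y \<le> m"
    using Y by (intro LIMSEQ_le[of "\<lambda>n. F (Y n)"]) (auto intro: less_imp_le)
  with mle have min: "F y \<le> F z" for z by (meson order_trans)
  have ge: "0 \<le> inner y v - g v" for v
  proof (rule field_le_epsilon)
    fix e :: real assume e: "e > 0"
    define t where "t = e / ((norm v)\<^sup>2 + 1)"
    have t: "t > 0" using e by (simp add: t_def add_nonneg_pos)
    have "(norm (y + t *\<^sub>R v))\<^sup>2 = (norm y)\<^sup>2 + 2 * t * inner y v + t\<^sup>2 * (norm v)\<^sup>2"
      unfolding power2_norm_eq_inner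
      by (simp add: inner_add inner_commute[of v y] power2_eq_square algebra_simps)
    then have "F (y + t *\<^sub>R v) = F y + t * (inner y v - g v) + t\<^sup>2 * (norm v)\<^sup>2 / 2"
      by (simp add: F_def blinfun.scaleR_right blinfun.add_right field_simps)
    with min[of "y + t *\<^sub>R v"] have "0 \<le> t * (inner y v - g v + t * (norm v)\<^sup>2 / 2)"
      by (simp add: algebra_simps power2_eq_square)
    with t have "0 \<le> inner y v - g v + t * (norm v)\<^sup>2 / 2" by (simp add: zero_le_mult_iff)
    moreover have "t * (norm v)\<^sup>2 \<le> e" unfolding t_def using e by (rule quotient_step_le)
    ultimately show "0 \<le> inner y v - g v + e" using e by linarith
  qed
  have "inner y v = g v" for v
    using ge[of v] ge[of "- v"] by (simp add: blinfun.minus_right)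
  then show ?thesis
  proof (intro ex1I[of _ y])
    fix z assume "\<forall>v. inner z v = g v" and "\<And>v. inner y v = g v"
    then have "inner (z - y) (z - y) = 0" by (simp add: inner_diff_left)
    then show "z = y" by simp
  qed auto
qed

text \<open>
  Riesz representation makes the descriptions in the definition of \<^const>\<open>hilbert_adjoint\<close>
  well-defined; the function they give is bounded and linear, as \<^const>\<open>Blinfun\<close> requires.
\<close>

lemma inner_hilbert_adjoint:
  fixes B :: "'y::{real_inner, complete_space} \<Rightarrow>\<^sub>L 'x::real_normed_vector"
  shows "inner (hilbert_adjoint B f) v = blinfun_apply f (blinfun_apply B v)"
proof -
  define R where "R f = (THE y. \<forall>v. inner y v = blinfun_apply f (blinfun_apply B v))" for f
  have R: "inner (R f) v = blinfun_apply f (blinfun_apply B v)" for f v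
  proof -
    have "\<exists>!y. \<forall>v. inner y v = blinfun_apply f (blinfun_apply B v)"
      using Riesz_representation[of "f o\<^sub>L B"] by simp
    from theI'[OF this] show ?thesis unfolding R_def by blast
  qed
  have ext: "y = z" if "\<And>v. inner y v = inner z v" for y z :: 'y
    using that by (metis inner_eq_zero_iff inner_diff_left eq_iff_diff_eq_0)
  have "bounded_linear R"
  proof (rule bounded_linear_intro[where K = "norm B"])
    fix f g :: "'x \<Rightarrow>\<^sub>L real" and c :: real
    show "R (f + g) = R f + R g" by (rule ext) (simp add: R inner_add_left blinfun.add_left)
    show "R (c *\<^sub>R f) = c *\<^sub>R R f" by (rule ext) (simp add: R blinfun.scaleR_left)
    have "norm (R f) * norm (R f) = f (B (R f))"
      by (simp flip: R power2_norm_eq_inner power2_eq_square)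
    also have "\<dots> \<le> norm f * (norm B * norm (R f))"
      using norm_blinfun[of f "B (R f)"] norm_blinfun[of B "R f"]
        mult_left_mono[OF norm_blinfun[of B "R f"], of "norm f"] by auto
    finally have "norm (R f) * norm (R f) \<le> (norm f * norm B) * norm (R f)" by (simp add: mult_ac)
    then show "norm (R f) \<le> norm f * norm B" by (cases "R f = 0") auto
  qed
  then have "blinfun_apply (hilbert_adjoint B) = R"
    unfolding hilbert_adjoint_def R_def[abs_def] by (rule bounded_linear_Blinfun_apply)
  with R show ?thesis by simp
qed

section \<open>Bochner integrals in non-separable Banach spaces\<close>

text \<open>
  Strong measurability in the form given by Pettis' theorem: Borel measurability together with a
  separable range.  The range condition takes the place of separability of the space.
\<close>

definition strongly_integrable :: "'a measure \<Rightarrow> ('a \<Rightarrow> 'x::real_normed_vector) \<Rightarrow> bool" where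
  "strongly_integrable M f \<longleftrightarrow>
     f \<in> borel_measurable M \<and> (\<exists>D. countable D \<and> f ` space M \<subseteq> closure D) \<and>
     integrable M (\<lambda>x. norm (f x))"

lemma countable_dense_subset:
  fixes C :: "'c::{metric_space, second_countable_topology} set"
  obtains D where "countable D" "D \<subseteq> C" "C \<subseteq> closure D"
proof -
  obtain \<B> :: "'c set set" where \<B>: "countable \<B>" "topological_basis \<B>"
    using ex_countable_basis by blast
  define pick where "pick U = (SOME x. x \<in> U \<inter> C)" for U
  define D where "D = pick ` {U \<in> \<B>. U \<inter> C \<noteq> {}}"
  have pick: "pick U \<in> U \<inter> C" if "U \<inter> C \<noteq> {}" for U
    unfolding pick_def using that by (rule some_in_eq[THEN iffD2])
  show ?thesis
  proof
    show "countable D" unfolding D_def using \<B>(1) by auto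
    show "D \<subseteq> C" using pick by (auto simp: D_def)
    show "C \<subseteq> closure D"
    proof
      fix x assume x: "x \<in> C"
      have "\<exists>y\<in>D. y \<in> V" if V: "open V" "x \<in> V" for V
      proof -
        obtain U where U: "U \<in> \<B>" "x \<in> U" "U \<subseteq> V"
          using topological_basisE[OF \<B>(2) V] by blast
        with x have "U \<inter> C \<noteq> {}" by auto
        with pick[OF this] U show ?thesis by (auto simp: D_def)
      qed
      then show "x \<in> closure D" by (auto simp: closure_iff_nhds_not_empty)
    qed
  qed
qed

text \<open>
  All integrands below are of this form: a scalar weight, the time and the control are collected in
  a measurable function \<open>g\<close> with values in a separable metric space, and the vector is a continuous
  function of these data.  Continuity transports both measurability and separability.
\<close>

lemma strongly_integrable_comp:
  fixes g :: "'a \<Rightarrow> 'c::{metric_space, second_countable_topology}"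
    and \<Phi> :: "'c \<Rightarrow> 'x::real_normed_vector"
  assumes g: "g \<in> borel_measurable M" and C: "\<And>x. x \<in> space M \<Longrightarrow> g x \<in> C"
    and cont: "continuous_on C \<Phi>"
    and int: "integrable M w" and bound: "\<And>x. x \<in> space M \<Longrightarrow> norm (\<Phi> (g x)) \<le> w x"
  shows "strongly_integrable M (\<lambda>x. \<Phi> (g x))"
proof -
  have meas: "(\<lambda>x. \<Phi> (g x)) \<in> borel_measurable M"
    using measurable_restrict_space2[of g M C borel] g C
      borel_measurable_continuous_on_restrict[OF cont]
    by (intro measurable_compose[of g M "restrict_space borel C" \<Phi>]) auto
  obtain D where D: "countable D" "D \<subseteq> C" "C \<subseteq> closure D" by (rule countable_dense_subset)
  have "\<Phi> c \<in> closure (\<Phi> ` D)" if c: "c \<in> C" for c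
  proof -
    obtain x where x: "\<And>n. x n \<in> D" "x \<longlonglongrightarrow> c" using c D(3) closure_sequential by (metis subsetD)
    moreover have "\<forall>n. x n \<in> C" using x(1) D(2) by blast
    ultimately have "(\<lambda>n. \<Phi> (x n)) \<longlonglongrightarrow> \<Phi> c"
      using cont c unfolding continuous_on_sequentially comp_def by blast
    with x(1) show ?thesis unfolding closure_sequential by (intro exI[of _ "\<lambda>n. \<Phi> (x n)"] conjI allI imageI)
  qed
  then have "(\<lambda>x. \<Phi> (g x)) ` space M \<subseteq> closure (\<Phi> ` D)" using C by auto
  moreover have "integrable M (\<lambda>x. norm (\<Phi> (g x)))"
  proof (rule Bochner_Integration.integrable_bound[OF int])
    show "(\<lambda>x. norm (\<Phi> (g x))) \<in> borel_measurable M"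
      by (rule measurable_compose[OF meas]) measurable
    show "AE x in M. norm (norm (\<Phi> (g x))) \<le> norm (w x)"
      by (rule AE_I2) (use bound in force)
  qed
  ultimately show ?thesis
    using meas D(1) unfolding strongly_integrable_def by (metis countable_image)
qed

lemma borel_measurable_norm_diff_simple:
  fixes f s :: "'a \<Rightarrow> 'x::real_normed_vector"
  assumes f: "f \<in> borel_measurable M" and s: "simple_function M s"
  shows "(\<lambda>x. norm (f x - s x)) \<in> borel_measurable M"
proof (rule measurable_compose_countable'[where f = "\<lambda>c x. norm (f x - c)" and I = "s ` space M"])
  show "(\<lambda>x. norm (f x - c)) \<in> borel_measurable M" for c
    by (rule measurable_compose[OF f borel_measurable_continuous_onI]) (intro continuous_intros)
  show "s \<in> measurable M (count_space (s ` space M))"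
    using s by (auto simp: measurable_count_space_eq2 simple_function_def)
  show "countable (s ` space M)" using s by (auto simp: simple_function_def countable_finite)
qed

lemma simple_bochner_integral_dist_le:
  fixes f s t :: "'a \<Rightarrow> 'x::real_normed_vector"
  assumes f: "f \<in> borel_measurable M"
    and s: "Bochner_Integration.simple_bochner_integrable M s"
    and t: "Bochner_Integration.simple_bochner_integrable M t"
  shows "ennreal (norm (Bochner_Integration.simple_bochner_integral M s
                        - Bochner_Integration.simple_bochner_integral M t))
         \<le> (\<integral>\<^sup>+x. norm (f x - s x) \<partial>M) + (\<integral>\<^sup>+x. norm (f x - t x) \<partial>M)"
proof -
  have st: "Bochner_Integration.simple_bochner_integrable M (\<lambda>x. s x - t x)"
    using s t by (intro simple_bochner_integrable_compose2[where p = "(-)"]) auto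
  have nst: "Bochner_Integration.simple_bochner_integrable M (\<lambda>x. norm (s x - t x))"
    using s t by (intro simple_bochner_integrable_compose2[where p = "\<lambda>x y. norm (x - y)"]) auto
  have "ennreal (norm (Bochner_Integration.simple_bochner_integral M s
                        - Bochner_Integration.simple_bochner_integral M t))
      \<le> ennreal (Bochner_Integration.simple_bochner_integral M (\<lambda>x. norm (s x - t x)))"
    using simple_bochner_integral_norm_bound[OF st] simple_bochner_integral_diff[OF s t]
    by (auto intro!: ennreal_leI)
  also have "\<dots> = (\<integral>\<^sup>+x. norm (s x - t x) \<partial>M)"
    by (rule simple_bochner_integral_eq_nn_integral[OF nst]) simp
  also have "\<dots> \<le> (\<integral>\<^sup>+x. ennreal (norm (f x - s x)) + ennreal (norm (f x - t x)) \<partial>M)"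
  proof (rule nn_integral_mono)
    fix x
    have "norm (s x - t x) \<le> norm (f x - s x) + norm (f x - t x)"
      using norm_triangle_ineq4[of "f x - t x" "f x - s x"] by simp
    then show "ennreal (norm (s x - t x)) \<le> ennreal (norm (f x - s x)) + ennreal (norm (f x - t x))"
      by (simp add: ennreal_leI flip: ennreal_plus)
  qed
  also have "\<dots> = (\<integral>\<^sup>+x. norm (f x - s x) \<partial>M) + (\<integral>\<^sup>+x. norm (f x - t x) \<partial>M)"
    using s t
    by (intro nn_integral_add measurable_compose[OF borel_measurable_norm_diff_simple[OF f]])
       (auto elim: simple_bochner_integrable.cases)
  finally show ?thesis .
qed

text \<open>
  Let \<open>d 0 = 0, d 1, \<dots>\<close> be dense in the range, and let \<open>s n x\<close> be the first of the points
  \<open>d 0, \<dots>, d n\<close> that is nearest to \<open>f x\<close>.  These simple functions converge pointwise.  Since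
  \<open>0\<close> is a candidate, the error is at most \<open>norm (f x)\<close>, so dominated convergence applies.
\<close>

lemma strongly_integrable_has_bochner_int:
  fixes f :: "'a \<Rightarrow> 'x::banach"
  assumes "strongly_integrable M f"
  shows "\<exists>I. has_bochner_int M f I"
proof -
  obtain D where f: "f \<in> borel_measurable M" and D: "countable D" "f ` space M \<subseteq> closure D"
    and int: "integrable M (\<lambda>x. norm (f x))"
    using assms by (auto simp: strongly_integrable_def)
  define d where "d n = (case n of 0 \<Rightarrow> 0 | Suc m \<Rightarrow> from_nat_into (insert 0 D) m)" for n
  have d0: "d 0 = 0" by (simp add: d_def)
  have rd: "D \<subseteq> range d"
  proof
    fix c assume "c \<in> D"
    then obtain m where "c = from_nat_into (insert 0 D) m"
      using from_nat_into_surj[of "insert 0 D" c] D(1) by (metis countable_insert insertI2)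
    then have "c = d (Suc m)" by (simp add: d_def)
    then show "c \<in> range d" by blast
  qed
  define best where "best n x i \<longleftrightarrow> i \<le> n \<and> (\<forall>j\<le>n. norm (f x - d i) \<le> norm (f x - d j))" for n x i
  define k where "k n x = (LEAST i. best n x i)" for n x
  define s where "s n x = d (k n x)" for n x
  have "\<exists>i. best n x i" for n x
  proof -
    obtain i where "is_arg_min (\<lambda>i. norm (f x - d i)) (\<lambda>i. i \<in> {..n}) i"
      using ex_is_arg_min_if_finite[of "{..n}" "\<lambda>i. norm (f x - d i)"] by auto
    then show ?thesis by (auto simp: best_def is_arg_min_linorder)
  qed
  then have best: "best n x (k n x)" for n x unfolding k_def by (rule LeastI_ex)
  have near: "norm (f x - s n x) \<le> norm (f x - d j)" if "j \<le> n" for n x j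
    using best[of n x] that by (simp add: best_def s_def)
  have [measurable]: "(\<lambda>x. norm (f x - c)) \<in> borel_measurable M" for c
    by (rule measurable_compose[OF f borel_measurable_continuous_onI]) (intro continuous_intros)
  have k_meas: "k n \<in> measurable M (count_space UNIV)" for n
    unfolding k_def[abs_def] best_def by measurable
  have simple: "simple_function M (s n)" for n
  proof -
    have "simple_function M (k n)"
      unfolding simple_function_def
    proof (intro conjI ballI)
      have "k n ` space M \<subseteq> {..n}" using best by (auto simp: best_def)
      then show "finite (k n ` space M)" by (rule finite_subset) simp
    qed (use k_meas in measurable)
    then show ?thesis unfolding s_def[abs_def] by (rule simple_function_compose1)
  qed
  have sn_f: "norm (s n x) \<le> 2 * norm (f x)" for n x
    using near[of 0 n x] norm_triangle_ineq2[of "s n x" "f x"] by (simp add: d0 norm_minus_commute)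
  have fin: "(\<integral>\<^sup>+x. ennreal (c * norm (f x)) \<partial>M) < \<infinity>" if "c \<ge> 0" for c
    using integrable_mult_right[OF int, of c] that unfolding integrable_iff_bounded by simp
  have sbi: "Bochner_Integration.simple_bochner_integrable M (s n)" for n
  proof (rule simple_bochner_integrableI_bounded[OF simple])
    show "(\<integral>\<^sup>+x. norm (s n x) \<partial>M) < \<infinity>"
      by (rule le_less_trans[OF nn_integral_mono fin[of 2]]) (auto intro!: ennreal_leI sn_f)
  qed
  have lim: "(\<lambda>n. s n x) \<longlonglongrightarrow> f x" if x: "x \<in> space M" for x
  proof (rule metric_LIMSEQ_I)
    fix e :: real assume e: "e > 0"
    have "f x \<in> closure D" using x D(2) by blast
    then obtain c where "c \<in> D" "dist c (f x) < e" using e by (auto simp: closure_approachable)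
    then obtain j where j: "norm (f x - d j) < e" using rd by (auto simp: dist_norm norm_minus_commute)
    show "\<exists>N. \<forall>n\<ge>N. dist (s n x) (f x) < e"
      using near[of j _ x] j by (intro exI[of _ j]) (auto simp: dist_norm norm_minus_commute intro: le_less_trans)
  qed
  have conv: "(\<lambda>n. \<integral>\<^sup>+x. norm (f x - s n x) \<partial>M) \<longlonglongrightarrow> 0"
  proof -
    have "(\<lambda>n. \<integral>\<^sup>+x. norm (f x - s n x) \<partial>M) \<longlonglongrightarrow> (\<integral>\<^sup>+x. 0 \<partial>M)"
    proof (rule nn_integral_dominated_convergence[where w = "\<lambda>x. ennreal (norm (f x))"])
      show "(\<lambda>x. ennreal (norm (f x - s n x))) \<in> borel_measurable M" for n
        by (rule measurable_compose[OF borel_measurable_norm_diff_simple[OF f simple]]) measurable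
      show "(\<lambda>x. ennreal (norm (f x))) \<in> borel_measurable M"
        by (rule measurable_compose[OF f]) measurable
      show "AE x in M. ennreal (norm (f x - s n x)) \<le> ennreal (norm (f x))" for n
        using near[of 0 n] by (auto simp: d0 intro!: AE_I2 ennreal_leI)
      show "(\<integral>\<^sup>+ x. ennreal (norm (f x)) \<partial>M) < \<infinity>" using fin[of 1] by simp
      show "AE x in M. (\<lambda>n. ennreal (norm (f x - s n x))) \<longlonglongrightarrow> 0"
      proof (rule AE_I2)
        fix x assume "x \<in> space M"
        from tendsto_norm[OF tendsto_diff[OF tendsto_const lim[OF this], of "f x"]]
        show "(\<lambda>n. ennreal (norm (f x - s n x))) \<longlonglongrightarrow> 0"
          by (intro tendsto_ennrealI[where x = 0, unfolded ennreal_0]) simp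
      qed
    qed simp_all
    then show ?thesis by simp
  qed
  have "Cauchy (\<lambda>n. Bochner_Integration.simple_bochner_integral M (s n))"
  proof (rule metric_CauchyI)
    fix e :: real assume e: "e > 0"
    from order_tendstoD(2)[OF conv, of "ennreal (e / 2)"] e
    obtain N where N: "\<And>n. n \<ge> N \<Longrightarrow> (\<integral>\<^sup>+x. norm (f x - s n x) \<partial>M) < ennreal (e / 2)"
      by (auto simp: eventually_sequentially)
    have "dist (Bochner_Integration.simple_bochner_integral M (s i))
        (Bochner_Integration.simple_bochner_integral M (s j)) < e" if "i \<ge> N" "j \<ge> N" for i j
    proof -
      have "ennreal (norm (Bochner_Integration.simple_bochner_integral M (s i)
          - Bochner_Integration.simple_bochner_integral M (s j))) < ennreal (e / 2) + ennreal (e / 2)"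
        using simple_bochner_integral_dist_le[OF f sbi sbi, of i j] add_strict_mono[OF N[OF that(1)] N[OF that(2)]]
        by (rule le_less_trans)
      also have "\<dots> = ennreal e" using e by (simp flip: ennreal_plus)
      finally show ?thesis using e by (simp add: dist_norm ennreal_less_iff)
    qed
    then show "\<exists>N. \<forall>i\<ge>N. \<forall>j\<ge>N. dist (Bochner_Integration.simple_bochner_integral M (s i))
        (Bochner_Integration.simple_bochner_integral M (s j)) < e" by blast
  qed
  then obtain I where "(\<lambda>n. Bochner_Integration.simple_bochner_integral M (s n)) \<longlonglongrightarrow> I"
    by (auto simp: Cauchy_convergent_iff convergent_def)
  with sbi conv lim show ?thesis
    unfolding has_bochner_int_def by (intro exI[of _ I] exI[of _ s]) auto
qed

text \<open>Functionals map approximating simple functions to approximating simple functions.\<close>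

lemma has_bochner_int_functional:
  fixes f :: "'a \<Rightarrow> 'x::real_normed_vector" and \<phi> :: "'x \<Rightarrow>\<^sub>L real"
  assumes f: "f \<in> borel_measurable M" and I: "has_bochner_int M f I"
  shows "has_bochner_integral M (\<lambda>x. \<phi> (f x)) (\<phi> I)"
proof -
  obtain s where sbi: "\<And>n. Bochner_Integration.simple_bochner_integrable M (s n)"
    and conv: "(\<lambda>n. \<integral>\<^sup>+x. norm (f x - s n x) \<partial>M) \<longlonglongrightarrow> 0"
    and lim: "(\<lambda>n. Bochner_Integration.simple_bochner_integral M (s n)) \<longlonglongrightarrow> I"
    using I by (auto simp: has_bochner_int_def)
  have simple: "simple_function M (s n)" for n
    using sbi[of n] by (auto elim: simple_bochner_integrable.cases)
  show ?thesis
  proof (rule has_bochner_integral.intros)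
    show "(\<lambda>x. \<phi> (f x)) \<in> borel_measurable M"
      by (rule measurable_compose[OF f borel_measurable_continuous_onI]) (intro continuous_intros)
    show "Bochner_Integration.simple_bochner_integrable M (\<lambda>x. \<phi> (s n x))" for n
      using simple_bochner_integrable_compose2[OF _ sbi[of n] sbi[of n], of "\<lambda>x y. \<phi> x"]
      by (simp add: blinfun.zero_right)
    have "Bochner_Integration.simple_bochner_integral M (\<lambda>x. \<phi> (s n x))
        = \<phi> (Bochner_Integration.simple_bochner_integral M (s n))" for n
      by (rule simple_bochner_integral_linear[OF _ sbi])
         (simp add: blinfun.bounded_linear_right bounded_linear.linear)
    then show "(\<lambda>n. Bochner_Integration.simple_bochner_integral M (\<lambda>x. \<phi> (s n x))) \<longlonglongrightarrow> \<phi> I"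
      using lim by (simp add: blinfun.tendsto)
    have "(\<lambda>n. ennreal (norm \<phi>) * (\<integral>\<^sup>+x. norm (f x - s n x) \<partial>M)) \<longlonglongrightarrow> ennreal (norm \<phi>) * 0"
      using conv by (intro ennreal_tendsto_cmult) auto
    then have upper: "(\<lambda>n. ennreal (norm \<phi>) * (\<integral>\<^sup>+x. norm (f x - s n x) \<partial>M)) \<longlonglongrightarrow> 0" by simp
    have "(\<integral>\<^sup>+x. norm (\<phi> (f x) - \<phi> (s n x)) \<partial>M)
        \<le> ennreal (norm \<phi>) * (\<integral>\<^sup>+x. norm (f x - s n x) \<partial>M)" for n
    proof -
      have "(\<integral>\<^sup>+x. norm (\<phi> (f x) - \<phi> (s n x)) \<partial>M)
          \<le> (\<integral>\<^sup>+x. ennreal (norm \<phi>) * ennreal (norm (f x - s n x)) \<partial>M)"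
        by (intro nn_integral_mono)
           (simp add: norm_blinfun[of \<phi>, unfolded real_norm_def] flip: blinfun.diff_right ennreal_mult)
      also have "\<dots> = ennreal (norm \<phi>) * (\<integral>\<^sup>+x. norm (f x - s n x) \<partial>M)"
        by (rule nn_integral_cmult, rule measurable_compose[OF borel_measurable_norm_diff_simple[OF f simple]])
           measurable
      finally show ?thesis .
    qed
    then show "(\<lambda>n. \<integral>\<^sup>+x. norm (\<phi> (f x) - \<phi> (s n x)) \<partial>M) \<longlonglongrightarrow> 0"
      by (intro tendsto_sandwich[OF _ _ tendsto_const upper]) auto
  qed
qed

text \<open>
  This determines the integral, because functionals separate points; the linearity and the norm
  bound below are read off from it.  The same separation argument shows uniqueness, so that the
  description in the definition of \<^const>\<open>bochner_int\<close> denotes the integral.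
\<close>

lemma bochner_int_functional:
  fixes f :: "'a \<Rightarrow> 'x::banach" and \<phi> :: "'x \<Rightarrow>\<^sub>L real"
  assumes f: "strongly_integrable M f"
  shows "has_bochner_integral M (\<lambda>x. \<phi> (f x)) (\<phi> (bochner_int M f))"
proof -
  have meas: "f \<in> borel_measurable M" using f by (simp add: strongly_integrable_def)
  have ex: "\<exists>I. has_bochner_int M f I" using f by (rule strongly_integrable_has_bochner_int)
  have unique: "I = J" if "has_bochner_int M f I" "has_bochner_int M f J" for I J
  proof (rule eq_if_functionals_eq)
    fix \<phi> :: "'x \<Rightarrow>\<^sub>L real"
    show "\<phi> I = \<phi> J"
      using has_bochner_int_functional[OF meas that(1), of \<phi>]
        has_bochner_int_functional[OF meas that(2), of \<phi>] by (rule has_bochner_integral_eq)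
  qed
  have "has_bochner_int M f (bochner_int M f)"
    unfolding bochner_int_def using ex unique by (auto intro: theI)
  then show ?thesis by (rule has_bochner_int_functional[OF meas])
qed

lemma bochner_int_diff:
  fixes f g :: "'a \<Rightarrow> 'x::banach"
  assumes f: "strongly_integrable M f" and g: "strongly_integrable M g"
    and fg: "strongly_integrable M (\<lambda>x. f x - g x)"
  shows "bochner_int M f - bochner_int M g = bochner_int M (\<lambda>x. f x - g x)"
proof (rule eq_if_functionals_eq)
  fix \<phi> :: "'x \<Rightarrow>\<^sub>L real"
  show "\<phi> (bochner_int M f - bochner_int M g) = \<phi> (bochner_int M (\<lambda>x. f x - g x))"
    using has_bochner_integral_diff[OF bochner_int_functional[OF f] bochner_int_functional[OF g], of \<phi> \<phi>]
      bochner_int_functional[OF fg, of \<phi>]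
    by (auto simp: blinfun.diff_right intro: has_bochner_integral_eq)
qed

lemma norm_bochner_int_le:
  fixes f :: "'a \<Rightarrow> 'x::banach"
  assumes f: "strongly_integrable M f"
  shows "norm (bochner_int M f) \<le> (\<integral>x. norm (f x) \<partial>M)"
proof -
  obtain \<phi> :: "'x \<Rightarrow>\<^sub>L real" where \<phi>: "\<phi> (bochner_int M f) = norm (bochner_int M f)" "norm \<phi> \<le> 1"
    by (rule exists_norming_functional)
  note hb = bochner_int_functional[OF f, of \<phi>]
  have "\<phi> (f x) \<le> norm (f x)" for x
    using norm_blinfun[of \<phi> "f x"] \<phi>(2) mult_right_mono[OF \<phi>(2), of "norm (f x)"] by simp
  then have "(\<integral>x. \<phi> (f x) \<partial>M) \<le> (\<integral>x. norm (f x) \<partial>M)"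
    using hb f by (intro integral_mono) (auto simp: has_bochner_integral_iff strongly_integrable_def)
  with hb \<phi>(1) show ?thesis by (simp add: has_bochner_integral_iff)
qed

lemma blinfun_apply_strong_int:
  fixes F :: "'a \<Rightarrow> 'z::real_normed_vector \<Rightarrow>\<^sub>L 'x::banach"
  assumes si: "\<And>x. strongly_integrable M (\<lambda>s. F s x)"
    and w: "integrable M w" and bound: "\<And>s x. s \<in> space M \<Longrightarrow> norm (F s x) \<le> w s * norm x"
  shows "strong_int M F x = bochner_int M (\<lambda>s. F s x)"
proof -
  define I where "I x = bochner_int M (\<lambda>s. F s x)" for x
  have \<phi>: "has_bochner_integral M (\<lambda>s. \<phi> (F s x)) (\<phi> (I x))" for \<phi> :: "'x \<Rightarrow>\<^sub>L real" and x
    unfolding I_def by (rule bochner_int_functional[OF si])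
  have "bounded_linear I"
  proof (rule bounded_linear_intro[where K = "\<integral>s. w s \<partial>M"])
    fix x y
    show "I (x + y) = I x + I y"
    proof (rule eq_if_functionals_eq)
      fix \<phi> :: "'x \<Rightarrow>\<^sub>L real"
      show "\<phi> (I (x + y)) = \<phi> (I x + I y)"
        using has_bochner_integral_add[OF \<phi>[of \<phi> x] \<phi>[of \<phi> y]] \<phi>[of \<phi> "x + y"]
        by (auto simp: blinfun.add_right intro: has_bochner_integral_eq)
    qed
  next
    fix c :: real and x
    show "I (c *\<^sub>R x) = c *\<^sub>R I x"
    proof (rule eq_if_functionals_eq)
      fix \<phi> :: "'x \<Rightarrow>\<^sub>L real"
      show "\<phi> (I (c *\<^sub>R x)) = \<phi> (c *\<^sub>R I x)"
        using has_bochner_integral_mult_right[OF \<phi>[of \<phi> x], of c] \<phi>[of \<phi> "c *\<^sub>R x"]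
        by (auto simp: blinfun.scaleR_right intro: has_bochner_integral_eq)
    qed
  next
    fix x
    have "norm (I x) \<le> (\<integral>s. norm (F s x) \<partial>M)" unfolding I_def by (rule norm_bochner_int_le[OF si])
    also have "\<dots> \<le> (\<integral>s. w s * norm x \<partial>M)"
      using si[of x] w bound by (intro integral_mono) (auto simp: strongly_integrable_def)
    finally show "norm (I x) \<le> norm x * (\<integral>s. w s \<partial>M)" by (simp add: mult.commute)
  qed
  then have "blinfun_apply (strong_int M F) = I"
    unfolding strong_int_def I_def[abs_def] by (rule bounded_linear_Blinfun_apply)
  then show ?thesis by (simp add: I_def)
qed

text \<open>
  Pettis' theorem in a separable Hilbert space.  A closed ball is the intersection of countably many
  half-spaces, with normal vectors in a countable dense set, so its preimage is measurable; and an
  open set is a countable union of closed balls.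
\<close>

lemma borel_measurable_if_inner_measurable:
  fixes g :: "'a \<Rightarrow> 'y::{real_inner, second_countable_topology}"
  assumes inner: "\<And>v. (\<lambda>x. inner (g x) v) \<in> borel_measurable M"
  shows "g \<in> borel_measurable M"
proof -
  obtain D :: "'y set" where D: "countable D" "UNIV \<subseteq> closure D"
    using countable_dense_subset[of UNIV] by metis
  have norm_le_iff: "norm z \<le> r \<longleftrightarrow> (\<forall>d\<in>D. inner z d \<le> r * norm d)"
    if r: "r \<ge> 0" for z :: 'y and r
  proof
    assume "norm z \<le> r"
    then show "\<forall>d\<in>D. inner z d \<le> r * norm d"
      by (meson norm_cauchy_schwarz mult_right_mono norm_ge_zero order_trans)
  next
    assume le: "\<forall>d\<in>D. inner z d \<le> r * norm d"
    have "closed {d. inner z d \<le> r * norm d}" by (intro closed_Collect_le continuous_intros)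
    with le have "closure D \<subseteq> {d. inner z d \<le> r * norm d}" by (intro closure_minimal) auto
    with D(2) have zz: "inner z z \<le> r * norm z" by blast
    show "norm z \<le> r"
    proof (cases "z = 0")
      case False
      with zz show ?thesis by (simp add: power2_norm_eq_inner[symmetric] power2_eq_square)
    qed (use r in simp)
  qed
  have ball: "{x \<in> space M. norm (g x - c) \<le> r} \<in> sets M" if r: "r \<ge> 0" for c r
  proof -
    have "{x \<in> space M. norm (g x - c) \<le> r}
        = {x \<in> space M. \<forall>d\<in>D. inner (g x) d - inner c d \<le> r * norm d}"
      using norm_le_iff[OF r] by (simp add: inner_diff_left)
    also have "\<dots> \<in> sets M"
    proof (rule sets.sets_Collect_countable_All')
      show "{x \<in> space M. inner (g x) d - inner c d \<le> r * norm d} \<in> sets M" for d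
        using inner[of d] by measurable
    qed (use D(1) in auto)
    finally show ?thesis .
  qed
  show ?thesis
  proof (rule borel_measurableI)
    fix S :: "'y set" assume S: "open S"
    define P where "P = {(d, n). d \<in> D \<and> cball d (1 / Suc n) \<subseteq> S}"
    have "countable P"
      by (rule countable_subset[of _ "D \<times> (UNIV :: nat set)"]) (use D(1) in \<open>auto simp: P_def\<close>)
    moreover have "g -` S \<inter> space M = (\<Union>(d, n)\<in>P. {x \<in> space M. norm (g x - d) \<le> 1 / Suc n})"
    proof (intro equalityI subsetI)
      fix x assume x: "x \<in> g -` S \<inter> space M"
      then obtain e where e: "e > 0" "cball (g x) e \<subseteq> S" using S open_contains_cball by blast
      obtain n where n: "1 / Suc n < e / 2" using e(1) nat_approx_posE[of "e / 2"] by auto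
      obtain d where d: "d \<in> D" "dist d (g x) < 1 / Suc n"
        using D(2) closure_approachable[of "g x" D] by (metis UNIV_I subsetD zero_less_divide_1_iff of_nat_0_less_iff zero_less_Suc)
      have "cball d (1 / Suc n) \<subseteq> cball (g x) e"
      proof
        fix y assume "y \<in> cball d (1 / Suc n)"
        then have "dist d y \<le> 1 / Suc n" by simp
        with d n dist_triangle[of "g x" y d] show "y \<in> cball (g x) e" by (simp add: dist_commute)
      qed
      with e(2) d(1) have "(d, n) \<in> P" by (auto simp: P_def)
      with d(2) x show "x \<in> (\<Union>(d, n)\<in>P. {x \<in> space M. norm (g x - d) \<le> 1 / Suc n})"
        by (force simp: dist_norm norm_minus_commute)
    next
      fix x assume "x \<in> (\<Union>(d, n)\<in>P. {x \<in> space M. norm (g x - d) \<le> 1 / Suc n})"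
      then show "x \<in> g -` S \<inter> space M" by (fastforce simp: P_def dist_norm norm_minus_commute)
    qed
    ultimately show "g -` S \<inter> space M \<in> sets M"
      using ball by (auto intro!: sets.countable_UN'')
  qed
qed

section \<open>Exponential decay of the Wright function\<close>

lemma sums_integral_dominated:
  fixes f :: "nat \<Rightarrow> 'a \<Rightarrow> 'b::{banach, second_countable_topology}"
  assumes f: "\<And>n. integrable M (f n)" and F: "integrable M F"
    and le: "\<And>N x. x \<in> space M \<Longrightarrow> (\<Sum>n<N. norm (f n x)) \<le> F x"
  shows "(\<lambda>n. integral\<^sup>L M (f n)) sums (\<integral>x. (\<Sum>n. f n x) \<partial>M)"
    and "integrable M (\<lambda>x. \<Sum>n. f n x)"
proof -
  have 1: "AE x in M. summable (\<lambda>n. norm (f n x))"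
    by (rule AE_I2, rule summableI_nonneg_bounded[OF _ le]) auto
  have 2: "summable (\<lambda>n. \<integral>x. norm (f n x) \<partial>M)"
  proof (rule summableI_nonneg_bounded)
    fix N
    have "(\<Sum>n<N. \<integral>x. norm (f n x) \<partial>M) = (\<integral>x. (\<Sum>n<N. norm (f n x)) \<partial>M)"
      using f by (intro Bochner_Integration.integral_sum[symmetric]) auto
    also have "\<dots> \<le> integral\<^sup>L M F" using f F le by (intro integral_mono) auto
    finally show "(\<Sum>n<N. \<integral>x. norm (f n x) \<partial>M) \<le> integral\<^sup>L M F" .
  qed auto
  show "(\<lambda>n. integral\<^sup>L M (f n)) sums (\<integral>x. (\<Sum>n. f n x) \<partial>M)"
    by (rule sums_integral[OF f 1 2])
  show "integrable M (\<lambda>x. \<Sum>n. f n x)"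
    by (rule integrable_suminf[OF f 1 2])
qed

abbreviation half_line :: "real measure" where
  "half_line \<equiv> lebesgue_on {0..}"

lemma borel_measurable_half_line [measurable (raw)]:
  "f \<in> borel_measurable borel \<Longrightarrow> f \<in> borel_measurable half_line"
  by (intro measurable_restrict_space1 measurable_completion) (simp add: measurable_lborel1)

lemma AE_half_line_pos: "AE r in half_line. r > 0"
proof -
  have "AE r in lebesgue. r \<noteq> (0::real)"
    by (rule AE_completion) (rule AE_lborel_singleton)
  then show ?thesis by (subst AE_restrict_space_iff) auto
qed

lemma integrable_powr_exp:
  assumes z: "z > 0" and q: "q > 0"
  shows "integrable half_line (\<lambda>r. r powr (z - 1) * exp (- (q * r)))"
proof -
  let ?f = "\<lambda>t. complex_of_real t powr (complex_of_real z - 1) / of_real (exp (q * t))"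
  have "?f absolutely_integrable_on {0<..}"
    using absolutely_integrable_Gamma_integral[of "complex_of_real z" q] z q by simp
  then have "?f absolutely_integrable_on {0..}"
  proof (rule absolutely_integrable_spike_set_eq[THEN iffD1, rotated 2])
    show "negligible {x \<in> {0<..} - {0..}. ?f x \<noteq> 0}"
      by (rule negligible_subset[of "{0}"]) auto
    show "negligible {x \<in> {0..} - {0<..}. ?f x \<noteq> 0}"
      by (rule negligible_subset[of "{0}"]) auto
  qed
  then have "integrable half_line ?f" by (intro absolutely_integrable_imp_integrable) auto
  then have "integrable half_line (\<lambda>t. norm (?f t))" by (rule integrable_norm)
  moreover have *: "norm (?f t) = t powr (z - 1) * exp (- (q * t))" if "t \<in> space half_line" for t
    using that powr_of_real[of t "z - 1"]
    by (simp add: norm_mult norm_inverse exp_minus divide_inverse)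
  moreover have "integrable half_line (\<lambda>t. norm (?f t))
      \<longleftrightarrow> integrable half_line (\<lambda>t. t powr (z - 1) * exp (- (q * t)))"
    by (rule Bochner_Integration.integrable_cong[OF refl *])
  ultimately show ?thesis by blast
qed

lemma integral_powr_exp:
  assumes z: "z > 0"
  shows "(\<integral>r. r powr (z - 1) * exp (- r) \<partial>half_line) = Gamma z"
proof -
  have "integral {0..} (\<lambda>t. t powr (z - 1) / exp t) = Gamma z"
    using Gamma_integral_real[OF z] by (rule integral_unique)
  then show ?thesis
    using lebesgue_integral_eq_integral[of "{0..}" "\<lambda>r. r powr (z - 1) * exp (- r)"]
      integrable_powr_exp[OF z, of 1] by (simp add: exp_minus divide_inverse)
qed

lemma exp_sums_divide:
  fixes w :: "'b::{real_normed_field, banach}"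
  shows "(\<lambda>n. w ^ n / fact n) sums exp w"
  using exp_converges[of w] by (simp add: scaleR_conv_of_real divide_inverse mult.commute)

lemma sum_norm_exp_le:
  fixes w :: "'b::{real_normed_field, banach}"
  shows "(\<Sum>n<N. norm (w ^ n / fact n)) \<le> exp (norm w)"
proof -
  have "(\<Sum>n<N. norm (w ^ n / fact n)) = (\<Sum>n<N. norm w ^ n / fact n)"
    by (simp add: norm_divide norm_power)
  also have "\<dots> \<le> (\<Sum>n. norm w ^ n / fact n)"
    using exp_sums_divide[of "norm w"] by (intro sum_le_suminf) (auto simp: sums_iff)
  also have "\<dots> = exp (norm w)" using exp_sums_divide[of "norm w"] by (simp add: sums_iff)
  finally show ?thesis .
qed

text \<open>
  Expand \<open>exp (- (w - 1) r)\<close> under the integral: the terms integrate to multiples of \<open>Gamma (z + n)\<close>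
  and add up to the binomial series of \<open>w powr (- z)\<close>, which converges for \<open>norm (w - 1) < 1\<close>.
  Every direction in the open right half-plane is represented by such a \<open>w\<close>.
\<close>

lemma Gamma_integral_ray:
  fixes w :: complex
  assumes z: "z > 0" and w: "norm (w - 1) < 1"
  shows "(\<integral>r. of_real (r powr (z - 1)) * exp (- w * of_real r) \<partial>half_line)
           = of_real (Gamma z) * w powr (- of_real z)"
proof -
  define v where "v = w - 1"
  define f where "f n r = of_real (r powr (z - 1) * exp (- r)) * ((- v * of_real r) ^ n / fact n)"
    for n and r :: real
  have f_eq: "f n r = (- v) ^ n / fact n * of_real (r powr (z + real n - 1) * exp (- r))"
    if "r \<ge> 0" for n r
  proof (cases "r = 0 \<or> n = 0")
    case False
    then have "r powr (z - 1) * r ^ n = r powr (z + real n - 1)"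
      using that by (simp add: powr_realpow[symmetric] powr_add[symmetric] algebra_simps)
    then have "of_real (r powr (z - 1)) * of_real r ^ n = complex_of_real (r powr (z + real n - 1))"
      by (metis of_real_mult of_real_power)
    then show ?thesis
      by (simp add: f_def power_mult_distrib power_minus[of v] power_minus[of "v * of_real r"] mult_ac)
  qed (auto simp: f_def)
  have int: "integrable half_line (f n)" for n
  proof -
    have "integrable half_line (\<lambda>r. (- v) ^ n / fact n * of_real (r powr (z + real n - 1) * exp (- r)))"
      using integrable_powr_exp[of "z + real n" 1] z
      by (intro integrable_mult_right integrable_of_real) simp
    moreover have "integrable half_line (f n) \<longleftrightarrow> integrable half_line
        (\<lambda>r. (- v) ^ n / fact n * of_real (r powr (z + real n - 1) * exp (- r)))"
      by (rule Bochner_Integration.integrable_cong) (auto simp: f_eq)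
    ultimately show ?thesis by simp
  qed
  have val: "integral\<^sup>L half_line (f n) = of_real (Gamma z) * ((- of_real z gchoose n) * v ^ n)" for n
  proof -
    have "integral\<^sup>L half_line (f n)
        = (\<integral>r. (- v) ^ n / fact n * of_real (r powr (z + real n - 1) * exp (- r)) \<partial>half_line)"
      using f_eq by (intro Bochner_Integration.integral_cong) auto
    also have "\<dots> = (- v) ^ n / fact n * of_real (\<integral>r. r powr (z + real n - 1) * exp (- r) \<partial>half_line)"
      by (simp del: of_real_mult)
    also have "(\<integral>r. r powr (z + real n - 1) * exp (- r) \<partial>half_line) = Gamma (z + real n)"
      by (rule integral_powr_exp) (use z in simp)
    also have "Gamma (z + real n) = pochhammer z n * Gamma z"
    proof -
      have "z \<notin> \<int>\<^sub>\<le>\<^sub>0" using z nonpos_Ints_nonpos[of z] by auto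
      then show ?thesis using Gamma_real_pos[OF z] by (simp add: pochhammer_Gamma)
    qed
    also have "(- v) ^ n / fact n * complex_of_real (pochhammer z n * Gamma z)
        = of_real (Gamma z) * ((- of_real z gchoose n) * v ^ n)"
      by (simp add: gbinomial_pochhammer power_minus[of v] pochhammer_of_real)
    finally show ?thesis .
  qed
  have F: "integrable half_line (\<lambda>r. r powr (z - 1) * exp (- ((1 - norm v) * r)))"
    using w z by (intro integrable_powr_exp) (auto simp: v_def)
  have le: "(\<Sum>n<N. norm (f n r)) \<le> r powr (z - 1) * exp (- ((1 - norm v) * r))"
    if "r \<in> space half_line" for N r
  proof -
    have "(\<Sum>n<N. norm (f n r)) = r powr (z - 1) * exp (- r) * (\<Sum>n<N. norm ((- v * of_real r) ^ n / fact n))"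
      unfolding f_def norm_mult sum_distrib_left by (simp add: abs_mult del: of_real_mult)
    also have "\<dots> \<le> r powr (z - 1) * exp (- r) * exp (norm (- v * of_real r))"
      by (intro mult_left_mono sum_norm_exp_le) auto
    also have "\<dots> = r powr (z - 1) * exp (- ((1 - norm v) * r))"
      using that by (simp add: norm_mult algebra_simps flip: exp_add)
    finally show ?thesis .
  qed
  have "(\<lambda>n. integral\<^sup>L half_line (f n)) sums (\<integral>r. (\<Sum>n. f n r) \<partial>half_line)"
    by (rule sums_integral_dominated(1)[OF int F le])
  moreover have "(\<Sum>n. f n r) = of_real (r powr (z - 1)) * exp (- w * of_real r)" for r
  proof -
    have "(\<Sum>n. f n r) = of_real (r powr (z - 1) * exp (- r)) * exp (- v * of_real r)"
      unfolding f_def by (rule sums_unique[symmetric]) (intro sums_mult exp_sums_divide)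
    also have "\<dots> = of_real (r powr (z - 1)) * exp (of_real (- r) + - v * of_real r)"
      unfolding exp_add exp_of_real by simp
    also have "of_real (- r) + - v * of_real r = - w * of_real r" by (simp add: v_def algebra_simps)
    finally show ?thesis .
  qed
  ultimately have "(\<lambda>n. of_real (Gamma z) * ((- of_real z gchoose n) * v ^ n)) sums
      (\<integral>r. of_real (r powr (z - 1)) * exp (- w * of_real r) \<partial>half_line)"
    by (simp add: val)
  moreover have "(\<lambda>n. of_real (Gamma z) * ((- of_real z gchoose n) * v ^ n)) sums
      (of_real (Gamma z) * (1 + v) powr (- of_real z))"
    using w by (intro sums_mult gen_binomial_complex) (simp add: v_def)
  ultimately show ?thesis by (simp add: sums_unique2 v_def)
qed

text \<open>
  Take \<open>w = - \<mu>\<close> in the previous lemma.  The quotient of the powers \<open>\<mu> powr z\<close> and \<open>(- \<mu>) powr z\<close> is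
  \<open>exp (i pi z)\<close>, whose imaginary part is the sine in Euler's reflection formula.
\<close>

lemma rGamma_conv_ray_integral:
  assumes z: "z > 0" and mu: "Re \<mu> < 0" "Im \<mu> > 0" "norm (1 + \<mu>) < 1"
  shows "rGamma (1 - z) =
           Im (\<mu> powr of_real z * (\<integral>r. of_real (r powr (z - 1)) * exp (\<mu> * of_real r) \<partial>half_line)) / pi"
proof -
  define w where "w = - \<mu>"
  have "\<mu> \<noteq> 0" using mu by auto
  have "norm (w - 1) = norm (1 + \<mu>)"
    unfolding w_def by (metis minus_add_distrib norm_minus_cancel add.commute uminus_add_conv_diff diff_minus_eq_add minus_diff_eq)
  then have w: "norm (w - 1) < 1" using mu by simp
  have "Ln \<mu> = Ln w + \<i> * pi" using Ln_minus[of w] mu \<open>\<mu> \<noteq> 0\<close> by (auto simp: w_def)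
  then have "\<mu> powr of_real z * w powr (- of_real z) = exp (\<i> * of_real (pi * z))"
    using \<open>\<mu> \<noteq> 0\<close> by (simp add: powr_def w_def algebra_simps flip: exp_add)
  then have "\<mu> powr of_real z * (of_real (Gamma z) * w powr (- of_real z))
      = of_real (Gamma z) * cis (pi * z)" by (simp add: cis_conv_exp mult_ac)
  moreover have "(\<integral>r. of_real (r powr (z - 1)) * exp (\<mu> * of_real r) \<partial>half_line)
      = of_real (Gamma z) * w powr (- of_real z)"
    using Gamma_integral_ray[OF z w] by (simp add: w_def)
  ultimately have "Im (\<mu> powr of_real z * (\<integral>r. of_real (r powr (z - 1)) * exp (\<mu> * of_real r) \<partial>half_line))
      = Im (of_real (Gamma z) * cis (pi * z))"
    by (simp only:)
  then have ImI: "Im (\<mu> powr of_real z * (\<integral>r. of_real (r powr (z - 1)) * exp (\<mu> * of_real r) \<partial>half_line))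
      = Gamma z * sin (pi * z)"
    by simp
  have reflection: "rGamma z * rGamma (1 - z) = sin (pi * z) / pi"
  proof -
    have "complex_of_real (rGamma z * rGamma (1 - z)) = of_real (sin (pi * z) / pi)"
      using rGamma_reflection_complex[of "of_real z"] rGamma_complex_of_real[of "1 - z"]
      by (simp add: rGamma_complex_of_real sin_of_real flip: of_real_mult)
    then show ?thesis by (simp only: of_real_eq_iff)
  qed
  have "Gamma z * sin (pi * z) / pi = Gamma z * rGamma z * rGamma (1 - z)"
    using reflection by (metis mult.assoc times_divide_eq_right)
  also have "Gamma z * rGamma z = 1" using Gamma_real_pos[OF z] by (simp add: rGamma_inverse_Gamma)
  finally have rG: "rGamma (1 - z) = Gamma z * sin (pi * z) / pi" by simp
  then show ?thesis by (simp only: ImI)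
qed

lemma powr_le_linear:
  fixes \<alpha> A q :: real
  assumes "0 < \<alpha>" "\<alpha> < 1" "A > 0" "q > 0"
  obtains C where "\<And>r. r \<ge> 0 \<Longrightarrow> A * r powr \<alpha> \<le> q * r + C"
proof
  define R where "R = (A / q) powr (1 / (1 - \<alpha>))"
  have R: "R > 0" using assms by (simp add: R_def)
  have RA: "A * R powr (\<alpha> - 1) = q"
  proof -
    have "1 / (1 - \<alpha>) * (\<alpha> - 1) = - 1" using assms by (simp add: field_simps)
    then have "R powr (\<alpha> - 1) = (A / q) powr - 1" by (simp only: R_def powr_powr)
    then show ?thesis using assms by (simp add: powr_minus)
  qed
  fix r :: real assume r: "r \<ge> 0"
  show "A * r powr \<alpha> \<le> q * r + A * R powr \<alpha>"
  proof (cases "r \<le> R")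
    case True
    then have "r powr \<alpha> \<le> R powr \<alpha>" using r assms by (intro powr_mono2) auto
    then show ?thesis using assms r by (simp add: add_increasing)
  next
    case False
    then have "r powr (\<alpha> - 1) \<le> R powr (\<alpha> - 1)" using R assms by (intro powr_mono2') auto
    moreover have "r powr \<alpha> = r powr (\<alpha> - 1) * r" using False R by (simp add: powr_mult_base' powr_diff)
    ultimately have "A * r powr \<alpha> \<le> (A * R powr (\<alpha> - 1)) * r" using r assms by (simp add: mult_right_mono)
    also have "\<dots> \<le> q * r + A * R powr \<alpha>" using RA assms by simp
    finally show ?thesis .
  qed
qed

text \<open>The integrand of Hankel's contour integral for \<open>M\<^sub>\<alpha>\<close>.\<close>

definition wright_integrand :: "real \<Rightarrow> real \<Rightarrow> complex \<Rightarrow> complex" where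
  "wright_integrand \<alpha> \<theta> \<sigma> =
     exp (\<sigma> - of_real \<theta> * \<sigma> powr of_real \<alpha>) * \<sigma> powr (of_real (\<alpha> - 1))"

text \<open>
  The power series of \<open>M\<^sub>\<alpha>\<close>, with each coefficient written as an integral along the ray through \<open>\<mu>\<close>,
  is summed under the integral.  Domination needs \<open>\<alpha> < 1\<close>: the exponential series contributes
  \<open>exp (A * r powr \<alpha>)\<close>, which a decaying exponential absorbs.
\<close>

lemma wright_M_conv_ray_integral:
  assumes \<alpha>: "0 < \<alpha>" "\<alpha> < 1" and \<theta>: "\<theta> \<ge> 0"
    and mu: "Re \<mu> < 0" "Im \<mu> > 0" "norm (1 + \<mu>) < 1"
  shows "wright_M \<alpha> \<theta> = Im (\<integral>r. wright_integrand \<alpha> \<theta> (\<mu> * of_real r) * \<mu> \<partial>half_line) / pi"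
proof -
  have "\<mu> \<noteq> 0" using mu by auto
  define \<zeta> where "\<zeta> = \<mu> powr of_real \<alpha>"
  define f where "f n r = \<zeta> * of_real (r powr (\<alpha> - 1)) * exp (\<mu> * of_real r) *
      ((- of_real \<theta> * \<zeta> * of_real (r powr \<alpha>)) ^ n / fact n)" for n and r :: real
  define c where "c n = (- \<theta>) ^ n / fact n" for n
  define g where "g n r = \<mu> powr of_real (\<alpha> * real (n + 1)) *
      (of_real (r powr (\<alpha> * real (n + 1) - 1)) * exp (\<mu> * of_real r))" for n r
  have pos: "\<alpha> * real (n + 1) > 0" for n using \<alpha> by simp
  have f_eq: "f n r = of_real (c n) * g n r" if "r > 0" for n r
  proof -
    have 1: "\<zeta> ^ Suc n = \<mu> powr of_real (\<alpha> * real (n + 1))"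
      using \<open>\<mu> \<noteq> 0\<close> unfolding \<zeta>_def powr_def
      by (simp del: power_Suc add: exp_of_nat_mult[symmetric] mult_ac)
    have 2: "r powr (\<alpha> - 1) * (r powr \<alpha>) ^ n = r powr (\<alpha> * real (n + 1) - 1)"
      using that by (simp add: powr_realpow[symmetric] powr_powr powr_add[symmetric] algebra_simps)
    have 3: "(- of_real \<theta> * \<zeta> * of_real (r powr \<alpha>)) ^ n
        = of_real ((- \<theta>) ^ n) * \<zeta> ^ n * of_real ((r powr \<alpha>) ^ n)"
      by (simp flip: power_mult_distrib)
    show ?thesis unfolding f_def g_def c_def 1[symmetric] 2[symmetric] 3
      by (simp add: mult_ac)
  qed
  have [measurable]: "f n \<in> borel_measurable half_line" for n
    unfolding f_def by (intro borel_measurable_half_line) measurable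
  have ig: "integrable half_line (g n)" for n
  proof -
    have "integrable half_line (\<lambda>r. complex_of_real (r powr (\<alpha> * real (n + 1) - 1)) * exp (\<mu> * of_real r))"
    proof (rule Bochner_Integration.integrable_bound[OF integrable_powr_exp[OF pos[of n], of "- Re \<mu>"]])
      show "(\<lambda>r. complex_of_real (r powr (\<alpha> * real (n + 1) - 1)) * exp (\<mu> * of_real r)) \<in> borel_measurable half_line"
        by (intro borel_measurable_half_line) measurable
    qed (use mu in \<open>auto simp: norm_mult\<close>)
    then show ?thesis unfolding g_def by (rule integrable_mult_right)
  qed
  have int: "integrable half_line (f n)" for n
  proof -
    have "integrable half_line (\<lambda>r. of_real (c n) * g n r)" by (intro integrable_mult_right ig)
    then show ?thesis
      by (rule integrable_cong_AE_imp) (use AE_half_line_pos in \<open>auto elim!: eventually_mono simp: f_eq\<close>)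
  qed
  have val: "Im (integral\<^sup>L half_line (f n)) = pi * (c n * rGamma (1 - \<alpha> * real (n + 1)))" for n
  proof -
    have "integral\<^sup>L half_line (f n) = (\<integral>r. of_real (c n) * g n r \<partial>half_line)"
      using ig by (intro integral_cong_AE) (use AE_half_line_pos in \<open>auto elim!: eventually_mono simp: f_eq\<close>)
    also have "\<dots> = of_real (c n) * (\<integral>r. g n r \<partial>half_line)" by simp
    also have "Im \<dots> = c n * Im (\<integral>r. g n r \<partial>half_line)" by simp
    also have "Im (\<integral>r. g n r \<partial>half_line) = pi * rGamma (1 - \<alpha> * real (n + 1))"
      unfolding rGamma_conv_ray_integral[OF pos mu] g_def by simp
    finally show ?thesis by (simp add: mult_ac)
  qed
  define A where "A = \<theta> * norm \<zeta> + 1"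
  have A: "A > 0" using \<theta> by (simp add: A_def add_nonneg_pos)
  obtain C where C: "\<And>r. r \<ge> 0 \<Longrightarrow> A * r powr \<alpha> \<le> - Re \<mu> / 2 * r + C"
    using powr_le_linear[OF \<alpha> A, of "- Re \<mu> / 2"] mu by auto
  define F where "F r = norm \<zeta> * exp C * (r powr (\<alpha> - 1) * exp (- (- Re \<mu> / 2 * r)))" for r
  have F: "integrable half_line F"
    unfolding F_def using mu \<alpha> by (intro integrable_mult_right integrable_powr_exp) auto
  have le: "(\<Sum>n<N. norm (f n r)) \<le> F r" if "r \<in> space half_line" for N r
  proof -
    have r: "r \<ge> 0" using that by simp
    let ?x = "- of_real \<theta> * \<zeta> * of_real (r powr \<alpha>)"
    have "(\<Sum>n<N. norm (f n r)) = norm \<zeta> * r powr (\<alpha> - 1) * exp (Re \<mu> * r) * (\<Sum>n<N. norm (?x ^ n / fact n))"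
      unfolding f_def norm_mult sum_distrib_left by simp
    also have "\<dots> \<le> norm \<zeta> * r powr (\<alpha> - 1) * exp (Re \<mu> * r) * exp (norm ?x)"
      by (intro mult_left_mono sum_norm_exp_le) auto
    also have "norm ?x \<le> A * r powr \<alpha>"
      using \<theta> by (simp add: norm_mult A_def distrib_right)
    also have "\<dots> \<le> - Re \<mu> / 2 * r + C" using C[OF r] .
    finally have "(\<Sum>n<N. norm (f n r)) \<le> norm \<zeta> * r powr (\<alpha> - 1) * exp (Re \<mu> * r) * exp (- Re \<mu> / 2 * r + C)"
      by (simp add: mult_left_mono)
    also have "\<dots> = F r"
    proof -
      have "exp (Re \<mu> * r) * exp (- Re \<mu> / 2 * r + C) = exp C * exp (- (- Re \<mu> / 2 * r))"
        unfolding exp_add[symmetric] by (simp add: algebra_simps)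
      then have "norm \<zeta> * r powr (\<alpha> - 1) * (exp (Re \<mu> * r) * exp (- Re \<mu> / 2 * r + C)) = F r"
        unfolding F_def by (simp only: mult_ac)
      then show ?thesis by (simp only: mult.assoc)
    qed
    finally show ?thesis .
  qed
  note sums = sums_integral_dominated[OF int F le]
  have sum_f: "(\<Sum>n. f n r) = wright_integrand \<alpha> \<theta> (\<mu> * of_real r) * \<mu>" if r: "r > 0" for r
  proof -
    have Ln: "Ln (\<mu> * of_real r) = Ln \<mu> + of_real (ln r)"
      using r \<open>\<mu> \<noteq> 0\<close> Ln_times_of_real[of r \<mu>] by (simp add: mult.commute add.commute Ln_of_real)
    have pw: "(\<mu> * of_real r) powr of_real s = \<mu> powr of_real s * of_real (r powr s)" for s
      using r \<open>\<mu> \<noteq> 0\<close> by (simp add: powr_def Ln distrib_left exp_add exp_of_real[symmetric])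
    have "\<mu> powr of_real (\<alpha> - 1) * \<mu> = \<zeta>"
      using \<open>\<mu> \<noteq> 0\<close> by (simp add: \<zeta>_def powr_diff)
    then have eq: "wright_integrand \<alpha> \<theta> (\<mu> * of_real r) * \<mu> =
        \<zeta> * of_real (r powr (\<alpha> - 1)) * (exp (\<mu> * of_real r) * exp (- of_real \<theta> * \<zeta> * of_real (r powr \<alpha>)))"
      unfolding wright_integrand_def pw \<zeta>_def[symmetric]
      by (simp add: exp_diff exp_minus divide_inverse mult_ac)
    have "(\<Sum>n. f n r) = \<zeta> * of_real (r powr (\<alpha> - 1)) * exp (\<mu> * of_real r) * exp (- of_real \<theta> * \<zeta> * of_real (r powr \<alpha>))"
      unfolding f_def by (rule sums_unique[symmetric]) (intro sums_mult exp_sums_divide)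
    then show ?thesis unfolding eq by (simp add: mult_ac)
  qed
  have meas: "(\<lambda>r. wright_integrand \<alpha> \<theta> (\<mu> * of_real r) * \<mu>) \<in> borel_measurable half_line"
    unfolding wright_integrand_def powr_def by (intro borel_measurable_half_line) measurable
  have ae: "AE r in half_line. (\<Sum>n. f n r) = wright_integrand \<alpha> \<theta> (\<mu> * of_real r) * \<mu>"
    using AE_half_line_pos by (auto elim!: eventually_mono simp: sum_f)
  have "(\<integral>r. (\<Sum>n. f n r) \<partial>half_line) = (\<integral>r. wright_integrand \<alpha> \<theta> (\<mu> * of_real r) * \<mu> \<partial>half_line)"
    using sums(2) meas ae by (intro integral_cong_AE) auto
  with bounded_linear.sums[OF bounded_linear_Im sums(1)]
  have "(\<lambda>n. pi * (c n * rGamma (1 - \<alpha> * real (n + 1)))) sums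
      Im (\<integral>r. wright_integrand \<alpha> \<theta> (\<mu> * of_real r) * \<mu> \<partial>half_line)" by (simp only: val)
  from sums_divide[OF this, of pi]
  show "wright_M \<alpha> \<theta> = Im (\<integral>r. wright_integrand \<alpha> \<theta> (\<mu> * of_real r) * \<mu> \<partial>half_line) / pi"
    by (simp add: wright_M_def c_def sums_iff)
qed

text \<open>
  The hypotheses place \<open>\<sigma>\<close> in the sector between the positive real axis and the ray through \<open>\<mu>\<close>;
  after raising to the power \<open>\<alpha>\<close> that sector lies in the open right half-plane.
\<close>

lemma Re_powr_ge:
  assumes \<alpha>: "0 < \<alpha>" and mu: "Im \<mu> > 0" "\<alpha> * Arg \<mu> < pi / 2"
    and s: "Im \<sigma> \<ge> 0" "\<sigma> \<noteq> 0" "Im (\<mu> * cnj \<sigma>) \<ge> 0"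
  shows "cos (\<alpha> * Arg \<mu>) * norm \<sigma> powr \<alpha> \<le> Re (\<sigma> powr of_real \<alpha>)"
proof -
  have "\<mu> \<noteq> 0" using mu by auto
  have Arg_mu: "0 < Arg \<mu>" "Arg \<mu> < pi" using mu Arg_lt_pi[of \<mu>] by auto
  have Arg_s: "0 \<le> Arg \<sigma>" "Arg \<sigma> \<le> pi" using s Arg_less_0[of \<sigma>] Arg_le_pi[of \<sigma>] by auto
  have "Arg \<sigma> \<le> Arg \<mu>"
  proof (rule ccontr)
    assume "\<not> Arg \<sigma> \<le> Arg \<mu>"
    then have "sin (Arg \<mu> - Arg \<sigma>) < 0"
      using Arg_mu Arg_s sin_gt_zero[of "Arg \<sigma> - Arg \<mu>"] sin_minus[of "Arg \<sigma> - Arg \<mu>"] by simp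
    moreover have "\<mu> * cnj \<sigma> = of_real (norm \<mu> * norm \<sigma>) * cis (Arg \<mu> - Arg \<sigma>)"
    proof -
      have "\<mu> = of_real (norm \<mu>) * cis (Arg \<mu>)" "\<sigma> = of_real (norm \<sigma>) * cis (Arg \<sigma>)"
        using \<open>\<mu> \<noteq> 0\<close> s by (simp_all add: cis_Arg sgn_eq)
      then have "\<mu> * cnj \<sigma> = of_real (norm \<mu>) * cis (Arg \<mu>) * cnj (of_real (norm \<sigma>) * cis (Arg \<sigma>))"
        by simp
      also have "\<dots> = of_real (norm \<mu> * norm \<sigma>) * (cis (Arg \<mu>) * cis (- Arg \<sigma>))"
        by (simp add: cis_cnj mult_ac)
      finally show ?thesis by (simp add: cis_mult)
    qed
    ultimately have "Im (\<mu> * cnj \<sigma>) < 0"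
      using \<open>\<mu> \<noteq> 0\<close> s by (simp add: mult_pos_neg)
    with s show False by simp
  qed
  then have "cos (\<alpha> * Arg \<mu>) \<le> cos (\<alpha> * Arg \<sigma>)"
    using Arg_s mu \<alpha> by (intro cos_monotone_0_pi_le) (auto simp: mult_left_mono)
  moreover have "Re (\<sigma> powr of_real \<alpha>) = norm \<sigma> powr \<alpha> * cos (\<alpha> * Arg \<sigma>)"
    using s by (simp add: powr_def Re_exp Ln_Arg)
  ultimately show ?thesis by (simp add: mult.commute mult_left_mono)
qed

lemma wright_integrand_bound:
  assumes \<alpha>: "0 < \<alpha>" "\<alpha> < 1" and \<theta>: "\<theta> \<ge> 0"
    and mu: "Im \<mu> > 0" "\<alpha> * Arg \<mu> < pi / 2"
    and cr: "c \<ge> 0" "r \<ge> 0"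
    and m: "0 < m" "m \<le> norm (of_real c + \<mu> * of_real r)"
  shows "norm (wright_integrand \<alpha> \<theta> (of_real c + \<mu> * of_real r))
     \<le> exp (c + r * Re \<mu>) * m powr (\<alpha> - 1) * exp (- \<theta> * (cos (\<alpha> * Arg \<mu>) * m powr \<alpha>))"
proof -
  define \<sigma> where "\<sigma> = of_real c + \<mu> * of_real r"
  have "Im (\<mu> * cnj \<sigma>) = c * Im \<mu>" by (simp add: \<sigma>_def algebra_simps)
  then have s: "\<sigma> \<noteq> 0" "Im \<sigma> \<ge> 0" "Im (\<mu> * cnj \<sigma>) \<ge> 0"
    using m mu cr by (auto simp: \<sigma>_def)
  have "0 < Arg \<mu>" using mu Arg_lt_pi[of \<mu>] by auto
  then have "0 \<le> \<alpha> * Arg \<mu>" using \<alpha> by simp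
  then have k: "cos (\<alpha> * Arg \<mu>) \<ge> 0" using mu by (intro cos_ge_zero) auto
  have "cos (\<alpha> * Arg \<mu>) * m powr \<alpha> \<le> cos (\<alpha> * Arg \<mu>) * norm \<sigma> powr \<alpha>"
    using m \<alpha> k by (intro mult_left_mono powr_mono2) (auto simp: \<sigma>_def)
  also have "\<dots> \<le> Re (\<sigma> powr of_real \<alpha>)"
    by (rule Re_powr_ge) (use s mu \<alpha> in auto)
  finally have "\<theta> * (cos (\<alpha> * Arg \<mu>) * m powr \<alpha>) \<le> \<theta> * Re (\<sigma> powr of_real \<alpha>)"
    using \<theta> by (rule mult_left_mono)
  then have "exp (Re (\<sigma> - of_real \<theta> * \<sigma> powr of_real \<alpha>))
      \<le> exp (c + r * Re \<mu>) * exp (- \<theta> * (cos (\<alpha> * Arg \<mu>) * m powr \<alpha>))"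
    by (simp add: \<sigma>_def mult.commute flip: exp_add)
  moreover have "norm \<sigma> powr (\<alpha> - 1) \<le> m powr (\<alpha> - 1)"
    using m \<alpha> by (intro powr_mono2') (auto simp: \<sigma>_def)
  ultimately have "norm (wright_integrand \<alpha> \<theta> \<sigma>)
      \<le> (exp (c + r * Re \<mu>) * exp (- \<theta> * (cos (\<alpha> * Arg \<mu>) * m powr \<alpha>))) * m powr (\<alpha> - 1)"
    unfolding wright_integrand_def norm_mult norm_exp_eq_Re
    by (intro mult_mono) (auto simp: norm_powr_real_powr')
  then show ?thesis by (simp add: \<sigma>_def mult_ac)
qed

text \<open>
  The open half-plane \<open>H\<close> around the bisector of \<open>1\<close> and \<open>\<mu>\<close> is convex, avoids the branch cut, and
  contains the closed sector between \<open>1\<close> and \<open>\<mu>\<close> except for its vertex, so the integrand has a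
  primitive there.
\<close>

lemma wright_integrand_primitive:
  assumes mu: "Im \<mu> > 0"
  obtains P where
    "\<And>c r. c \<ge> 0 \<Longrightarrow> r \<ge> 0 \<Longrightarrow> c > 0 \<or> r > 0 \<Longrightarrow>
       (P has_field_derivative wright_integrand \<alpha> \<theta> (of_real c + \<mu> * of_real r)) (at (of_real c + \<mu> * of_real r))"
proof -
  define \<nu> where "\<nu> = of_real (norm \<mu>) + \<mu>"
  define H where "H = {\<sigma>. Re (\<sigma> * cnj \<nu>) > 0}"
  have "\<mu> \<noteq> 0" using mu by auto
  have "\<bar>Re \<mu>\<bar> < norm \<mu>" using mu abs_Re_le_cmod[of \<mu>] cmod_power2[of \<mu>]
    by (smt (verit) power2_abs power_mono zero_less_power2 abs_ge_zero real_sqrt_abs2 power2_eq_square)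
  then have nu: "Re \<nu> > 0" "Re (\<mu> * cnj \<nu>) > 0"
  proof -
    assume *: "\<bar>Re \<mu>\<bar> < norm \<mu>"
    then show "Re \<nu> > 0" by (simp add: \<nu>_def)
    have "Re (\<mu> * cnj \<nu>) = norm \<mu> * (Re \<mu> + norm \<mu>)"
      using cmod_power2[of \<mu>] by (simp add: \<nu>_def power2_eq_square algebra_simps)
    with * \<open>\<mu> \<noteq> 0\<close> show "Re (\<mu> * cnj \<nu>) > 0" by simp
  qed
  have H_eq: "H = {\<sigma>. inner \<nu> \<sigma> > 0}" by (auto simp: H_def inner_complex_def algebra_simps)
  have "convex H" "open H"
    unfolding H_eq by (rule convex_halfspace_gt, rule open_halfspace_gt)
  have H_slit: "\<sigma> \<notin> \<real>\<^sub>\<le>\<^sub>0" if "\<sigma> \<in> H" for \<sigma>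
  proof
    assume "\<sigma> \<in> \<real>\<^sub>\<le>\<^sub>0"
    then obtain x where "\<sigma> = of_real x" "x \<le> 0" by (auto elim!: nonpos_Reals_cases)
    with that nu show False by (simp add: H_def zero_less_mult_iff)
  qed
  have "wright_integrand \<alpha> \<theta> holomorphic_on H"
    unfolding wright_integrand_def using H_slit by (intro holomorphic_intros) auto
  then obtain P where P: "\<And>x. x \<in> H \<Longrightarrow> (P has_field_derivative wright_integrand \<alpha> \<theta> x) (at x within H)"
    using holomorphic_convex_primitive'[OF \<open>convex H\<close> \<open>open H\<close>] by metis
  have "of_real c + \<mu> * of_real r \<in> H" if "c \<ge> 0" "r \<ge> 0" "c > 0 \<or> r > 0" for c r
  proof -
    have "Re ((of_real c + \<mu> * of_real r) * cnj \<nu>) = c * Re \<nu> + r * Re (\<mu> * cnj \<nu>)"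
      by (simp add: algebra_simps)
    also have "\<dots> > 0" using that nu by (auto intro: add_pos_nonneg add_nonneg_pos)
    finally show ?thesis by (simp add: H_def)
  qed
  then show ?thesis
    using P \<open>open H\<close> by (intro that[of P]) (metis at_within_open)
qed

lemma wright_integrand_measurable [measurable]:
  "(\<lambda>r. wright_integrand \<alpha> \<theta> (of_real c + \<mu> * of_real r) * \<mu>) \<in> borel_measurable half_line"
  unfolding wright_integrand_def powr_def by (intro borel_measurable_half_line) measurable

text \<open>
  Two lower bounds for the distance of a shifted ray from the branch point.  The one that is linear in
  \<open>r\<close> is uniform in the shift; the one that is linear in \<open>c\<close> produces the decay.
\<close>

lemma ray_shift_norm_ge:
  assumes "Im \<mu> > 0" "c \<ge> 0" "r \<ge> 0"
  shows "r * Im \<mu> \<le> norm (of_real c + \<mu> * of_real r)"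
    and "c * (Im \<mu> / norm \<mu>) \<le> norm (of_real c + \<mu> * of_real r)"
proof -
  let ?s = "of_real c + \<mu> * of_real r"
  show "r * Im \<mu> \<le> norm ?s" using abs_Im_le_cmod[of ?s] assms by (simp add: mult.commute)
  have "c * Im \<mu> = Im (\<mu> * cnj ?s)" by (simp add: algebra_simps)
  also have "\<dots> \<le> norm \<mu> * norm ?s"     using abs_Im_le_cmod[of "\<mu> * cnj ?s"] unfolding norm_mult complex_mod_cnj by linarith
  finally have "c * Im \<mu> \<le> norm \<mu> * norm ?s" .
  moreover have "norm \<mu> > 0" using assms by auto
  ultimately show "c * (Im \<mu> / norm \<mu>) \<le> norm ?s" by (simp add: field_simps)
qed

text \<open>
  The last factor, the integral of \<open>exp (r Re \<mu>)\<close> up to the null set \<open>{0}\<close>, is independent of \<open>\<theta>\<close>.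
\<close>

lemma wright_ray_integrable:
  assumes \<alpha>: "0 < \<alpha>" "\<alpha> < 1" and \<theta>: "\<theta> \<ge> 0"
    and mu: "Re \<mu> < 0" "Im \<mu> > 0" "\<alpha> * Arg \<mu> < pi / 2" and c: "c > 0"
  defines "m \<equiv> c * (Im \<mu> / norm \<mu>)"
  shows "integrable half_line (\<lambda>r. wright_integrand \<alpha> \<theta> (of_real c + \<mu> * of_real r) * \<mu>)"
    and "norm (\<integral>r. wright_integrand \<alpha> \<theta> (of_real c + \<mu> * of_real r) * \<mu> \<partial>half_line)
       \<le> norm \<mu> * exp c * m powr (\<alpha> - 1) * exp (- \<theta> * (cos (\<alpha> * Arg \<mu>) * m powr \<alpha>))
          * (\<integral>r. r powr (1 - 1) * exp (- (- Re \<mu> * r)) \<partial>half_line)"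
proof -
  let ?w = "\<lambda>r. norm \<mu> * exp c * m powr (\<alpha> - 1) * exp (- \<theta> * (cos (\<alpha> * Arg \<mu>) * m powr \<alpha>))
          * (r powr (1 - 1) * exp (- (- Re \<mu> * r)))"
  have "norm \<mu> > 0" using mu by auto
  then have m: "m > 0" using mu c by (simp add: m_def)
  have int: "integrable half_line ?w"
    by (intro integrable_mult_right integrable_powr_exp) (use mu in auto)
  have le: "norm (wright_integrand \<alpha> \<theta> (of_real c + \<mu> * of_real r) * \<mu>) \<le> ?w r" if "r > 0" for r
  proof -
    have "norm (wright_integrand \<alpha> \<theta> (of_real c + \<mu> * of_real r))
        \<le> exp (c + r * Re \<mu>) * m powr (\<alpha> - 1) * exp (- \<theta> * (cos (\<alpha> * Arg \<mu>) * m powr \<alpha>))"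
      using that c mu m ray_shift_norm_ge(2)[of \<mu> c r]
      by (intro wright_integrand_bound \<alpha> \<theta>) (auto simp: m_def)
    then have "norm \<mu> * norm (wright_integrand \<alpha> \<theta> (of_real c + \<mu> * of_real r))
        \<le> norm \<mu> * (exp (c + r * Re \<mu>) * m powr (\<alpha> - 1) * exp (- \<theta> * (cos (\<alpha> * Arg \<mu>) * m powr \<alpha>)))"
      by (rule mult_left_mono) simp
    then show ?thesis using that by (simp add: norm_mult exp_add mult_ac)
  qed
  have ae: "AE r in half_line. norm (wright_integrand \<alpha> \<theta> (of_real c + \<mu> * of_real r) * \<mu>) \<le> ?w r"
    using AE_half_line_pos by (rule eventually_mono) (rule le)
  show *: "integrable half_line (\<lambda>r. wright_integrand \<alpha> \<theta> (of_real c + \<mu> * of_real r) * \<mu>)"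
    by (rule Bochner_Integration.integrable_bound[OF int])
       (use ae in \<open>auto elim!: eventually_mono intro: order_trans[OF _ abs_ge_self]\<close>)
  have "norm (\<integral>r. wright_integrand \<alpha> \<theta> (of_real c + \<mu> * of_real r) * \<mu> \<partial>half_line) \<le> (\<integral>r. ?w r \<partial>half_line)"
    using int ae * by (intro order_trans[OF integral_norm_bound] integral_mono_AE) auto
  then show "norm (\<integral>r. wright_integrand \<alpha> \<theta> (of_real c + \<mu> * of_real r) * \<mu> \<partial>half_line)
       \<le> norm \<mu> * exp c * m powr (\<alpha> - 1) * exp (- \<theta> * (cos (\<alpha> * Arg \<mu>) * m powr \<alpha>))
          * (\<integral>r. r powr (1 - 1) * exp (- (- Re \<mu> * r)) \<partial>half_line)"
    by simp
qed

text \<open>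
  For a primitive \<open>P\<close>, the integral is the limit of \<open>P (c + \<mu> n) - P c\<close>.  Between the far ends of the
  two rays the integrand decays, so the values of \<open>P\<close> there have the same limit; and
  \<open>P c2 - P c1\<close> is real because the integrand is real on the positive axis.
\<close>

lemma Im_wright_ray_integral_shift:
  assumes \<alpha>: "0 < \<alpha>" "\<alpha> < 1" and \<theta>: "\<theta> \<ge> 0"
    and mu: "Re \<mu> < 0" "Im \<mu> > 0" "\<alpha> * Arg \<mu> < pi / 2" and c: "0 < c1" "c1 \<le> c2"
  shows "Im (\<integral>r. wright_integrand \<alpha> \<theta> (of_real c1 + \<mu> * of_real r) * \<mu> \<partial>half_line)
       = Im (\<integral>r. wright_integrand \<alpha> \<theta> (of_real c2 + \<mu> * of_real r) * \<mu> \<partial>half_line)"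
proof -
  define G where "G = wright_integrand \<alpha> \<theta>"
  define K where "K c = (\<integral>r. G (of_real c + \<mu> * of_real r) * \<mu> \<partial>half_line)" for c :: real
  obtain P where P: "\<And>c r. c \<ge> 0 \<Longrightarrow> r \<ge> 0 \<Longrightarrow> c > 0 \<or> r > 0 \<Longrightarrow>
      (P has_field_derivative G (of_real c + \<mu> * of_real r)) (at (of_real c + \<mu> * of_real r))"
    using wright_integrand_primitive[OF mu(2), of \<alpha> \<theta>] unfolding G_def by metis
  have K_lim: "(\<lambda>n. P (of_real c + \<mu> * of_real (real n)) - P (of_real c)) \<longlonglongrightarrow> K c" if c: "c > 0" for c
  proof -
    have int: "integrable half_line (\<lambda>r. G (of_real c + \<mu> * of_real r) * \<mu>)"
      unfolding G_def by (rule wright_ray_integrable(1)[OF \<alpha> \<theta> mu c])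
    have eq: "(\<integral>r. indicator {..real n} r *\<^sub>R (G (of_real c + \<mu> * of_real r) * \<mu>) \<partial>half_line)
        = P (of_real c + \<mu> * of_real (real n)) - P (of_real c)" for n
    proof -
      have set_int: "set_integrable lebesgue {0..real n} (\<lambda>r. G (of_real c + \<mu> * of_real r) * \<mu>)"
      proof (rule set_integrable_subset)
        show "set_integrable lebesgue {0..} (\<lambda>r. G (of_real c + \<mu> * of_real r) * \<mu>)"
          using int unfolding set_integrable_def by (subst (asm) integrable_restrict_space) simp_all
      qed auto
      have "((\<lambda>r. G (of_real c + \<mu> * of_real r) * \<mu>) has_integral
          (P (of_real c + \<mu> * of_real (real n)) - P (of_real c + \<mu> * of_real 0))) {0..real n}"
      proof (rule fundamental_theorem_of_calculus)
        fix r assume r: "r \<in> {0..real n}"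
        have "((\<lambda>r. of_real c + \<mu> * of_real r) has_vector_derivative \<mu>) (at r within {0..real n})"
          by (auto intro!: derivative_eq_intros simp: has_vector_derivative_def scaleR_conv_of_real mult.commute)
        from field_vector_diff_chain_within[OF this has_field_derivative_at_within[OF P]]
        show "((\<lambda>r. P (of_real c + \<mu> * of_real r)) has_vector_derivative G (of_real c + \<mu> * of_real r) * \<mu>)
            (at r within {0..real n})"
          using r c by (simp add: o_def mult.commute)
      qed simp
      then have "integral {0..real n} (\<lambda>r. G (of_real c + \<mu> * of_real r) * \<mu>)
          = P (of_real c + \<mu> * of_real (real n)) - P (of_real c + \<mu> * of_real 0)" by (rule integral_unique)
      moreover have "P (of_real c + \<mu> * of_real 0) = P (of_real c)" by simp
      moreover have "(\<integral>r. indicator {..real n} r *\<^sub>R (G (of_real c + \<mu> * of_real r) * \<mu>) \<partial>half_line)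
          = (LINT r:{0..real n}|lebesgue. G (of_real c + \<mu> * of_real r) * \<mu>)"
        unfolding set_lebesgue_integral_def
        by (subst integral_restrict_space) (auto intro!: Bochner_Integration.integral_cong simp: indicator_def)
      ultimately show ?thesis using set_lebesgue_integral_eq_integral(2)[OF set_int] by (simp only:)
    qed
    have "(\<lambda>n. \<integral>r. indicator {..real n} r *\<^sub>R (G (of_real c + \<mu> * of_real r) * \<mu>) \<partial>half_line) \<longlonglongrightarrow> K c"
      unfolding K_def
    proof (rule integral_dominated_convergence[where w = "\<lambda>r. norm (G (of_real c + \<mu> * of_real r) * \<mu>)"])
      show "(\<lambda>r. G (of_real c + \<mu> * of_real r) * \<mu>) \<in> borel_measurable half_line"
        using int by auto
      show "(\<lambda>r. indicator {..real n} r *\<^sub>R (G (of_real c + \<mu> * of_real r) * \<mu>)) \<in> borel_measurable half_line" for n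
      proof (rule borel_measurable_scaleR)
        show "indicator {..real n} \<in> borel_measurable half_line"
          by (rule borel_measurable_half_line) simp
      qed (use int in auto)
      show "integrable half_line (\<lambda>r. norm (G (of_real c + \<mu> * of_real r) * \<mu>))"
        using int by (rule integrable_norm)
      show "AE r in half_line. (\<lambda>n. indicator {..real n} r *\<^sub>R (G (of_real c + \<mu> * of_real r) * \<mu>))
          \<longlonglongrightarrow> G (of_real c + \<mu> * of_real r) * \<mu>"
      proof (rule AE_I2)
        fix r :: real
        obtain N where "r \<le> real N" using real_arch_simple by blast
        then have "eventually (\<lambda>n. indicator {..real n} r *\<^sub>R (G (of_real c + \<mu> * of_real r) * \<mu>)
            = G (of_real c + \<mu> * of_real r) * \<mu>) sequentially"
          by (intro eventually_sequentiallyI[of N]) (auto simp: indicator_def)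
        then show "(\<lambda>n. indicator {..real n} r *\<^sub>R (G (of_real c + \<mu> * of_real r) * \<mu>))
            \<longlonglongrightarrow> G (of_real c + \<mu> * of_real r) * \<mu>" by (rule tendsto_eventually)
      qed
    qed (auto simp: indicator_def)
    then show ?thesis by (simp add: eq)
  qed
  have far: "(\<lambda>n. P (of_real c2 + \<mu> * of_real (real n)) - P (of_real c1 + \<mu> * of_real (real n))) \<longlonglongrightarrow> 0"
  proof (rule Lim_null_comparison)
    let ?B = "\<lambda>n. exp (c2 + real n * Re \<mu>) * (real n * Im \<mu>) powr (\<alpha> - 1) * (c2 - c1)"
    show "\<forall>\<^sub>F n in sequentially. norm (P (of_real c2 + \<mu> * of_real (real n)) - P (of_real c1 + \<mu> * of_real (real n))) \<le> ?B n"
    proof (rule eventually_sequentiallyI[of 1])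
      fix n :: nat assume n: "n \<ge> 1"
      let ?S = "(\<lambda>x. of_real x + \<mu> * of_real (real n)) ` {c1..c2}"
      have "convex ?S"
      proof -
        have "?S = (\<lambda>z. \<mu> * of_real (real n) + z) ` of_real ` {c1..c2}" by (auto simp: image_image add.commute)
        then show ?thesis
          using bounded_linear.linear[OF bounded_linear_of_real[where 'a = complex]]
          by (simp only: convex_translation convex_linear_image convex_real_interval)
      qed
      then have "norm (P (of_real c2 + \<mu> * of_real (real n)) - P (of_real c1 + \<mu> * of_real (real n)))
          \<le> exp (c2 + real n * Re \<mu>) * (real n * Im \<mu>) powr (\<alpha> - 1)
              * norm ((of_real c2 + \<mu> * of_real (real n)) - (of_real c1 + \<mu> * of_real (real n)))"
      proof (rule field_differentiable_bound[where f' = G])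
        fix z assume "z \<in> ?S"
        then obtain x where x: "x \<in> {c1..c2}" "z = of_real x + \<mu> * of_real (real n)" by blast
        show "(P has_field_derivative G z) (at z within ?S)"
          unfolding x(2) by (rule has_field_derivative_at_within[OF P]) (use x(1) c in auto)
        have "norm (G z) \<le> exp (x + real n * Re \<mu>) * (real n * Im \<mu>) powr (\<alpha> - 1)
            * exp (- \<theta> * (cos (\<alpha> * Arg \<mu>) * (real n * Im \<mu>) powr \<alpha>))"
          unfolding x(2) G_def using x c mu n ray_shift_norm_ge(1)[of \<mu> x "real n"]
          by (intro wright_integrand_bound \<alpha> \<theta>) auto
        also have "\<dots> \<le> exp (c2 + real n * Re \<mu>) * (real n * Im \<mu>) powr (\<alpha> - 1) * 1"
        proof (intro mult_mono)
          have "0 < Arg \<mu>" using mu Arg_lt_pi[of \<mu>] by auto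
          then have "0 \<le> \<alpha> * Arg \<mu>" using \<alpha> by simp
          then have "cos (\<alpha> * Arg \<mu>) \<ge> 0" using mu by (intro cos_ge_zero) auto
          then show "exp (- \<theta> * (cos (\<alpha> * Arg \<mu>) * (real n * Im \<mu>) powr \<alpha>)) \<le> 1" using \<theta> by simp
        qed (use x in auto)
        finally show "norm (G z) \<le> exp (c2 + real n * Re \<mu>) * (real n * Im \<mu>) powr (\<alpha> - 1)" by simp
      qed (use c in auto)
      also have "norm ((of_real c2 + \<mu> * of_real (real n)) - (of_real c1 + \<mu> * of_real (real n))) = c2 - c1"
        using c by (simp flip: of_real_diff)
      finally show "norm (P (of_real c2 + \<mu> * of_real (real n)) - P (of_real c1 + \<mu> * of_real (real n))) \<le> ?B n" .
    qed
    have "((\<lambda>x. exp (c2 + x * Re \<mu>) * (x * Im \<mu>) powr (\<alpha> - 1) * (c2 - c1)) \<longlongrightarrow> 0) at_top"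
      using mu \<alpha> by real_asymp
    then show "?B \<longlonglongrightarrow> 0" by (rule filterlim_compose) (rule filterlim_real_sequentially)
  qed
  have "(\<lambda>n. (P (of_real c2 + \<mu> * of_real (real n)) - P (of_real c2))
          - (P (of_real c1 + \<mu> * of_real (real n)) - P (of_real c1))) \<longlonglongrightarrow> K c2 - K c1"
    using c by (intro tendsto_diff K_lim) auto
  moreover have "(\<lambda>n. (P (of_real c2 + \<mu> * of_real (real n)) - P (of_real c1 + \<mu> * of_real (real n)))
          - (P (of_real c2) - P (of_real c1))) \<longlonglongrightarrow> 0 - (P (of_real c2) - P (of_real c1))"
    by (intro tendsto_diff far tendsto_const)
  ultimately have diff: "K c2 - K c1 = P (of_real c1) - P (of_real c2)"
    using LIMSEQ_unique by (fastforce simp: algebra_simps)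
  have "Im (P (of_real c1)) = Im (P (of_real c2))"
  proof (rule DERIV_isconst3[of 0 "c2 + 1" c1 c2 "\<lambda>x. Im (P (of_real x))"])
    fix x assume x: "x \<in> {0<..<c2 + 1}"
    have "((\<lambda>x. P (of_real x)) has_vector_derivative G (of_real x)) (at x)"
    proof -
      have "(P has_field_derivative G (of_real x)) (at (of_real x))" using P[of x 0] x by simp
      from field_vector_diff_chain_at[OF has_vector_derivative_of_real[OF DERIV_ident] this]
      show ?thesis by (simp add: o_def)
    qed
    then have "((\<lambda>x. Im (P (of_real x))) has_vector_derivative Im (G (of_real x))) (at x)"
      by (rule bounded_linear.has_vector_derivative[OF bounded_linear_Im])
    moreover have "G (of_real x) = of_real (exp (x - \<theta> * x powr \<alpha>) * x powr (\<alpha> - 1))"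
      unfolding G_def wright_integrand_def using x powr_of_real[of x \<alpha>] powr_of_real[of x "\<alpha> - 1"]
      by (simp add: exp_of_real[symmetric])
    ultimately show "DERIV (\<lambda>x. Im (P (of_real x))) x :> 0"
      by (simp add: has_real_derivative_iff_has_vector_derivative)
  qed (use c in auto)
  with diff have "Im (K c2 - K c1) = 0" by simp
  then show ?thesis by (simp add: K_def G_def)
qed

text \<open>The shift by \<open>0\<close> is the limit of small shifts, by dominated convergence.\<close>

lemma wright_M_conv_shifted_ray_integral:
  assumes \<alpha>: "0 < \<alpha>" "\<alpha> < 1" and \<theta>: "\<theta> \<ge> 0"
    and mu: "Re \<mu> < 0" "Im \<mu> > 0" "norm (1 + \<mu>) < 1" "\<alpha> * Arg \<mu> < pi / 2" and c: "c > 0"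
  shows "wright_M \<alpha> \<theta> = Im (\<integral>r. wright_integrand \<alpha> \<theta> (of_real c + \<mu> * of_real r) * \<mu> \<partial>half_line) / pi"
proof -
  define G where "G = wright_integrand \<alpha> \<theta>"
  define K where "K c = (\<integral>r. G (of_real c + \<mu> * of_real r) * \<mu> \<partial>half_line)" for c :: real
  define d where "d n = min c (inverse (real (Suc n)))" for n
  have d: "0 < d n" "d n \<le> c" "d n \<le> 1" for n
    using c by (auto simp: d_def inverse_eq_divide min_le_iff_disj)
  have d_lim: "d \<longlonglongrightarrow> 0"
    using tendsto_min[OF tendsto_const[of c] LIMSEQ_inverse_real_of_nat] c by (simp add: d_def[abs_def])
  have hol: "G holomorphic_on - \<real>\<^sub>\<le>\<^sub>0"
    unfolding G_def wright_integrand_def by (intro holomorphic_intros) auto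
  have "(\<lambda>n. K (d n)) \<longlonglongrightarrow> K 0"
    unfolding K_def
  proof (rule integral_dominated_convergence[where
      w = "\<lambda>r. norm \<mu> * exp 1 * Im \<mu> powr (\<alpha> - 1) * (r powr (\<alpha> - 1) * exp (- (- Re \<mu> * r)))"])
    show "integrable half_line (\<lambda>r. norm \<mu> * exp 1 * Im \<mu> powr (\<alpha> - 1) * (r powr (\<alpha> - 1) * exp (- (- Re \<mu> * r))))"
      by (intro integrable_mult_right integrable_powr_exp) (use mu \<alpha> in auto)
    show "AE r in half_line. norm (G (of_real (d n) + \<mu> * of_real r) * \<mu>)
        \<le> norm \<mu> * exp 1 * Im \<mu> powr (\<alpha> - 1) * (r powr (\<alpha> - 1) * exp (- (- Re \<mu> * r)))" for n
      using AE_half_line_pos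
    proof (rule eventually_mono)
      fix r :: real assume r: "r > 0"
      have "norm (G (of_real (d n) + \<mu> * of_real r))
          \<le> exp (d n + r * Re \<mu>) * (r * Im \<mu>) powr (\<alpha> - 1)
              * exp (- \<theta> * (cos (\<alpha> * Arg \<mu>) * (r * Im \<mu>) powr \<alpha>))"
        unfolding G_def using r d[of n] mu ray_shift_norm_ge(1)[of \<mu> "d n" r]
        by (intro wright_integrand_bound \<alpha> \<theta>) auto
      also have "\<dots> \<le> exp (1 + r * Re \<mu>) * (r * Im \<mu>) powr (\<alpha> - 1) * 1"
      proof (intro mult_mono)
        have "0 < Arg \<mu>" using mu Arg_lt_pi[of \<mu>] by auto
        then have "0 \<le> \<alpha> * Arg \<mu>" using \<alpha> by simp
        then have "cos (\<alpha> * Arg \<mu>) \<ge> 0" using mu by (intro cos_ge_zero) auto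
        then show "exp (- \<theta> * (cos (\<alpha> * Arg \<mu>) * (r * Im \<mu>) powr \<alpha>)) \<le> 1" using \<theta> by simp
      qed (use d[of n] in auto)
      finally have "norm (G (of_real (d n) + \<mu> * of_real r)) \<le> exp (1 + r * Re \<mu>) * (r * Im \<mu>) powr (\<alpha> - 1)"
        by simp
      then have "norm \<mu> * norm (G (of_real (d n) + \<mu> * of_real r))
          \<le> norm \<mu> * (exp (1 + r * Re \<mu>) * (r * Im \<mu>) powr (\<alpha> - 1))"
        by (rule mult_left_mono) simp
      then show "norm (G (of_real (d n) + \<mu> * of_real r) * \<mu>)
          \<le> norm \<mu> * exp 1 * Im \<mu> powr (\<alpha> - 1) * (r powr (\<alpha> - 1) * exp (- (- Re \<mu> * r)))"
        using r mu by (simp add: norm_mult exp_add powr_mult mult_ac)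
    qed
    show "AE r in half_line. (\<lambda>n. G (of_real (d n) + \<mu> * of_real r) * \<mu>) \<longlonglongrightarrow> G (of_real 0 + \<mu> * of_real r) * \<mu>"
      using AE_half_line_pos
    proof (rule eventually_mono)
      fix r :: real assume r: "r > 0"
      have "Im (\<mu> * of_real r) \<noteq> 0" using r mu by simp
      then have "\<mu> * of_real r \<notin> \<real>\<^sub>\<le>\<^sub>0" by (auto simp: complex_nonpos_Reals_iff)
      then have "isCont G (\<mu> * of_real r)"
        using holomorphic_on_imp_differentiable_at[OF hol] closed_nonpos_Reals_complex
        by (intro field_differentiable_imp_continuous_at) (auto simp: open_Compl)
      moreover have "(\<lambda>n. of_real (d n) + \<mu> * of_real r) \<longlonglongrightarrow> \<mu> * of_real r"
        using tendsto_add[OF tendsto_of_real[OF d_lim] tendsto_const] by simp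
      ultimately have "(\<lambda>n. G (of_real (d n) + \<mu> * of_real r)) \<longlonglongrightarrow> G (\<mu> * of_real r)"
        by (rule isCont_tendsto_compose)
      from tendsto_mult_right[OF this, of \<mu>]
      show "(\<lambda>n. G (of_real (d n) + \<mu> * of_real r) * \<mu>) \<longlonglongrightarrow> G (of_real 0 + \<mu> * of_real r) * \<mu>" by simp
    qed
  qed (simp_all add: G_def wright_integrand_measurable wright_integrand_measurable[where c = 0, simplified])
  then have "(\<lambda>n. Im (K (d n))) \<longlonglongrightarrow> Im (K 0)" by (rule tendsto_Im)
  moreover have "Im (K (d n)) = Im (K c)" for n
    unfolding K_def G_def using mu d by (intro Im_wright_ray_integral_shift \<alpha> \<theta>) auto
  ultimately have "Im (K c) = Im (K 0)" by (simp add: LIMSEQ_const_iff)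
  then show ?thesis
    using wright_M_conv_ray_integral[OF \<alpha> \<theta> mu(1-3)] by (simp add: K_def G_def)
qed

text \<open>
  On the ray shifted by \<open>c\<close> the factor \<open>exp (- \<theta> \<sigma>\<^sup>\<alpha>)\<close> has modulus at most \<open>exp (- \<theta> k (\<delta> c)\<^sup>\<alpha>)\<close> with positive
  constants \<open>k\<close> and \<open>\<delta>\<close>, and the shift is at our disposal: a large \<open>c\<close> gives any prescribed rate, at
  the price of the constant \<open>exp c\<close>.
\<close>

theorem wright_M_exponential_decay:
  assumes \<alpha>: "0 < \<alpha>" "\<alpha> < 1" and \<kappa>: "\<kappa> > 0"
  obtains C where "\<And>\<theta>. \<theta> \<ge> 0 \<Longrightarrow> \<bar>wright_M \<alpha> \<theta>\<bar> \<le> C * exp (- \<kappa> * \<theta>)"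
proof -
  have "pi / 2 < min pi (pi / (2 * \<alpha>))" using \<alpha> by (simp add: field_simps)
  then obtain \<omega> where chi: "pi / 2 < \<omega>" "\<omega> < pi" "\<omega> < pi / (2 * \<alpha>)" by (metis dense min_less_iff_conj)
  \<comment> \<open>The modulus \<open>- cos \<omega>\<close> puts \<open>- \<mu>\<close> at the foot of the perpendicular from \<open>1\<close> onto its ray, at distance
      \<open>sin \<omega> < 1\<close> from \<open>1\<close>.\<close>
  define \<mu> where "\<mu> = rcis (- cos \<omega>) \<omega>"
  have cos: "cos \<omega> < 0" using cos_monotone_0_pi[of "pi / 2" \<omega>] chi pi_gt_zero by simp
  have sin: "sin \<omega> > 0" using chi pi_gt_zero by (intro sin_gt_zero) auto
  have Re: "Re \<mu> = - (cos \<omega>)\<^sup>2" and Im: "Im \<mu> = - cos \<omega> * sin \<omega>"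
    by (simp_all add: \<mu>_def power2_eq_square)
  have "(norm (1 + \<mu>))\<^sup>2 = 1 - (cos \<omega>)\<^sup>2"
  proof -
    have "(norm (1 + \<mu>))\<^sup>2 = (1 - (cos \<omega>)\<^sup>2)\<^sup>2 + (cos \<omega>)\<^sup>2 * (sin \<omega>)\<^sup>2"
      by (simp add: cmod_power2 Re Im power_mult_distrib)
    also have "\<dots> = 1 - (cos \<omega>)\<^sup>2" unfolding sin_squared_eq by (simp add: power2_eq_square algebra_simps)
    finally show ?thesis .
  qed
  also have "\<dots> < 1\<^sup>2" using cos by simp
  finally have near: "norm (1 + \<mu>) < 1" by (rule power_less_imp_less_base) simp
  have Arg: "Arg \<mu> = \<omega>" unfolding \<mu>_def using chi cos pi_gt_zero by (intro Arg_rcis) auto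
  have aArg: "\<alpha> * Arg \<mu> < pi / 2" using chi \<alpha> by (simp add: Arg field_simps)
  have mu: "Re \<mu> < 0" "Im \<mu> > 0" using cos sin by (simp_all add: Re Im mult_neg_pos)
  define k where "k = cos (\<alpha> * Arg \<mu>)"
  have k: "k > 0" unfolding k_def using aArg chi \<alpha> pi_gt_zero Arg
    by (intro cos_gt_zero_pi) (auto intro: less_le_trans[of _ 0])
  \<comment> \<open>\<open>m\<close> is the distance from the branch point that yields the rate \<open>\<kappa>\<close>, and \<open>c\<close> a shift that
      guarantees it.\<close>
  define m where "m = (\<kappa> / k) powr (1 / \<alpha>)"
  have m: "m > 0" "k * m powr \<alpha> = \<kappa>" using k \<kappa> \<alpha> by (simp_all add: m_def powr_powr)
  define c where "c = m / (Im \<mu> / norm \<mu>)"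
  have "norm \<mu> > 0" using mu by auto
  then have c: "c > 0" "c * (Im \<mu> / norm \<mu>) = m" using m mu by (simp_all add: c_def)
  define C where "C = norm \<mu> * exp c * m powr (\<alpha> - 1)
      * (\<integral>r. r powr (1 - 1) * exp (- (- Re \<mu> * r)) \<partial>half_line) / pi"
  show ?thesis
  proof (rule that[of C])
    fix \<theta> :: real assume \<theta>: "\<theta> \<ge> 0"
    let ?I = "\<integral>r. wright_integrand \<alpha> \<theta> (of_real c + \<mu> * of_real r) * \<mu> \<partial>half_line"
    have "\<bar>wright_M \<alpha> \<theta>\<bar> \<le> norm ?I / pi"
      unfolding wright_M_conv_shifted_ray_integral[OF \<alpha> \<theta> mu near aArg c(1)]
      using abs_Im_le_cmod[of ?I] by (simp add: divide_right_mono)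
    also have "\<dots> \<le> C * exp (- \<kappa> * \<theta>)"
      using wright_ray_integrable(2)[OF \<alpha> \<theta> mu aArg c(1)]
      unfolding c(2) k_def[symmetric] m(2) C_def by (simp add: divide_right_mono mult_ac)
    finally show "\<bar>wright_M \<alpha> \<theta>\<bar> \<le> C * exp (- \<kappa> * \<theta>)" .
  qed
qed

lemma borel_measurable_wright_M [measurable]: "wright_M \<alpha> \<in> borel_measurable borel"
  unfolding wright_M_def[abs_def] by measurable

section \<open>Semigroups and the operators \<open>P\<^sub>\<alpha>\<close>\<close>

text \<open>
  Otherwise there are \<open>t n\<close> tending to \<open>0\<close> with \<open>norm (T (t n)) > n\<close>; but \<open>T (t n) x\<close> tends to \<open>x\<close>
  for every \<open>x\<close>, which contradicts uniform boundedness.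
\<close>

lemma C0_semigroup_bounded_near_0:
  fixes T :: "real \<Rightarrow> 'x::banach \<Rightarrow>\<^sub>L 'x"
  assumes T: "C0_semigroup T"
  obtains \<delta> K where "\<delta> > 0" "\<And>t. 0 \<le> t \<Longrightarrow> t \<le> \<delta> \<Longrightarrow> norm (T t) \<le> K"
proof -
  have "\<exists>\<delta>>0. \<exists>K. \<forall>t. 0 \<le> t \<and> t \<le> \<delta> \<longrightarrow> norm (T t) \<le> K"
  proof (rule ccontr)
    assume contra: "\<not> ?thesis"
    have "\<exists>t. 0 \<le> t \<and> t \<le> 1 / Suc n \<and> norm (T t) > real n" for n
      using contra by (metis linorder_not_less of_nat_0_less_iff zero_less_Suc zero_less_divide_1_iff)
    then obtain t where t: "\<And>n. 0 \<le> t n" "\<And>n. t n \<le> 1 / Suc n" "\<And>n. norm (T (t n)) > real n"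
      by metis
    have "bounded (range (\<lambda>n. T (t n)))"
    proof (rule uniform_boundedness)
      fix x
      have "(\<lambda>n. T (t n) x) \<longlonglongrightarrow> x"
      proof (rule metric_LIMSEQ_I)
        fix e :: real assume e: "e > 0"
        have "((\<lambda>t. T t x) \<longlongrightarrow> x) (at_right 0)" using T by (simp add: C0_semigroup_def)
        from tendstoD[OF this e] obtain \<eta> where eta: "\<eta> > 0" "\<And>s. 0 < s \<Longrightarrow> s < \<eta> \<Longrightarrow> dist (T s x) x < e"
          by (auto simp: eventually_at_right_field)
        obtain N where N: "1 / Suc N < \<eta>" using eta(1) nat_approx_posE by blast
        have "dist (T (t n) x) x < e" if "n \<ge> N" for n
        proof (cases "t n = 0")
          case True
          then show ?thesis using T e by (simp add: C0_semigroup_def)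
        next
          case False
          have "1 / Suc n \<le> 1 / Suc N" using that by (simp add: frac_le)
          with t(1,2)[of n] N False show ?thesis by (intro eta(2)) auto
        qed
        then show "\<exists>N. \<forall>n\<ge>N. dist (T (t n) x) x < e" by blast
      qed
      then have "bounded (range (\<lambda>n. T (t n) x))" by (rule convergent_imp_bounded)
      then show "bounded ((\<lambda>L. blinfun_apply L x) ` range (\<lambda>n. T (t n)))" by (simp add: image_image)
    qed
    then obtain K where K: "\<And>n. norm (T (t n)) \<le> K" by (auto simp: bounded_iff)
    obtain n where "K \<le> real n" using real_arch_simple by blast
    with K[of n] t(3)[of n] show False by simp
  qed
  with that show ?thesis by blast
qed

lemma C0_semigroup_exponential_bound:
  fixes T :: "real \<Rightarrow> 'x::banach \<Rightarrow>\<^sub>L 'x"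
  assumes T: "C0_semigroup T"
  obtains K \<omega> where "K \<ge> 1" "\<omega> \<ge> 0" "\<And>t. t \<ge> 0 \<Longrightarrow> norm (T t) \<le> K * exp (\<omega> * t)"
proof -
  obtain \<delta> K0 where \<delta>: "\<delta> > 0" and K0: "\<And>t. 0 \<le> t \<Longrightarrow> t \<le> \<delta> \<Longrightarrow> norm (T t) \<le> K0"
    using C0_semigroup_bounded_near_0[OF T] by metis
  define K where "K = max 1 K0"
  have K: "K \<ge> 1" "\<And>t. 0 \<le> t \<Longrightarrow> t \<le> \<delta> \<Longrightarrow> norm (T t) \<le> K"
    using K0 by (force simp: K_def)+
  have iter: "norm (T t) \<le> K ^ Suc n" if "0 \<le> t" "t \<le> real (Suc n) * \<delta>" for t n
    using that
  proof (induction n arbitrary: t)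
    case 0
    then show ?case using K by simp
  next
    case (Suc n)
    show ?case
    proof (cases "t \<le> \<delta>")
      case True
      then have "norm (T t) \<le> K" using K Suc.prems by simp
      also have "\<dots> \<le> K ^ Suc (Suc n)" using K(1) by (intro self_le_power) auto
      finally show ?thesis .
    next
      case False
      have "T t = T (t - \<delta>) o\<^sub>L T \<delta>"
        using T False \<delta> unfolding C0_semigroup_def by (metis diff_add_cancel diff_ge_0_iff_ge less_imp_le linorder_not_less)
      then have "norm (T t) \<le> norm (T (t - \<delta>)) * norm (T \<delta>)" by (simp add: norm_blinfun_compose)
      also have "\<dots> \<le> K ^ Suc n * K"
        using False Suc.prems \<delta> K
        by (intro mult_mono Suc.IH) (auto simp: algebra_simps)
      finally show ?thesis by (simp add: mult.commute)
    qed
  qed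
  have "norm (T t) \<le> K * exp (ln K / \<delta> * t)" if t: "t \<ge> 0" for t
  proof -
    define n where "n = nat \<lfloor>t / \<delta>\<rfloor>"
    have n: "real n \<le> t / \<delta>" "t / \<delta> < real n + 1"
      using t \<delta> by (auto simp: n_def)
    then have "t \<le> real (Suc n) * \<delta>" using \<delta> by (simp add: field_simps)
    then have "norm (T t) \<le> K * K ^ n" using iter[OF t] by simp
    also have "K ^ n = exp (real n * ln K)" using K(1) by (simp add: exp_of_nat_mult)
    also have "\<dots> \<le> exp (t / \<delta> * ln K)"
      using mult_right_mono[OF n(1), of "ln K"] K(1) by simp
    finally show ?thesis using K(1) by (simp add: mult.commute)
  qed
  with K(1) \<delta> show ?thesis by (intro that[of K "ln K / \<delta>"]) auto
qed

lemma C0_semigroup_continuous: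
  fixes T :: "real \<Rightarrow> 'x::banach \<Rightarrow>\<^sub>L 'x"
  assumes T: "C0_semigroup T"
  shows "continuous_on {0..} (\<lambda>t. T t x)"
proof -
  obtain K \<omega> where K: "K \<ge> 1" "\<omega> \<ge> 0" "\<And>t. t \<ge> 0 \<Longrightarrow> norm (T t) \<le> K * exp (\<omega> * t)"
    using C0_semigroup_exponential_bound[OF T] by metis
  show ?thesis
    unfolding continuous_on_iff
  proof (intro ballI allI impI)
    fix t0 e :: real assume t0: "t0 \<in> {0..}" and e: "e > 0"
    define B where "B = K * exp (\<omega> * (t0 + 1))"
    have B: "B > 0" using K by (simp add: B_def)
    have "((\<lambda>t. T t x) \<longlongrightarrow> x) (at_right 0)" using T by (simp add: C0_semigroup_def)
    from tendstoD[OF this, of "e / B"] e B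
    obtain \<eta> where eta: "\<eta> > 0" "\<And>s. 0 < s \<Longrightarrow> s < \<eta> \<Longrightarrow> dist (T s x) x < e / B"
      by (auto simp: eventually_at_right_field)
    have step: "norm (T t x - T s x) < e" if st: "0 \<le> s" "s \<le> t" "s \<le> t0 + 1" "t - s < \<eta>" for s t
    proof (cases "s = t")
      case False
      have "T t = T s o\<^sub>L T (t - s)"
        using T st unfolding C0_semigroup_def by (metis add_diff_cancel_left' diff_ge_0_iff_ge le_add_diff_inverse)
      then have "T t x - T s x = T s (T (t - s) x - x)" by (simp add: blinfun.diff_right)
      then have "norm (T t x - T s x) \<le> norm (T s) * norm (T (t - s) x - x)"
        by (simp add: norm_blinfun)
      also have "\<dots> \<le> B * norm (T (t - s) x - x)"
      proof (rule mult_right_mono)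
        have "norm (T s) \<le> K * exp (\<omega> * s)" using K(3) st by simp
        also have "\<dots> \<le> B" using K st by (simp add: B_def mult_left_mono)
        finally show "norm (T s) \<le> B" .
      qed simp
      also have "\<dots> < B * (e / B)"
        using eta(2)[of "t - s"] st False B by (intro mult_strict_left_mono) (auto simp: dist_norm)
      finally show ?thesis using B by simp
    qed (use e in simp)
    show "\<exists>d>0. \<forall>t\<in>{0..}. dist t t0 < d \<longrightarrow> dist (T t x) (T t0 x) < e"
    proof (intro exI[of _ "min 1 \<eta>"] conjI ballI impI)
      fix t assume t: "t \<in> {0..}" "dist t t0 < min 1 \<eta>"
      then show "dist (T t x) (T t0 x) < e"
        using step[of t0 t] step[of t t0] t0
        by (cases "t0 \<le> t") (auto simp: dist_norm norm_minus_commute abs_if split: if_splits)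
    qed (use eta in auto)
  qed
qed

text \<open>
  Strong continuity and local boundedness suffice for joint continuity; it is what makes
  \<open>s \<mapsto> Q s (v s)\<close> strongly measurable for a control \<open>v\<close> that is merely measurable.
\<close>

lemma jointly_continuous_blinfun:
  fixes Q :: "'t::metric_space \<Rightarrow> 'z::real_normed_vector \<Rightarrow>\<^sub>L 'x::real_normed_vector"
  assumes cont: "\<And>z. continuous_on I (\<lambda>t. Q t z)" and bound: "\<And>t. t \<in> I \<Longrightarrow> norm (Q t) \<le> K"
  shows "continuous_on (I \<times> UNIV) (\<lambda>(t, z). Q t z)"
  unfolding continuous_on_def
proof (intro ballI, clarify)
  fix t and z :: 'z assume t: "t \<in> I"
  let ?F = "at (t, z) within I \<times> UNIV"
  have fst: "(fst \<longlongrightarrow> t) ?F" and snd: "(snd \<longlongrightarrow> z) ?F"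
    using tendsto_fst[OF tendsto_ident_at, of "(t, z)"] tendsto_snd[OF tendsto_ident_at, of "(t, z)"] by auto
  have in_I: "\<forall>\<^sub>F p in ?F. fst p \<in> I"     unfolding eventually_at_filter by (rule always_eventually) auto
  have "((\<lambda>p. Q (fst p) z) \<longlongrightarrow> Q t z) ?F"
    using cont[of z] t in_I by (rule continuous_on_tendsto_compose[OF _ fst])
  moreover have "((\<lambda>p. Q (fst p) (snd p - z)) \<longlongrightarrow> 0) ?F"
  proof (rule Lim_null_comparison)
    show "\<forall>\<^sub>F p in ?F. norm (Q (fst p) (snd p - z)) \<le> K * norm (snd p - z)"
      using in_I by (rule eventually_mono) (meson bound norm_blinfun mult_right_mono norm_ge_zero order_trans)
    show "((\<lambda>p. K * norm (snd p - z)) \<longlongrightarrow> 0) ?F"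
      using tendsto_mult_right_zero[OF tendsto_norm_zero[OF LIM_zero[OF snd]], of K] .
  qed
  ultimately have "((\<lambda>p. Q (fst p) z + Q (fst p) (snd p - z)) \<longlongrightarrow> Q t z + 0) ?F"
    by (rule tendsto_add)
  then show "((\<lambda>(t, z). Q t z) \<longlongrightarrow> Q t z) ?F"
    by (simp add: blinfun.diff_right case_prod_unfold)
qed

lemma wright_kernel_strongly_integrable:
  fixes y :: "real \<Rightarrow> 'x::real_normed_vector"
  assumes y: "continuous_on {0..} y"
    and bound: "\<And>\<theta>. \<theta> \<ge> 0 \<Longrightarrow> norm ((\<alpha> * \<theta> * wright_M \<alpha> \<theta>) *\<^sub>R y \<theta>) \<le> w \<theta>"
    and w: "integrable half_line w"
  shows "strongly_integrable half_line (\<lambda>\<theta>. (\<alpha> * \<theta> * wright_M \<alpha> \<theta>) *\<^sub>R y \<theta>)"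
proof -
  have "strongly_integrable half_line (\<lambda>\<theta>. (\<lambda>(r, \<theta>). r *\<^sub>R y \<theta>) (\<alpha> * \<theta> * wright_M \<alpha> \<theta>, \<theta>))"
  proof (rule strongly_integrable_comp[where C = "UNIV \<times> {0..}"])
    show "(\<lambda>\<theta>. (\<alpha> * \<theta> * wright_M \<alpha> \<theta>, \<theta>)) \<in> borel_measurable half_line"
      by (intro borel_measurable_half_line) measurable
    show "continuous_on (UNIV \<times> {0..}) (\<lambda>(r, \<theta>). r *\<^sub>R y \<theta>)"
      unfolding case_prod_unfold
      by (intro continuous_intros continuous_on_compose2[OF y]) auto
  qed (use w bound in auto)
  then show ?thesis by simp
qed

text \<open>
  For \<open>\<alpha> < 1\<close> the integrand of \<open>P\<^sub>\<alpha>(t)\<close> is bounded by a multiple of \<open>\<theta> exp (- \<theta>)\<close>, uniformly for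
  \<open>t \<le> \<tau>\<close>, once the decay rate \<open>\<kappa>\<close> of the Wright function exceeds by \<open>1\<close> the growth rate
  \<open>\<omega> \<tau>\<^sup>\<alpha>\<close> of the semigroup at the argument \<open>\<tau>\<^sup>\<alpha> \<theta>\<close>.  Boundedness, and continuity by
  dominated convergence, follow.
\<close>

theorem P_op_strongly_continuous:
  fixes T :: "real \<Rightarrow> 'x::banach \<Rightarrow>\<^sub>L 'x"
  assumes T: "C0_semigroup T" and \<alpha>: "0 < \<alpha>" "\<alpha> \<le> 1" and \<tau>: "\<tau> \<ge> 0"
  shows "continuous_on {0..\<tau>} (\<lambda>t. P_op \<alpha> T t x)"
    and "\<exists>K. \<forall>t\<in>{0..\<tau>}. norm (P_op \<alpha> T t) \<le> K"
proof -
  obtain K \<omega> where K: "K \<ge> 1" "\<omega> \<ge> 0" and TK: "\<And>t. t \<ge> 0 \<Longrightarrow> norm (T t) \<le> K * exp (\<omega> * t)"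
    using C0_semigroup_exponential_bound[OF T] by metis
  have "(\<forall>x. continuous_on {0..\<tau>} (\<lambda>t. P_op \<alpha> T t x)) \<and> (\<exists>K. \<forall>t\<in>{0..\<tau>}. norm (P_op \<alpha> T t) \<le> K)"
  proof (cases "\<alpha> = 1")
    case True
    have "norm (T t) \<le> K * exp (\<omega> * \<tau>)" if "t \<in> {0..\<tau>}" for t
      using TK[of t] that K by (auto elim!: order_trans simp: mult_left_mono)
    moreover have "continuous_on {0..\<tau>} (\<lambda>t. T t x)" for x
      using C0_semigroup_continuous[OF T] by (rule continuous_on_subset) auto
    ultimately show ?thesis
      unfolding P_op_def using True by (auto intro!: exI[of _ "K * exp (\<omega> * \<tau>)"])
  next
    case False
    with \<alpha> have a1: "\<alpha> < 1" by simp
    define \<kappa> where "\<kappa> = \<omega> * \<tau> powr \<alpha> + 1"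
    have \<kappa>: "\<kappa> > 0" using K by (simp add: \<kappa>_def add_nonneg_pos)
    obtain C where C: "\<And>\<theta>. \<theta> \<ge> 0 \<Longrightarrow> \<bar>wright_M \<alpha> \<theta>\<bar> \<le> C * exp (- \<kappa> * \<theta>)"
      using wright_M_exponential_decay[OF \<alpha>(1) a1 \<kappa>] by metis
    have "C \<ge> 0" using C[of 0] by simp
    define F where "F t \<theta> = (\<alpha> * \<theta> * wright_M \<alpha> \<theta>) *\<^sub>R T (t powr \<alpha> * \<theta>)" for t \<theta>
    define w where "w \<theta> = (\<alpha> * C * K) * (\<theta> powr (2 - 1) * exp (- (1 * \<theta>)))" for \<theta>
    have w: "integrable half_line w"
      unfolding w_def by (intro integrable_mult_right integrable_powr_exp) auto
    have F_le: "norm (F t \<theta>) \<le> w \<theta>" if t: "t \<in> {0..\<tau>}" and \<theta>: "\<theta> \<ge> 0" for t \<theta>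
    proof -
      have "t powr \<alpha> \<le> \<tau> powr \<alpha>" using t \<alpha> by (intro powr_mono2) auto
      then have "\<omega> * (t powr \<alpha> * \<theta>) \<le> \<omega> * (\<tau> powr \<alpha> * \<theta>)"
        using \<theta> K by (intro mult_left_mono mult_right_mono) auto
      moreover have "norm (T (t powr \<alpha> * \<theta>)) \<le> K * exp (\<omega> * (t powr \<alpha> * \<theta>))" using \<theta> by (intro TK) auto
      ultimately have "norm (T (t powr \<alpha> * \<theta>)) \<le> K * exp (\<omega> * (\<tau> powr \<alpha> * \<theta>))"
        using K by (elim order_trans) (simp add: mult_left_mono)
      then have "norm (F t \<theta>) \<le> (\<alpha> * \<theta> * (C * exp (- \<kappa> * \<theta>))) * (K * exp (\<omega> * (\<tau> powr \<alpha> * \<theta>)))"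
        unfolding F_def norm_scaleR using C[OF \<theta>] \<alpha> \<theta> \<open>C \<ge> 0\<close>
        by (intro mult_mono) (auto simp: abs_mult intro!: mult_left_mono)
      also have "\<dots> = \<alpha> * C * K * (\<theta> * (exp (- \<kappa> * \<theta>) * exp (\<omega> * (\<tau> powr \<alpha> * \<theta>))))"
        by (simp add: mult_ac)
      also have "exp (- \<kappa> * \<theta>) * exp (\<omega> * (\<tau> powr \<alpha> * \<theta>)) = exp (- (1 * \<theta>))"
        unfolding exp_add[symmetric] by (simp add: \<kappa>_def algebra_simps)
      also have "\<alpha> * C * K * (\<theta> * exp (- (1 * \<theta>))) = w \<theta>" using \<theta> by (simp add: w_def)
      finally show ?thesis .
    qed
    have F_le_x: "norm (F t \<theta> x) \<le> w \<theta> * norm x" if "t \<in> {0..\<tau>}" "\<theta> \<ge> 0" for t \<theta> x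
      using F_le[OF that] norm_blinfun[of "F t \<theta>" x] by (meson mult_right_mono norm_ge_zero order_trans)
    have T_cont: "continuous_on {0..} (\<lambda>\<theta>. T (t powr \<alpha> * \<theta>) x)" for t x
      by (rule continuous_on_compose2[OF C0_semigroup_continuous[OF T]]) (auto intro!: continuous_intros)
    have wx: "integrable half_line (\<lambda>\<theta>. w \<theta> * c)" for c
      using w by (rule integrable_mult_left)
    have si: "strongly_integrable half_line (\<lambda>\<theta>. F t \<theta> x)" if t: "t \<in> {0..\<tau>}" for t x
    proof -
      have "norm ((\<alpha> * \<theta> * wright_M \<alpha> \<theta>) *\<^sub>R T (t powr \<alpha> * \<theta>) x) \<le> w \<theta> * norm x" if "\<theta> \<ge> 0" for \<theta>
        using F_le_x[OF t that, of x] by (simp add: F_def blinfun.scaleR_left)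
      from wright_kernel_strongly_integrable[OF T_cont this wx]
      show ?thesis by (simp add: F_def blinfun.scaleR_left)
    qed
    have P: "P_op \<alpha> T t x = bochner_int half_line (\<lambda>\<theta>. F t \<theta> x)" if t: "t \<in> {0..\<tau>}" for t x
    proof -
      have "P_op \<alpha> T t = strong_int half_line (F t)" using a1 by (simp add: P_op_def F_def[abs_def])
      then show ?thesis
        using blinfun_apply_strong_int[of half_line "F t" w x] si[OF t] w F_le_x[OF t] by simp
    qed
    have bound: "norm (P_op \<alpha> T t) \<le> integral\<^sup>L half_line w" if t: "t \<in> {0..\<tau>}" for t
    proof (rule norm_blinfun_bound)
      show "0 \<le> integral\<^sup>L half_line w"
        using \<open>C \<ge> 0\<close> K \<alpha> by (intro integral_nonneg_AE AE_I2) (auto simp: w_def)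
      fix x
      have "norm (P_op \<alpha> T t x) \<le> (\<integral>\<theta>. norm (F t \<theta> x) \<partial>half_line)"
        unfolding P[OF t] by (rule norm_bochner_int_le[OF si[OF t]])
      also have "\<dots> \<le> (\<integral>\<theta>. w \<theta> * norm x \<partial>half_line)"
        using si[OF t, of x] wx F_le_x[OF t] by (intro integral_mono) (auto simp: strongly_integrable_def)
      finally show "norm (P_op \<alpha> T t x) \<le> integral\<^sup>L half_line w * norm x" by simp
    qed
    have cont: "continuous_on {0..\<tau>} (\<lambda>t. P_op \<alpha> T t x)" for x
      unfolding continuous_on_sequentially comp_def
    proof (intro allI ballI impI, elim conjE)
      fix s :: "nat \<Rightarrow> real" and t assume t: "t \<in> {0..\<tau>}" and s: "\<forall>n. s n \<in> {0..\<tau>}" "s \<longlonglongrightarrow> t"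
      define d where "d n \<theta> = F (s n) \<theta> x - F t \<theta> x" for n \<theta>
      have d_le: "norm (d n \<theta>) \<le> w \<theta> * (2 * norm x)" if "\<theta> \<ge> 0" for n \<theta>
        using norm_triangle_ineq4[of "F (s n) \<theta> x" "F t \<theta> x"] F_le_x[of "s n" \<theta> x] F_le_x[of t \<theta> x] s t that
        by (auto simp: d_def)
      have d_si: "strongly_integrable half_line (d n)" for n
      proof -
        have d_eq: "d n \<theta> = (\<alpha> * \<theta> * wright_M \<alpha> \<theta>) *\<^sub>R (T (s n powr \<alpha> * \<theta>) x - T (t powr \<alpha> * \<theta>) x)" for \<theta>
          by (simp add: d_def F_def blinfun.scaleR_left scaleR_diff_right)
        show ?thesis unfolding d_eq[abs_def]
          by (rule wright_kernel_strongly_integrable[OF continuous_on_diff[OF T_cont T_cont]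
                d_le[where n = n, unfolded d_eq] wx])
      qed
      have "(\<lambda>n. \<integral>\<theta>. norm (d n \<theta>) \<partial>half_line) \<longlonglongrightarrow> (\<integral>\<theta>. 0 \<partial>half_line)"
      proof (rule integral_dominated_convergence[OF _ _ wx])
        show "(\<lambda>\<theta>. norm (d n \<theta>)) \<in> borel_measurable half_line" for n
          using d_si[of n] by (auto simp: strongly_integrable_def)
        show "AE \<theta> in half_line. norm (norm (d n \<theta>)) \<le> w \<theta> * (2 * norm x)" for n
          using d_le by (auto intro!: AE_I2)
        show "AE \<theta> in half_line. (\<lambda>n. norm (d n \<theta>)) \<longlonglongrightarrow> 0"
        proof (rule AE_I2)
          fix \<theta> assume "\<theta> \<in> space half_line"
          then have \<theta>: "\<theta> \<ge> 0" by simp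
          have "(\<lambda>n. s n powr \<alpha> * \<theta>) \<longlonglongrightarrow> t powr \<alpha> * \<theta>"
            using s t \<alpha> by (intro tendsto_intros tendsto_powr') auto
          then have "(\<lambda>n. T (s n powr \<alpha> * \<theta>) x) \<longlonglongrightarrow> T (t powr \<alpha> * \<theta>) x"
            using \<theta> by (intro continuous_on_tendsto_compose[OF C0_semigroup_continuous[OF T]]) auto
          then have "(\<lambda>n. F (s n) \<theta> x) \<longlonglongrightarrow> F t \<theta> x"
            by (auto simp: F_def blinfun.scaleR_left intro!: tendsto_intros)
          then show "(\<lambda>n. norm (d n \<theta>)) \<longlonglongrightarrow> 0"
            unfolding d_def by (intro tendsto_norm_zero LIM_zero)
        qed
      qed simp
      then have lim: "(\<lambda>n. \<integral>\<theta>. norm (d n \<theta>) \<partial>half_line) \<longlonglongrightarrow> 0" by simp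
      have le: "norm (P_op \<alpha> T (s n) x - P_op \<alpha> T t x) \<le> (\<integral>\<theta>. norm (d n \<theta>) \<partial>half_line)" for n
      proof -
        have "P_op \<alpha> T (s n) x - P_op \<alpha> T t x = bochner_int half_line (d n)"
          unfolding d_def using s t by (simp add: P bochner_int_diff si d_si[unfolded d_def])
        then show ?thesis using norm_bochner_int_le[OF d_si] by simp
      qed
      have "(\<lambda>n. P_op \<alpha> T (s n) x - P_op \<alpha> T t x) \<longlonglongrightarrow> 0"
        by (rule Lim_null_comparison[OF _ lim]) (use le in auto)
      then show "(\<lambda>n. P_op \<alpha> T (s n) x) \<longlonglongrightarrow> P_op \<alpha> T t x" by (rule LIM_zero_cancel)
    qed
    from bound cont show ?thesis by blast
  qed
  then show "continuous_on {0..\<tau>} (\<lambda>t. P_op \<alpha> T t x)"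
    and "\<exists>K. \<forall>t\<in>{0..\<tau>}. norm (P_op \<alpha> T t) \<le> K" by blast+
qed

section \<open>Linear-quadratic control through an operator-valued kernel\<close>

text \<open>
  At the final time only a linear map from controls to states matters, given by a square-integrable
  scalar weight \<open>\<rho>\<close> and a bounded, strongly continuous family \<open>Q\<close>.  For the Hilfer system the weight
  is \<open>\<psi>' s (\<psi> b - \<psi> s)\<^sup>\<alpha>\<^sup>-\<^sup>1\<close>, unbounded near \<open>b\<close> if \<open>\<alpha> < 1\<close>, and \<open>Q s\<close> is
  \<open>P\<^sub>\<alpha>(\<psi> b - \<psi> s)\<close>.
\<close>

locale kernel_control =
  fixes a b :: real and \<rho> :: "real \<Rightarrow> real"
    and Q :: "real \<Rightarrow> 'x::banach \<Rightarrow>\<^sub>L 'x"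
    and B :: "'y::{real_inner, banach, second_countable_topology} \<Rightarrow>\<^sub>L 'x"
  assumes \<rho>_meas: "\<rho> \<in> borel_measurable (lebesgue_on {a..b})"
    and \<rho>_sq: "integrable (lebesgue_on {a..b}) (\<lambda>s. (\<rho> s)\<^sup>2)"
    and Q_cont: "\<And>x. continuous_on {a..b} (\<lambda>s. Q s x)"
    and Q_bounded: "\<exists>K. \<forall>s\<in>{a..b}. norm (Q s) \<le> K"
begin

abbreviation M :: "real measure" where "M \<equiv> lebesgue_on {a..b}"

definition steer :: "(real \<Rightarrow> 'y) \<Rightarrow> 'x" where
  "steer v = bochner_int M (\<lambda>s. \<rho> s *\<^sub>R Q s (B (v s)))"

definition steer_adj :: "('x \<Rightarrow>\<^sub>L real) \<Rightarrow> real \<Rightarrow> 'y" where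
  "steer_adj f s = \<rho> s *\<^sub>R hilbert_adjoint B (banach_adjoint (Q s) f)"

definition gramian :: "('x \<Rightarrow>\<^sub>L real) \<Rightarrow>\<^sub>L 'x" where
  "gramian = strong_int M (\<lambda>s. (\<rho> s)\<^sup>2 *\<^sub>R
     (Q s o\<^sub>L B o\<^sub>L hilbert_adjoint B o\<^sub>L banach_adjoint (Q s)))"

lemma banach_adjoint_apply: "banach_adjoint L f = f o\<^sub>L L"
  by transfer simp

lemma inner_steer_adj: "inner (steer_adj f s) y = \<rho> s * blinfun_apply f (Q s (B y))"
  by (simp add: steer_adj_def inner_hilbert_adjoint banach_adjoint_apply)

lemma steer_adj_scaleR: "steer_adj (c *\<^sub>R f) s = c *\<^sub>R steer_adj f s"
  by (simp add: steer_adj_def blinfun.scaleR_right)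

lemma Q_bound: obtains K where "K \<ge> 0" "\<And>s. s \<in> {a..b} \<Longrightarrow> norm (Q s) \<le> K"
  using Q_bounded by (metis norm_ge_zero order_trans max.cobounded1 max.coboundedI2)

lemma L2_product_integrable:
  assumes "f \<in> borel_measurable N" "g \<in> borel_measurable N"
    and "integrable N (\<lambda>s. (f s)\<^sup>2)" "integrable N (\<lambda>s. (g s)\<^sup>2)"
  shows "integrable N (\<lambda>s. f s * g s :: real)"
proof (rule Bochner_Integration.integrable_bound[OF Bochner_Integration.integrable_add[OF assms(3,4)]])
  show "AE s in N. norm (f s * g s) \<le> norm ((f s)\<^sup>2 + (g s)\<^sup>2)"
  proof (rule AE_I2)
    fix s
    have "2 * \<bar>f s\<bar> * \<bar>g s\<bar> \<le> (f s)\<^sup>2 + (g s)\<^sup>2"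
      using sum_squares_bound[of "\<bar>f s\<bar>" "\<bar>g s\<bar>"] by simp
    moreover have "0 \<le> \<bar>f s\<bar> * \<bar>g s\<bar>" by simp
    ultimately show "norm (f s * g s) \<le> norm ((f s)\<^sup>2 + (g s)\<^sup>2)"
      unfolding real_norm_def abs_mult by linarith
  qed
qed (use assms in measurable)

lemma L2_norm_product_integrable:
  assumes "L2_control a b v"
  shows "integrable M (\<lambda>s. \<bar>\<rho> s\<bar> * norm (v s))"
  using assms \<rho>_meas \<rho>_sq by (intro L2_product_integrable) (auto simp: L2_control_def)

lemma L2_inner_integrable:
  fixes v w :: "real \<Rightarrow> 'y"
  assumes "L2_control a b v" "L2_control a b w"
  shows "integrable M (\<lambda>s. inner (v s) (w s))"
proof (rule Bochner_Integration.integrable_bound)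
  show "integrable M (\<lambda>s. norm (v s) * norm (w s))"
    using assms by (intro L2_product_integrable) (auto simp: L2_control_def)
  show "(\<lambda>s. inner (v s) (w s)) \<in> borel_measurable M"
    using assms by (intro borel_measurable_inner) (auto simp: L2_control_def)
qed (auto intro!: AE_I2 Cauchy_Schwarz_ineq2)

lemma L2_control_add_scaleR:
  fixes v w :: "real \<Rightarrow> 'y"
  assumes "L2_control a b v" "L2_control a b w"
  shows "L2_control a b (\<lambda>s. v s + c *\<^sub>R w s)"
    and "(\<integral>s. (norm (v s + c *\<^sub>R w s))\<^sup>2 \<partial>M) = (\<integral>s. (norm (v s))\<^sup>2 \<partial>M)
          + 2 * c * (\<integral>s. inner (v s) (w s) \<partial>M) + c\<^sup>2 * (\<integral>s. (norm (w s))\<^sup>2 \<partial>M)"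
proof -
  have eq: "(norm (v s + c *\<^sub>R w s))\<^sup>2
      = (norm (v s))\<^sup>2 + 2 * c * inner (v s) (w s) + c\<^sup>2 * (norm (w s))\<^sup>2" for s
    unfolding power2_norm_eq_inner
    by (simp add: inner_add inner_commute[of "w s" "v s"] power2_eq_square algebra_simps)
  have meas: "v \<in> borel_measurable M" "w \<in> borel_measurable M"
    and int: "integrable M (\<lambda>s. (norm (v s))\<^sup>2)" "integrable M (\<lambda>s. (norm (w s))\<^sup>2)"
      "integrable M (\<lambda>s. inner (v s) (w s))"
    using assms L2_inner_integrable[OF assms] by (auto simp: L2_control_def)
  show "L2_control a b (\<lambda>s. v s + c *\<^sub>R w s)"
    unfolding L2_control_def eq using int meas
    by (auto intro!: borel_measurable_add borel_measurable_scaleR)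
  show "(\<integral>s. (norm (v s + c *\<^sub>R w s))\<^sup>2 \<partial>M) = (\<integral>s. (norm (v s))\<^sup>2 \<partial>M)
          + 2 * c * (\<integral>s. inner (v s) (w s) \<partial>M) + c\<^sup>2 * (\<integral>s. (norm (w s))\<^sup>2 \<partial>M)"
    unfolding eq using int by simp
qed

lemma steer_strongly_integrable:
  assumes v: "L2_control a b v"
  shows "strongly_integrable M (\<lambda>s. \<rho> s *\<^sub>R Q s (B (v s)))"
proof -
  obtain K where K: "K \<ge> 0" "\<And>s. s \<in> {a..b} \<Longrightarrow> norm (Q s) \<le> K" using Q_bound by metis
  have v_meas: "v \<in> borel_measurable M" using v by (simp add: L2_control_def)
  have id_meas: "(\<lambda>s. s) \<in> borel_measurable M"
    by (intro measurable_restrict_space1 measurable_completion) simp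
  have jc: "continuous_on ({a..b} \<times> UNIV) (\<lambda>(s, x). Q s x)"
    using Q_cont K(2) by (rule jointly_continuous_blinfun)
  have "strongly_integrable M (\<lambda>s. (\<lambda>(r, s, y). r *\<^sub>R Q s (B y)) (\<rho> s, s, v s))"
  proof (rule strongly_integrable_comp[where C = "UNIV \<times> {a..b} \<times> UNIV"])
    show "(\<lambda>s. (\<rho> s, s, v s)) \<in> borel_measurable M"
      using \<rho>_meas id_meas v_meas by (intro borel_measurable_Pair)
    show "continuous_on (UNIV \<times> {a..b} \<times> UNIV) (\<lambda>(r, s, y). r *\<^sub>R Q s (B y))"
    proof -
      have "continuous_on (UNIV \<times> {a..b} \<times> UNIV) (\<lambda>p. (\<lambda>(s, x). Q s x) (fst (snd p), B (snd (snd p))))"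
        by (rule continuous_on_compose2[OF jc]) (auto intro!: continuous_intros)
      then show ?thesis unfolding case_prod_unfold by (intro continuous_on_scaleR continuous_on_fst continuous_on_id) simp
    qed
    show "integrable M (\<lambda>s. (K * norm B) * (\<bar>\<rho> s\<bar> * norm (v s)))"
      using L2_norm_product_integrable[OF v] by (rule integrable_mult_right)
    fix s assume "s \<in> space M"
    then have "norm (Q s (B (v s))) \<le> K * (norm B * norm (v s))"
      using K by (intro order_trans[OF norm_blinfun mult_mono[OF _ norm_blinfun]]) auto
    then have "\<bar>\<rho> s\<bar> * norm (Q s (B (v s))) \<le> \<bar>\<rho> s\<bar> * (K * (norm B * norm (v s)))"
      by (rule mult_left_mono) simp
    then show "norm ((\<lambda>(r, s, y). r *\<^sub>R Q s (B y)) (\<rho> s, s, v s)) \<le> (K * norm B) * (\<bar>\<rho> s\<bar> * norm (v s))"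
      by (simp add: mult_ac)
  qed auto
  then show ?thesis by simp
qed

lemma steer_functional:
  fixes f :: "'x \<Rightarrow>\<^sub>L real"
  assumes v: "L2_control a b v"
  shows "f (steer v) = (\<integral>s. inner (steer_adj f s) (v s) \<partial>M)"
  using bochner_int_functional[OF steer_strongly_integrable[OF v], of f]
  by (simp add: has_bochner_integral_iff steer_def inner_steer_adj blinfun.scaleR_right)

text \<open>
  Strong continuity of \<open>Q\<close> makes the adjoint family weakly continuous, so \<open>steer_adj f\<close> is weakly
  measurable; Pettis' theorem in the separable space \<open>'y\<close> turns this into measurability.
\<close>

lemma steer_adj_L2: "L2_control a b (steer_adj f)"
proof -
  obtain K where K: "K \<ge> 0" "\<And>s. s \<in> {a..b} \<Longrightarrow> norm (Q s) \<le> K" using Q_bound by metis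
  have meas: "steer_adj f \<in> borel_measurable M"
  proof (rule borel_measurable_if_inner_measurable)
    fix y
    have "continuous_on {a..b} (\<lambda>s. f (Q s (B y)))"       by (rule bounded_linear.continuous_on[OF blinfun.bounded_linear_right Q_cont])
    then have "(\<lambda>s. f (Q s (B y))) \<in> borel_measurable M"
      by (rule continuous_imp_measurable_on_sets_lebesgue) simp
    with \<rho>_meas show "(\<lambda>s. inner (steer_adj f s) y) \<in> borel_measurable M"
      unfolding inner_steer_adj by measurable
  qed
  define c where "c = norm (hilbert_adjoint B) * (norm f * K)"
  have "integrable M (\<lambda>s. (norm (steer_adj f s))\<^sup>2)"
  proof (rule Bochner_Integration.integrable_bound)
    show "integrable M (\<lambda>s. c\<^sup>2 * (\<rho> s)\<^sup>2)" using \<rho>_sq by (rule integrable_mult_right)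
    show "(\<lambda>s. (norm (steer_adj f s))\<^sup>2) \<in> borel_measurable M" using meas by measurable
    show "AE s in M. norm ((norm (steer_adj f s))\<^sup>2) \<le> norm (c\<^sup>2 * (\<rho> s)\<^sup>2)"
    proof (rule AE_I2)
      fix s assume "s \<in> space M"
      then have "norm (f o\<^sub>L Q s) \<le> norm f * K"
        using K(2)[of s] norm_blinfun_compose[of f "Q s"] by (auto elim!: order_trans intro!: mult_left_mono)
      then have "norm (hilbert_adjoint B (f o\<^sub>L Q s)) \<le> c"
        unfolding c_def by (meson norm_blinfun mult_left_mono norm_ge_zero order_trans)
      then have "norm (steer_adj f s) \<le> \<bar>\<rho> s\<bar> * c"
        by (simp add: steer_adj_def banach_adjoint_apply mult_left_mono)
      then have "(norm (steer_adj f s))\<^sup>2 \<le> (\<bar>\<rho> s\<bar> * c)\<^sup>2" by (rule power_mono) simp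
      then show "norm ((norm (steer_adj f s))\<^sup>2) \<le> norm (c\<^sup>2 * (\<rho> s)\<^sup>2)"
        by (simp add: power_mult_distrib mult.commute)
    qed
  qed
  with meas show ?thesis by (simp add: L2_control_def)
qed

lemma steer_add_scaleR:
  assumes v: "L2_control a b v" and w: "L2_control a b w"
  shows "steer (\<lambda>s. v s + c *\<^sub>R w s) = steer v + c *\<^sub>R steer w"
proof (rule eq_if_functionals_eq)
  fix f :: "'x \<Rightarrow>\<^sub>L real"
  have "integrable M (\<lambda>s. inner (steer_adj f s) (v s))" "integrable M (\<lambda>s. inner (steer_adj f s) (w s))"
    using v w by (auto intro: L2_inner_integrable steer_adj_L2)
  then show "f (steer (\<lambda>s. v s + c *\<^sub>R w s)) = f (steer v + c *\<^sub>R steer w)"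
    using L2_control_add_scaleR(1)[OF v w] v w
    by (simp add: steer_functional blinfun.add_right blinfun.scaleR_right inner_add_right)
qed

text \<open>The factorisation of \<open>R(b)\<close> as the input map composed with its adjoint.\<close>

lemma gramian_conv_steer: "gramian f = steer (steer_adj f)"
proof -
  obtain K where K: "K \<ge> 0" "\<And>s. s \<in> {a..b} \<Longrightarrow> norm (Q s) \<le> K" using Q_bound by metis
  define F where "F s = (\<rho> s)\<^sup>2 *\<^sub>R (Q s o\<^sub>L B o\<^sub>L hilbert_adjoint B o\<^sub>L banach_adjoint (Q s))" for s
  have F: "F s f = \<rho> s *\<^sub>R Q s (B (steer_adj f s))" for s f
    by (simp add: F_def steer_adj_def blinfun.scaleR_left blinfun.scaleR_right power2_eq_square)
  define c where "c = K * (norm B * (norm (hilbert_adjoint B) * K))"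
  have bound: "norm (F s f) \<le> (c * (\<rho> s)\<^sup>2) * norm f" if s: "s \<in> space M" for s f
  proof -
    have 1: "norm (f o\<^sub>L Q s) \<le> K * norm f"
      using K(2)[of s] s norm_blinfun_compose[of f "Q s"] mult_left_mono[of "norm (Q s)" K "norm f"]
      by (simp add: mult.commute)
    have 2: "norm (hilbert_adjoint B (f o\<^sub>L Q s)) \<le> norm (hilbert_adjoint B) * (K * norm f)"
      using 1 by (meson norm_blinfun mult_left_mono norm_ge_zero order_trans)
    have 3: "norm (B (hilbert_adjoint B (f o\<^sub>L Q s))) \<le> norm B * (norm (hilbert_adjoint B) * (K * norm f))"
      using 2 by (meson norm_blinfun mult_left_mono norm_ge_zero order_trans)
    have "norm (Q s (B (hilbert_adjoint B (f o\<^sub>L Q s)))) \<le> K * (norm B * (norm (hilbert_adjoint B) * (K * norm f)))"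
      using norm_blinfun[of "Q s"] K s
      by (intro order_trans[OF norm_blinfun mult_mono[OF _ 3]]) auto
    from mult_left_mono[OF this, of "(\<rho> s)\<^sup>2"] show ?thesis
      by (simp add: F_def c_def blinfun.scaleR_left banach_adjoint_apply mult_ac)
  qed
  have "gramian f = bochner_int M (\<lambda>s. F s f)"
    unfolding gramian_def F_def[symmetric]
  proof (rule blinfun_apply_strong_int)
    show "strongly_integrable M (\<lambda>s. F s g)" for g
      unfolding F by (rule steer_strongly_integrable[OF steer_adj_L2])
    show "integrable M (\<lambda>s. c * (\<rho> s)\<^sup>2)" using \<rho>_sq by (rule integrable_mult_right)
  qed (rule bound)
  then show ?thesis by (simp add: F steer_def)
qed

lemma gramian_nonneg: "0 \<le> blinfun_apply f (gramian f)"
  unfolding gramian_conv_steer steer_functional[OF steer_adj_L2] by simp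

text \<open>
  If \<open>x\<close> and \<open>y\<close> have the same image, pairing the equation with \<open>J x - J y\<close> leaves
  \<open>lam * (J x - J y) (x - y) \<le> 0\<close>, because the Gramian is nonnegative.
\<close>

lemma regularized_gramian_injective:
  assumes sc: "strictly_convex_space TYPE('x)" and sc': "strictly_convex_space TYPE('x \<Rightarrow>\<^sub>L real)"
    and lam: "lam > 0"
  shows "inj (\<lambda>x. lam *\<^sub>R x + gramian (duality_map x))"
proof (rule injI)
  fix x y assume eq: "lam *\<^sub>R x + gramian (duality_map x) = lam *\<^sub>R y + gramian (duality_map y)"
  define g where "g = duality_map x - duality_map y"
  have "lam *\<^sub>R (x - y) = - gramian g"
    using eq by (simp add: g_def blinfun.diff_right scaleR_diff_right algebra_simps)
  then have "lam * g (x - y) = - g (gramian g)"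
    by (metis blinfun.minus_right blinfun.scaleR_right real_scaleR_def)
  then have "lam * g (x - y) \<le> 0" using gramian_nonneg[of g] by simp
  then have "g (x - y) \<le> 0" using lam by (simp add: mult_le_0_iff)
  then show "x = y" unfolding g_def by (rule duality_map_strictly_monotone[OF sc sc'])
qed

text \<open>
  Let \<open>y = z - steer u\<close> be the residual.  Stationarity of the cost at \<open>u\<close> says
  \<open>lam *\<^sub>R u = steer_adj (J y)\<close> almost everywhere.  Applying \<open>steer\<close>, one gets
  \<open>lam *\<^sub>R steer u = gramian (J y)\<close>, so that \<open>x = y / lam\<close> solves \<open>lam *\<^sub>R x + gramian (J x) = z\<close>,
  the duality mapping being homogeneous.  Injectivity makes \<open>x\<close> the value of the inverse at \<open>z\<close>,
  and \<open>u = steer_adj (J x)\<close>.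
\<close>

theorem optimal_control_feedback:
  assumes sc: "strictly_convex_space TYPE('x)" and sc': "strictly_convex_space TYPE('x \<Rightarrow>\<^sub>L real)"
    and lam: "lam > 0" and u: "L2_control a b u"
    and opt: "\<And>v. L2_control a b v \<Longrightarrow>
      (norm (z - steer u))\<^sup>2 + lam * (\<integral>t. (norm (u t))\<^sup>2 \<partial>M)
      \<le> (norm (z - steer v))\<^sup>2 + lam * (\<integral>t. (norm (v t))\<^sup>2 \<partial>M)"
  shows "AE t in M. u t = steer_adj (duality_map (inv (\<lambda>x. lam *\<^sub>R x + gramian (duality_map x)) z)) t"
proof -
  define y where "y = z - steer u"
  define w where "w = steer_adj (duality_map y)"
  have w: "L2_control a b w" unfolding w_def by (rule steer_adj_L2)
  have first_order: "duality_map y (steer h) \<le> lam * (\<integral>t. inner (u t) (h t) \<partial>M)"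
    if h: "L2_control a b h" for h
  proof -
    have "0 \<le> duality_map y (- steer h) + lam * (\<integral>t. inner (u t) (h t) \<partial>M)"
    proof (rule duality_map_first_order[OF sc'])
      fix t :: real assume "t > 0"
      from opt[OF L2_control_add_scaleR(1)[OF u h, of t]]
      show "(norm y)\<^sup>2 \<le> (norm (y + t *\<^sub>R - steer h))\<^sup>2 + 2 * t * (lam * (\<integral>t. inner (u t) (h t) \<partial>M))
          + t\<^sup>2 * (lam * (\<integral>t. (norm (h t))\<^sup>2 \<partial>M))"
        unfolding steer_add_scaleR[OF u h] L2_control_add_scaleR(2)[OF u h]
        by (simp add: y_def algebra_simps)
    qed
    then show ?thesis by (simp add: blinfun.minus_right)
  qed
  \<comment> \<open>Testing with the gradient itself turns the one-sided inequality into an equation.\<close>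
  define e where "e s = w s + (- lam) *\<^sub>R u s" for s
  have e: "L2_control a b e" unfolding e_def using w u by (rule L2_control_add_scaleR(1))
  have "(\<integral>s. (norm (e s))\<^sup>2 \<partial>M) = (\<integral>s. inner (w s) (e s) - lam * inner (u s) (e s) \<partial>M)"
    by (simp add: e_def power2_norm_eq_inner inner_diff_left)
  also have "\<dots> = duality_map y (steer e) - lam * (\<integral>s. inner (u s) (e s) \<partial>M)"
    using L2_inner_integrable[OF w e] L2_inner_integrable[OF u e]
    by (simp add: steer_functional[OF e] w_def)
  also have "\<dots> \<le> 0" using first_order[OF e] by simp
  finally have "(\<integral>s. (norm (e s))\<^sup>2 \<partial>M) = 0"
    by (intro antisym integral_nonneg_AE) auto
  then have "AE s in M. (norm (e s))\<^sup>2 = 0"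
    using e by (subst (asm) integral_nonneg_eq_0_iff_AE) (auto simp: L2_control_def)
  then have ae: "AE s in M. u s = (1 / lam) *\<^sub>R w s"
    by (rule eventually_mono) (use lam in \<open>auto simp: e_def\<close>)
  define x where "x = (1 / lam) *\<^sub>R y"
  have Jx: "duality_map x = (1 / lam) *\<^sub>R duality_map y"
    unfolding x_def by (rule duality_map_scaleR[OF sc'])
  have "steer u = gramian (duality_map x)"
  proof (rule eq_if_functionals_eq)
    fix f :: "'x \<Rightarrow>\<^sub>L real"
    have "f (steer u) = (\<integral>s. (1 / lam) * inner (steer_adj f s) (w s) \<partial>M)"
      unfolding steer_functional[OF u]
    proof (rule integral_cong_AE)
      show "(\<lambda>s. inner (steer_adj f s) (u s)) \<in> borel_measurable M"
        using L2_inner_integrable[OF steer_adj_L2 u] by auto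
      show "(\<lambda>s. (1 / lam) * inner (steer_adj f s) (w s)) \<in> borel_measurable M"
        using L2_inner_integrable[OF steer_adj_L2 w] by auto
    qed (use ae in \<open>auto elim!: eventually_mono\<close>)
    also have "\<dots> = f (gramian (duality_map x))"
      using steer_functional[OF w, of f]
      by (simp add: Jx blinfun.scaleR_right gramian_conv_steer w_def)
    finally show "f (steer u) = f (gramian (duality_map x))" .
  qed
  then have "lam *\<^sub>R x + gramian (duality_map x) = z" using lam by (simp add: x_def y_def)
  then have "inv (\<lambda>x. lam *\<^sub>R x + gramian (duality_map x)) z = x"
    by (intro inv_f_eq regularized_gramian_injective sc sc' lam)
  with ae show ?thesis by (simp add: Jx steer_adj_scaleR w_def)
qed

end

section \<open>Optimal control of the Hilfer system\<close>

lemma mono_derivative_pos: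
  fixes \<psi> \<psi>' :: "real \<Rightarrow> real"
  assumes "a < b" and t: "t \<in> {a..b}"
    and der: "(\<psi> has_real_derivative \<psi>' t) (at t within {a..b})"
    and mono: "mono_on {a..b} \<psi>" and nz: "\<psi>' t \<noteq> 0"
  shows "\<psi>' t > 0"
proof -
  have "((\<lambda>y. (\<psi> y - \<psi> t) / (y - t)) \<longlongrightarrow> \<psi>' t) (at t within {a..b})"
    using der by (simp add: has_field_derivative_iff)
  moreover have "\<forall>\<^sub>F y in at t within {a..b}. 0 \<le> (\<psi> y - \<psi> t) / (y - t)"
    unfolding eventually_at_filter
  proof (rule always_eventually, intro allI impI)
    fix y assume "y \<noteq> t" "y \<in> {a..b}"
    with mono_onD[OF mono, of y t] mono_onD[OF mono, of t y] t
    show "0 \<le> (\<psi> y - \<psi> t) / (y - t)" by (cases "y < t") (auto simp: zero_le_divide_iff)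
  qed
  moreover have "at t within {a..b} \<noteq> bot"
    using assms by (simp add: trivial_limit_within islimpt_Icc)
  ultimately have "0 \<le> \<psi>' t" by (rule tendsto_lowerbound)
  with nz show ?thesis by simp
qed

lemma integrable_powr_reflected:
  fixes a b p :: real
  assumes "a \<le> b" "p > -1"
  shows "integrable (lebesgue_on {a..b}) (\<lambda>s. (b - s) powr p)"
proof -
  have "((\<lambda>x. x powr p) has_integral ((b - a) powr (p + 1) / (p + 1))) (cbox 0 (b - a))"
    using has_integral_powr_from_0[of p "b - a"] assms by simp
  from has_integral_affinity[OF this, of "-1" b]
  have "(\<lambda>s. (b - s) powr p) integrable_on (\<lambda>x. b - x) ` {0..b - a}"
    by (auto simp: integrable_on_def image_def)
  moreover have "(\<lambda>x. b - x) ` {0..b - a} = {a..b}" using assms by simp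
  ultimately have "(\<lambda>s. (b - s) powr p) integrable_on {a..b}" by simp
  then have "(\<lambda>s. (b - s) powr p) absolutely_integrable_on {a..b}"
    by (intro nonnegative_absolutely_integrable_1) auto
  then show ?thesis by (intro absolutely_integrable_imp_integrable) auto
qed

text \<open>
  If \<open>m > 0\<close> is the minimum of \<open>\<psi>'\<close>, then \<open>\<psi> b - \<psi> s \<ge> m (b - s)\<close>, and the square of the kernel
  is dominated by a multiple of \<open>(b - s) powr (2 \<alpha> - 2)\<close>; that is integrable exactly for
  \<open>\<alpha> > 1/2\<close>.  At \<open>s = b\<close> the kernel vanishes, since \<open>0 powr x = 0\<close>.
\<close>

lemma psi_kernel_square_integrable:
  fixes \<psi> \<psi>' :: "real \<Rightarrow> real"
  assumes ab: "a < b" and \<alpha>: "1/2 < \<alpha>" "\<alpha> \<le> 1"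
    and der: "\<And>t. t \<in> {a..b} \<Longrightarrow> (\<psi> has_real_derivative \<psi>' t) (at t within {a..b})"
    and cont: "continuous_on {a..b} \<psi>'" and pos: "\<And>t. t \<in> {a..b} \<Longrightarrow> \<psi>' t > 0"
  defines "\<rho> \<equiv> \<lambda>s. \<psi>' s * (\<psi> b - \<psi> s) powr (\<alpha> - 1)"
  shows "\<rho> \<in> borel_measurable (lebesgue_on {a..b})"
    and "integrable (lebesgue_on {a..b}) (\<lambda>s. (\<rho> s)\<^sup>2)"
proof -
  have \<psi>_cont: "continuous_on {a..b} \<psi>" using der by (rule DERIV_continuous_on)
  have [measurable]: "\<psi> \<in> borel_measurable (lebesgue_on {a..b})" "\<psi>' \<in> borel_measurable (lebesgue_on {a..b})"
    using \<psi>_cont cont by (auto intro: continuous_imp_measurable_on_sets_lebesgue)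
  show meas: "\<rho> \<in> borel_measurable (lebesgue_on {a..b})" unfolding \<rho>_def by measurable
  obtain tm where tm: "tm \<in> {a..b}" "\<And>t. t \<in> {a..b} \<Longrightarrow> \<psi>' tm \<le> \<psi>' t"
    using continuous_attains_inf[OF _ _ cont] ab by auto
  obtain tM where tM: "tM \<in> {a..b}" "\<And>t. t \<in> {a..b} \<Longrightarrow> \<psi>' t \<le> \<psi>' tM"
    using continuous_attains_sup[OF _ _ cont] ab by auto
  define m where "m = \<psi>' tm"
  define C where "C = \<psi>' tM"
  have m: "m > 0" unfolding m_def using pos tm(1) .
  have low: "m * (b - s) \<le> \<psi> b - \<psi> s" if s: "a \<le> s" "s < b" for s
  proof -
    have "(\<psi> has_derivative (\<lambda>h. h * \<psi>' x)) (at x within {s..b})" if "s \<le> x" "x \<le> b" for x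
      using has_field_derivative_subset[OF der[of x], of "{s..b}"] that s
      by (auto simp: has_field_derivative_def mult_commute_abs)
    from mvt_simple[OF s(2) this] obtain x where "x \<in> {s<..<b}" "\<psi> b - \<psi> s = (b - s) * \<psi>' x" by blast
    with tm(2)[of x] s show ?thesis by (simp add: m_def mult.commute)
  qed
  show "integrable (lebesgue_on {a..b}) (\<lambda>s. (\<rho> s)\<^sup>2)"
  proof (rule Bochner_Integration.integrable_bound)
    show "integrable (lebesgue_on {a..b}) (\<lambda>s. C\<^sup>2 * m powr (2 * \<alpha> - 2) * (b - s) powr (2 * \<alpha> - 2))"
      using ab \<alpha> by (intro integrable_mult_right integrable_powr_reflected) auto
    show "(\<lambda>s. (\<rho> s)\<^sup>2) \<in> borel_measurable (lebesgue_on {a..b})" using meas by measurable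
    show "AE s in lebesgue_on {a..b}. norm ((\<rho> s)\<^sup>2) \<le> norm (C\<^sup>2 * m powr (2 * \<alpha> - 2) * (b - s) powr (2 * \<alpha> - 2))"
    proof (rule AE_I2)
      fix s assume "s \<in> space (lebesgue_on {a..b})"
      then have s: "s \<in> {a..b}" by simp
      show "norm ((\<rho> s)\<^sup>2) \<le> norm (C\<^sup>2 * m powr (2 * \<alpha> - 2) * (b - s) powr (2 * \<alpha> - 2))"
      proof (cases "s = b")
        case False
        with s have sb: "a \<le> s" "s < b" by auto
        have "((\<psi> b - \<psi> s) powr (\<alpha> - 1))\<^sup>2 = (\<psi> b - \<psi> s) powr (2 * \<alpha> - 2)"
          by (simp add: power2_eq_square flip: powr_add)
        also have "\<dots> \<le> (m * (b - s)) powr (2 * \<alpha> - 2)"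
          using low[OF sb] m sb \<alpha> by (intro powr_mono2') auto
        also have "\<dots> = m powr (2 * \<alpha> - 2) * (b - s) powr (2 * \<alpha> - 2)"
          using m sb by (simp add: powr_mult)
        finally have "(\<psi>' s)\<^sup>2 * ((\<psi> b - \<psi> s) powr (\<alpha> - 1))\<^sup>2
            \<le> C\<^sup>2 * (m powr (2 * \<alpha> - 2) * (b - s) powr (2 * \<alpha> - 2))"
          using tM(2)[OF s] pos[OF s] by (intro mult_mono power_mono) (auto simp: C_def)
        then show ?thesis by (simp add: \<rho>_def power_mult_distrib mult_ac)
      qed (simp add: \<rho>_def)
    qed
  qed
qed

theorem lemma4p12:
  fixes a b \<alpha> \<beta> lam :: real
    and \<psi> \<psi>' :: "real \<Rightarrow> real"
    and D :: "'x::banach set"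
    and A :: "'x \<Rightarrow> 'x"
    and T :: "real \<Rightarrow> 'x \<Rightarrow>\<^sub>L 'x"
    and B :: "'y::{real_inner, banach, second_countable_topology} \<Rightarrow>\<^sub>L 'x"
    and x0 xb :: 'x
    and u :: "real \<Rightarrow> 'y"
  assumes "a < b"
    and "1/2 < \<alpha>" and "\<alpha> \<le> 1"
    and "0 \<le> \<beta>" and "\<beta> \<le> 1"
    and "\<And>t. t \<in> {a..b} \<Longrightarrow> (\<psi> has_real_derivative \<psi>' t) (at t within {a..b})"
    and "continuous_on {a..b} \<psi>'"
    and "mono_on {a..b} \<psi>"
    and "\<And>t. t \<in> {a..b} \<Longrightarrow> \<psi>' t \<noteq> 0"
    and "reflexive_space TYPE('x)"
    and "strictly_convex_space TYPE('x)"
    and "strictly_convex_space TYPE('x \<Rightarrow>\<^sub>L real)"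
    and "generates_C0_semigroup D A T"
    and "lam > 0"
    and "optimal_control \<alpha> \<beta> \<psi> \<psi>' T B a b x0 xb lam u"
  shows "AE t in lebesgue_on {a..b}.
           u t = (\<psi>' t * (\<psi> b - \<psi> t) powr (\<alpha> - 1)) *\<^sub>R
                 blinfun_apply (hilbert_adjoint B)
                   (blinfun_apply (banach_adjoint (P_op \<alpha> T (\<psi> b - \<psi> t)))
                     (duality_map
                       (inv (\<lambda>x. lam *\<^sub>R x + blinfun_apply (R_op \<alpha> \<psi> \<psi>' T B a b) (duality_map x))
                         (xb - blinfun_apply (S_op \<alpha> \<beta> T (\<psi> b - \<psi> a)) x0))))"
proof -
  note ab = assms(1) and \<alpha> = assms(2,3) and der = assms(6) and mono = assms(8)
  define \<rho> where "\<rho> s = \<psi>' s * (\<psi> b - \<psi> s) powr (\<alpha> - 1)" for s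
  define Q where "Q s = P_op \<alpha> T (\<psi> b - \<psi> s)" for s
  define z where "z = xb - S_op \<alpha> \<beta> T (\<psi> b - \<psi> a) x0"
  have pos: "\<psi>' t > 0" if "t \<in> {a..b}" for t
    using ab that der[OF that] mono assms(9)[OF that] by (rule mono_derivative_pos)
  have T: "C0_semigroup T" using assms(13) by (simp add: generates_C0_semigroup_def)
  have range: "\<psi> b - \<psi> s \<in> {0..\<psi> b - \<psi> a}" if "s \<in> {a..b}" for s
    using mono_onD[OF mono, of a s] mono_onD[OF mono, of s b] that by auto
  have \<psi>_cont: "continuous_on {a..b} \<psi>" using der by (rule DERIV_continuous_on)
  have \<tau>: "0 \<le> \<psi> b - \<psi> a" using range[of a] ab by simp
  have "0 < \<alpha>" using \<alpha> by simp
  note P = P_op_strongly_continuous[OF T \<open>0 < \<alpha>\<close> \<alpha>(2) \<tau>]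
  interpret kernel_control a b \<rho> Q B
  proof
    show "\<rho> \<in> borel_measurable (lebesgue_on {a..b})" "integrable (lebesgue_on {a..b}) (\<lambda>s. (\<rho> s)\<^sup>2)"
      unfolding \<rho>_def using psi_kernel_square_integrable[OF ab \<alpha> der assms(7) pos] by auto
    show "continuous_on {a..b} (\<lambda>s. Q s x)" for x
      unfolding Q_def using range
      by (intro continuous_on_compose2[OF P(1)] continuous_intros \<psi>_cont) auto
    show "\<exists>K. \<forall>s\<in>{a..b}. norm (Q s) \<le> K" unfolding Q_def using P(2) range by blast
  qed
  have u: "L2_control a b u"
    and opt: "\<And>v. L2_control a b v \<Longrightarrow>
        cost a b xb lam (mild_solution \<alpha> \<beta> \<psi> \<psi>' T B a x0 u) u
        \<le> cost a b xb lam (mild_solution \<alpha> \<beta> \<psi> \<psi>' T B a x0 v) v"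
    using assms(15) by (auto simp: optimal_control_def)
  have cost: "cost a b xb lam (mild_solution \<alpha> \<beta> \<psi> \<psi>' T B a x0 v) v
      = (norm (z - steer v))\<^sup>2 + lam * (\<integral>t. (norm (v t))\<^sup>2 \<partial>lebesgue_on {a..b})" for v
  proof -
    have "mild_solution \<alpha> \<beta> \<psi> \<psi>' T B a x0 v b - xb = - (z - steer v)"
      by (simp add: mild_solution_def steer_def \<rho>_def Q_def z_def)
    then show ?thesis by (simp only: cost_def norm_minus_cancel)
  qed
  have gramian: "gramian = R_op \<alpha> \<psi> \<psi>' T B a b"
    by (simp add: gramian_def R_op_def \<rho>_def Q_def)
  have "AE t in lebesgue_on {a..b}.
      u t = steer_adj (duality_map (inv (\<lambda>x. lam *\<^sub>R x + gramian (duality_map x)) z)) t"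
    using opt unfolding cost by (intro optimal_control_feedback assms(11,12,14) u)
  then show ?thesis
    unfolding gramian by (simp only: steer_adj_def \<rho>_def Q_def z_def)
qed

end
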